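(* For every $n\in\mathbb{N}$, $n\ge1$, and every prime number $p>2$, the cup length of the reduced integral cohomology of the moment angle complex of $X(\mathbb{F}_p^n)$ is $$\mathrm{cup}\,\widetilde{H}^*(\mathcal{Z}_{X(\mathbb{F}_p^n)};\mathbb{Z})=n.$$
   Context: $X(\mathbb{F}_p^n)$ is the simplicial complex whose vertices are the nonzero vectors of $\mathbb{F}_p^n$ and whose simplices are the linearly independent subsets of $\mathbb{F}_p^n$. For a simplicial complex $\mathcal{K}$ on $[m]$, the moment angle complex is $\mathcal{Z}_{\mathcal{K}}=\bigcup_{\sigma\in\mathcal{K}}\prod_{i=1}^mY_i^\sigma\subseteq(D^2)^m$, where $Y_i^\sigma=D^2$ if $i\in\sigma$ and $Y_i^\sigma=S^1=\partial D^2$ if $i\notin\sigma$. The cup length $\mathrm{cup}\,\widetilde{H}^*(Y;\mathbb{Z})$ is the largest $k$ such that there are classes $\alpha_1,\dots,\alpha_k\in\widetilde{H}^*(Y;\mathbb{Z})$ with $\alpha_1\smile\cdots\smile\alpha_k\ne0$. *)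

theory Defs
  imports
    "HOL-Homology.Homology"
    "HOL-Algebra.QuotRing"
    "HOL-Library.Extended_Nat"
    "HOL-Number_Theory.Residues"
    "Jordan_Normal_Form.Missing_VectorSpace"
begin

section \<open>Integral singular cohomology with its cup product\<close>

text \<open>
  An element of the direct sum of the groups C^q(X;Z) over all q, where C^q(X;Z) consists of the
  integer-valued functions on the singular q-simplices of X; the first argument is the degree q.
\<close>

type_synonym 'a cochain = "nat \<Rightarrow> ((nat \<Rightarrow> real) \<Rightarrow> 'a) \<Rightarrow> int"

definition cochains :: "'a topology \<Rightarrow> 'a cochain set" where
  "cochains X = {c. (\<forall>q s. \<not> singular_simplex q X s \<longrightarrow> c q s = 0) \<and> finite {q. \<exists>s. c q s \<noteq> 0}}"

definition coboundary :: "'a topology \<Rightarrow> 'a cochain \<Rightarrow> 'a cochain" where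
  "coboundary X c = (\<lambda>q s.
     if 0 < q \<and> singular_simplex q X s
     then \<Sum>k\<le>q. (-1) ^ k * c (q - 1) (singular_face q k s) else 0)"

text \<open>
  For a singular r-simplex s and p \<open>\<le>\<close> r these are the restrictions of s to the faces
  [v_0,...,v_p] and (with q = r - p) [v_p,...,v_r].
\<close>

definition front_face :: "nat \<Rightarrow> ((nat \<Rightarrow> real) \<Rightarrow> 'a) \<Rightarrow> (nat \<Rightarrow> real) \<Rightarrow> 'a" where
  "front_face p s = restrict s (standard_simplex p)"

definition back_face :: "nat \<Rightarrow> nat \<Rightarrow> ((nat \<Rightarrow> real) \<Rightarrow> 'a) \<Rightarrow> (nat \<Rightarrow> real) \<Rightarrow> 'a" where
  "back_face p q s = restrict (\<lambda>x. s (\<lambda>i. if i < p then 0 else x (i - p))) (standard_simplex q)"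

definition cup_product :: "'a topology \<Rightarrow> 'a cochain \<Rightarrow> 'a cochain \<Rightarrow> 'a cochain" where
  "cup_product X a b = (\<lambda>r s.
     if singular_simplex r X s
     then \<Sum>p\<le>r. a p (front_face p s) * b (r - p) (back_face p (r - p) s) else 0)"

definition cocycle_ring :: "'a topology \<Rightarrow> 'a cochain ring" where
  "cocycle_ring X =
     \<lparr>carrier = {c \<in> cochains X. coboundary X c = (\<lambda>q s. 0)},
      monoid.mult = cup_product X,
      one = (\<lambda>q s. if q = 0 \<and> singular_simplex 0 X s then 1 else 0),
      zero = (\<lambda>q s. 0),
      add = (\<lambda>a b q s. a q s + b q s)\<rparr>"

definition coboundaries :: "'a topology \<Rightarrow> 'a cochain set" where
  "coboundaries X = coboundary X ` cochains X"

text \<open>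
  Both the cocycles and the coboundaries are graded, so this quotient is the direct sum of the
  groups H^q(X;Z), with the cup product as multiplication.
\<close>

definition cohomology_ring :: "'a topology \<Rightarrow> 'a cochain set ring" where
  "cohomology_ring X = cocycle_ring X Quot coboundaries X"

definition cochain_pullback :: "'a topology \<Rightarrow> ('a \<Rightarrow> 'b) \<Rightarrow> 'b cochain \<Rightarrow> 'a cochain" where
  "cochain_pullback X f c = (\<lambda>q s. if singular_simplex q X s then c q (simplex_map q f s) else 0)"

text \<open>
  The map induced by a continuous f from X; all members of the union are the same coset when A is
  a cohomology class of the codomain.
\<close>

definition cohomology_map :: "'a topology \<Rightarrow> ('a \<Rightarrow> 'b) \<Rightarrow> 'b cochain set \<Rightarrow> 'a cochain set" where
  "cohomology_map X f A =
     (\<Union>a\<in>A. coboundaries X +>\<^bsub>cocycle_ring X\<^esub> cochain_pullback X f a)"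

text \<open>
  Reduced cohomology, as the kernel of the restriction of H^*(X;Z) to the base point. It is an
  ideal of the cohomology ring, and so closed under cup products.
\<close>

definition reduced_cohomology :: "'a topology \<Rightarrow> 'a \<Rightarrow> 'a cochain set set" where
  "reduced_cohomology X x0 =
     a_kernel (cohomology_ring X) (cohomology_ring (subtopology X {x0}))
       (cohomology_map (subtopology X {x0}) id)"

text \<open>
  The supremum in the extended naturals is the maximum if there is one, infinity if there are
  arbitrarily long non-vanishing products, and 0 if every class of reduced cohomology vanishes.
\<close>

definition cup_length :: "'a topology \<Rightarrow> 'a \<Rightarrow> enat" where
  "cup_length X x0 =
     Sup {enat (length as) |as. as \<noteq> [] \<and> set as \<subseteq> reduced_cohomology X x0 \<and>
            foldr (\<otimes>\<^bsub>cohomology_ring X\<^esub>) as \<one>\<^bsub>cohomology_ring X\<^esub> \<noteq> \<zero>\<^bsub>cohomology_ring X\<^esub>}"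


section \<open>Moment angle complexes\<close>

text \<open>
  The moment angle complex of an abstract simplicial complex K with vertex set V, where K is given
  by its set of simplices (including the empty one). The coordinates are indexed by V itself
  rather than by a numbering of V, and the unit disc is taken in the complex plane.
\<close>

definition moment_angle_complex :: "'v set \<Rightarrow> 'v set set \<Rightarrow> ('v \<Rightarrow> complex) topology" where
  "moment_angle_complex V K =
     subtopology (product_topology (\<lambda>i. top_of_set (cball 0 1)) V)
       (\<Union>\<sigma>\<in>K. PiE V (\<lambda>i. if i \<in> \<sigma> then cball 0 1 else sphere 0 1))"


section \<open>The complex of linearly independent sets of vectors\<close>

abbreviation prime_field :: "nat \<Rightarrow> int ring" where
  "prime_field p \<equiv> residue_ring (int p)"

definition coord_space :: "nat \<Rightarrow> nat \<Rightarrow> (int, nat \<Rightarrow> int) module" where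
  "coord_space p n = ring.func_space (prime_field p) {..<n}"

definition nonzero_vectors :: "nat \<Rightarrow> nat \<Rightarrow> (nat \<Rightarrow> int) set" where
  "nonzero_vectors p n = carrier (coord_space p n) - {\<zero>\<^bsub>coord_space p n\<^esub>}"

definition indep_complex :: "nat \<Rightarrow> nat \<Rightarrow> (nat \<Rightarrow> int) set set" where
  "indep_complex p n =
     {\<sigma>. \<sigma> \<subseteq> carrier (coord_space p n) \<and>
          \<not> module.lin_dep (prime_field p) (coord_space p n) \<sigma>}"

text \<open>
  Base points exist, so quantifying over all of them in a hypothesis is not vacuous.
\<close>

lemma topspace_moment_angle_indep_complex_nonempty:
  assumes "prime p"
  shows "topspace (moment_angle_complex (nonzero_vectors p n) (indep_complex p n)) \<noteq> {}"
proof -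
  interpret residues_prime p "prime_field p"
    using assms by unfold_locales auto
  interpret M: module "prime_field p" "coord_space p n"
    unfolding coord_space_def by (rule func_space_is_module)
  have "{} \<in> indep_complex p n"
    by (auto simp: indep_complex_def M.lin_dep_def)
  then have "restrict (\<lambda>i. 1) (nonzero_vectors p n) \<in>
      topspace (moment_angle_complex (nonzero_vectors p n) (indep_complex p n))"
    by (auto simp: moment_angle_complex_def intro!: bexI[of _ "{}"])
  then show ?thesis by blast
qed

end

(*
  Upper bound. Every simplex has at most n vertices. Sort the points z of the moment angle complex
  by the set sigma of their small coordinates: the points with |z_i| < |z_j| for all i in sigma and
  j not in sigma, and z_j nonzero for j not in sigma, form an open set that contracts inside the
  complex, first to a torus and then, one coordinate at a time through the corresponding disc, to a
  point. For a fixed size of sigma these sets are disjoint, so n + 1 contractible open sets cover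
  the complex. As in the Lusternik-Schnirelmann theorem, representatives of n + 1 reduced classes
  can be chosen to vanish on one of these sets each. Their product vanishes on all simplices that
  are small with respect to the cover, and barycentric subdivision makes it a coboundary.

  Lower bound. Since p > 2, the vectors e_i and 2 e_i are distinct, and they span a cross polytope
  in the complex, which yields a product of n three-spheres in the moment angle complex together
  with coordinates to each factor that are defined on the whole complex. The degree 3 cocycle of
  a factor arises from the sign of its first coordinate by three Mayer-Vietoris steps. In parallel,
  a cycle is suspended by subtracting its two cones, and the value of the product cocycle on the
  cycle does not change. So the product of the n cocycles has value 1 on a cycle.
*)

theory Submission
  imports Defs
begin

text \<open>The cohomology of a sphere and a Kuenneth formula are never computed. The lower bound
  only needs one integer, the value of a cocycle on a cycle. The induction controls it because its
  statement is quantified over an arbitrary cocycle and an arbitrary cycle on the factors built so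
  far: one and the same step builds a sphere and multiplies by its class. Evaluation on chains
  requires cochains that equal prescribed ones on open sets, not merely up to coboundaries. So the
  passage to small chains has to fix small chains exactly. The obstacle is that the number of
  subdivisions that makes a simplex small depends on the simplex, and the numbers used for a simplex
  and for its faces have to be reconciled. The sets of the cover are in general disconnected. What
  contracts is their inclusion into the complex, and the argument for the upper bound uses only
  this. The three-sphere is the boundary of a product of two discs, which is the moment angle
  complex of two points. Its dimension is odd, and cocycles of odd degree vanish on constant
  simplices, so their classes are reduced for every base point.\<close>

section \<open>Evaluation of cochains on chains\<close>

text \<open>\<open>frag_extend\<close> only maps into free abelian groups. The integers therefore
  appear as the free group on the single element of \<open>unit\<close>, and the coefficient of
  \<open>()\<close> is read off.\<close>

definition frag_eval :: "('b \<Rightarrow> int) \<Rightarrow> ('b \<Rightarrow>\<^sub>0 int) \<Rightarrow> int" where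
  "frag_eval \<phi> x = Poly_Mapping.lookup (frag_extend (\<lambda>s. frag_cmul (\<phi> s) (frag_of ())) x) ()"

lemma frag_eval_0 [simp]: "frag_eval \<phi> 0 = 0"
  by (simp add: frag_eval_def)

lemma frag_eval_of [simp]: "frag_eval \<phi> (frag_of s) = \<phi> s"
  by (simp add: frag_eval_def)

lemma frag_eval_add: "frag_eval \<phi> (x + y) = frag_eval \<phi> x + frag_eval \<phi> y"
  by (simp add: frag_eval_def frag_extend_add lookup_add)

lemma frag_eval_diff: "frag_eval \<phi> (x - y) = frag_eval \<phi> x - frag_eval \<phi> y"
  by (simp add: frag_eval_def frag_extend_diff lookup_minus)

lemma frag_eval_cmul: "frag_eval \<phi> (frag_cmul k x) = k * frag_eval \<phi> x"
  by (simp add: frag_eval_def frag_extend_cmul)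

lemma frag_eval_sum: "frag_eval \<phi> (sum f I) = (\<Sum>i\<in>I. frag_eval \<phi> (f i))"
  by (induction I rule: infinite_finite_induct) (simp_all add: frag_eval_add)

lemma frag_eval_cong:
  assumes "\<And>s. s \<in> Poly_Mapping.keys x \<Longrightarrow> \<phi> s = \<psi> s"
  shows "frag_eval \<phi> x = frag_eval \<psi> x"
  unfolding frag_eval_def using assms by (metis (mono_tags, lifting) frag_extend_eq)

lemma frag_eval_eq_0:
  assumes "\<And>s. s \<in> Poly_Mapping.keys x \<Longrightarrow> \<phi> s = 0"
  shows "frag_eval \<phi> x = 0"
  unfolding frag_eval_def using assms by (simp add: frag_extend_eq_0)

lemma coboundary_apply:
  assumes "singular_simplex (Suc q) X s"
  shows "coboundary X c (Suc q) s = frag_eval (c q) (chain_boundary (Suc q) (frag_of s))"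
  using assms
  by (simp add: coboundary_def chain_boundary_of frag_eval_sum frag_eval_cmul del: sum.atMost_Suc)

text \<open>The coboundary is the transpose of the boundary. Since \<open>coboundary\<close> is cut
  off outside the singular simplices, this is an identity on singular chains.\<close>

lemma frag_eval_coboundary:
  assumes "singular_chain (Suc q) X x"
  shows "frag_eval (coboundary X c (Suc q)) x = frag_eval (c q) (chain_boundary (Suc q) x)"
  using assms unfolding singular_chain_def
  by (induction x rule: frag_induction)
     (auto simp: frag_eval_diff chain_boundary_diff coboundary_apply)

lemma coboundary_0 [simp]: "coboundary X c 0 s = 0"
  by (simp add: coboundary_def)

lemma coboundary_non_simplex: "\<not> singular_simplex q X s \<Longrightarrow> coboundary X c q s = 0"
  by (simp add: coboundary_def)

lemma coboundary_coboundary: "coboundary X (coboundary X c) = (\<lambda>q s. 0)"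
proof (intro ext)
  fix q s
  show "coboundary X (coboundary X c) q s = 0"
  proof (cases "\<exists>q'. q = Suc (Suc q') \<and> singular_simplex q X s")
    case True
    then obtain q' where q: "q = Suc (Suc q')" and s: "singular_simplex (Suc (Suc q')) X s"
      by auto
    have c1: "singular_chain (Suc (Suc q')) X (frag_of s)"
      using s by (simp add: singular_chain_of)
    then have "singular_chain (Suc q') X (chain_boundary (Suc (Suc q')) (frag_of s))"
      by (rule singular_chain_boundary_alt)
    then show ?thesis
      using s chain_boundary_boundary_alt [OF c1]
      by (simp add: q coboundary_apply frag_eval_coboundary)
  next
    case False
    then show ?thesis
      by (cases q; cases "q - 1") (auto simp: coboundary_def)
  qed
qed

lemma cochains_supportD: "c \<in> cochains X \<Longrightarrow> \<not> singular_simplex q X s \<Longrightarrow> c q s = 0"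
  by (simp add: cochains_def)

lemma singular_simplex_of_subtopology:
  "singular_simplex q (subtopology X S) s \<Longrightarrow> singular_simplex q X s"
  by (simp add: singular_simplex_subtopology)

lemma singular_chain_of_subtopology:
  "singular_chain q (subtopology X S) c \<Longrightarrow> singular_chain q X c"
  by (simp add: singular_chain_subtopology)

lemma cochains_subtopology: "c \<in> cochains (subtopology X S) \<Longrightarrow> c \<in> cochains X"
  by (auto simp: cochains_def singular_simplex_subtopology)

lemma coboundary_subtopology:
  "singular_simplex q (subtopology X S) s \<Longrightarrow> coboundary (subtopology X S) c q s = coboundary X c q s"
  by (simp add: coboundary_def singular_simplex_of_subtopology)

lemma coboundary_in_cochains:
  assumes "c \<in> cochains X"
  shows "coboundary X c \<in> cochains X"
proof -
  have "{q. \<exists>s. coboundary X c q s \<noteq> 0} \<subseteq> Suc ` {q. \<exists>s. c q s \<noteq> 0}"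
  proof clarify
    fix q s
    assume nz: "coboundary X c q s \<noteq> 0"
    then obtain q' where q: "q = Suc q'"
      by (metis coboundary_0 not0_implies_Suc)
    have "\<exists>s. c q' s \<noteq> 0"
    proof (rule ccontr)
      assume "\<nexists>s. c q' s \<noteq> 0"
      then have "coboundary X c q s = 0"
        by (simp add: coboundary_def q)
      with nz show False by simp
    qed
    then show "q \<in> Suc ` {q. \<exists>s. c q s \<noteq> 0}"
      using q by blast
  qed
  then have "finite {q. \<exists>s. coboundary X c q s \<noteq> 0}"
    using assms unfolding cochains_def
    by (metis (no_types, lifting) finite_imageI finite_subset mem_Collect_eq)
  then show ?thesis
    by (simp add: cochains_def coboundary_non_simplex)
qed

section \<open>Small chains\<close>

definition small_simplex :: "nat \<Rightarrow> 'a topology \<Rightarrow> 'a set set \<Rightarrow> ((nat \<Rightarrow> real) \<Rightarrow> 'a) \<Rightarrow> bool" where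
  "small_simplex q X \<C> s \<longleftrightarrow> (\<exists>V\<in>\<C>. singular_simplex q (subtopology X V) s)"

definition small_chain :: "nat \<Rightarrow> 'a topology \<Rightarrow> 'a set set \<Rightarrow> 'a chain \<Rightarrow> bool" where
  "small_chain q X \<C> c \<longleftrightarrow> Poly_Mapping.keys c \<subseteq> Collect (small_simplex q X \<C>)"

lemma small_chain_of [simp]: "small_chain q X \<C> (frag_of s) \<longleftrightarrow> small_simplex q X \<C> s"
  by (simp add: small_chain_def)

lemma small_chain_0 [simp]: "small_chain q X \<C> 0"
  by (simp add: small_chain_def)

lemma small_chain_cmul: "small_chain q X \<C> c \<Longrightarrow> small_chain q X \<C> (frag_cmul k c)"
  by (auto simp: small_chain_def)

lemma small_chain_diff:
  "small_chain q X \<C> a \<Longrightarrow> small_chain q X \<C> b \<Longrightarrow> small_chain q X \<C> (a - b)"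
  unfolding small_chain_def using keys_diff [of a b] by blast

lemma small_chain_sum:
  "(\<And>i. i \<in> I \<Longrightarrow> small_chain q X \<C> (f i)) \<Longrightarrow> small_chain q X \<C> (sum f I)"
  unfolding small_chain_def using keys_sum [of f I] by blast

lemma small_chain_subtopology:
  "singular_chain q (subtopology X V) c \<Longrightarrow> V \<in> \<C> \<Longrightarrow> small_chain q X \<C> c"
  unfolding small_chain_def small_simplex_def singular_chain_def by blast

text \<open>Linear operators that are natural for subspaces do not leave a member of the cover. This
  applies to the boundary, the subdivision and the homotopy between subdivision and
  identity.\<close>

lemma small_chain_map:
  assumes small: "small_chain p X \<C> c"
    and diff: "\<And>a b. h (a - b) = h a - h b"
    and h: "\<And>V c. singular_chain p (subtopology X V) c \<Longrightarrow> singular_chain q (subtopology X V) (h c)"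
  shows "small_chain q X \<C> (h c)"
proof -
  have h0: "h 0 = 0"
    using diff [of 0 0] by simp
  show ?thesis
    using small unfolding small_chain_def [of p]
  proof (induction c rule: frag_induction)
    case (one s)
    then obtain V where "V \<in> \<C>" "singular_chain p (subtopology X V) (frag_of s)"
      by (auto simp: small_simplex_def singular_chain_of)
    then show ?case
      using h small_chain_subtopology by blast
  qed (auto simp: diff h0 small_chain_diff)
qed

lemma small_chain_boundary:
  "small_chain (Suc q) X \<C> c \<Longrightarrow> small_chain q X \<C> (chain_boundary (Suc q) c)"
  by (rule small_chain_map [where h = "chain_boundary (Suc q)"])
     (auto simp: chain_boundary_diff singular_chain_boundary_alt)

lemma small_chain_singular_subdivision:
  "small_chain q X \<C> c \<Longrightarrow> small_chain q X \<C> ((singular_subdivision q ^^ i) c)"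
proof (induction i)
  case (Suc i)
  then show ?case
    by (simp, intro small_chain_map [where h = "singular_subdivision q"])
       (auto simp: singular_subdivision_diff singular_chain_singular_subdivision)
qed auto

lemma chain_boundary_iterated_subdivision:
  assumes "singular_chain (Suc q) X c"
  shows "singular_chain (Suc q) X ((singular_subdivision (Suc q) ^^ i) c) \<and>
    chain_boundary (Suc q) ((singular_subdivision (Suc q) ^^ i) c)
         = (singular_subdivision q ^^ i) (chain_boundary (Suc q) c)"
proof (induction i)
  case (Suc i)
  then show ?case
    using chain_boundary_singular_subdivision [of "Suc q" X "(singular_subdivision (Suc q) ^^ i) c"]
    by (simp add: singular_chain_singular_subdivision)
qed (use assms in auto)

lemma iterated_subdivision_sum:
  "(singular_subdivision q ^^ i) (sum f I) = (\<Sum>j\<in>I. (singular_subdivision q ^^ i) (f j))"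
proof (induction i)
  case (Suc i)
  have "singular_subdivision q (sum g I) = (\<Sum>j\<in>I. singular_subdivision q (g j))" for g
    by (induction I rule: infinite_finite_induct) (simp_all add: singular_subdivision_add)
  with Suc show ?case by simp
qed auto

lemma iterated_subdivision_cmul:
  "(singular_subdivision q ^^ i) (frag_cmul k c) = frag_cmul k ((singular_subdivision q ^^ i) c)"
proof (induction i)
  case (Suc i)
  then show ?case
    by (simp add: singular_subdivision_def frag_extend_cmul)
qed auto

text \<open>\<open>D\<close> is a chain homotopy between the identity and a map into small chains.
  It sums the subdivision homotopies up to the number of steps that a simplex needs. A simplex that
  is small already needs no step, so \<open>D\<close> vanishes on small chains and the resulting map
  is a strict retraction onto them.\<close>

lemma small_chain_retraction:
  fixes X :: "'a topology"
  assumes open_C: "\<And>U. U \<in> \<C> \<Longrightarrow> openin X U" and cover: "topspace X \<subseteq> \<Union>\<C>"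
  obtains D :: "nat \<Rightarrow> 'a chain \<Rightarrow> 'a chain" where
    "\<And>q a b. D q (a - b) = D q a - D q b"
    "\<And>q c. singular_chain q X c \<Longrightarrow> singular_chain (Suc q) X (D q c)"
    "\<And>q c. small_chain q X \<C> c \<Longrightarrow> D q c = 0"
    "\<And>q c. singular_chain q X c \<Longrightarrow>
       small_chain q X \<C> (c + chain_boundary (Suc q) (D q c) + D (q - Suc 0) (chain_boundary q c))"
proof -
  \<comment> \<open>One and the same \<open>h\<close> serves all spaces. This naturality lets it be
    applied inside the members of the cover.\<close>
  obtain h :: "nat \<Rightarrow> 'a chain \<Rightarrow> 'a chain" where h0: "\<And>p. h p 0 = 0"
    and h_diff: "\<And>p a b. h p (a - b) = h p a - h p b"
    and h_chain: "\<And>p X c. singular_chain p X c \<Longrightarrow> singular_chain (Suc p) X (h p c)"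
    and h_htpy: "\<And>p X c. singular_chain p X c \<Longrightarrow>
      chain_boundary (Suc p) (h p c) + h (p - Suc 0) (chain_boundary p c) = singular_subdivision p c - c"
    by (blast intro: chain_homotopic_singular_subdivision)
  have h_minus: "h p (- a) = - h p a" for p a
    using h_diff [of p 0 a] h0 by simp
  have h_add: "h p (a + b) = h p a + h p b" for p a b
    using h_diff [of p a "- b"] h_minus by simp
  have h_cmul: "h p (frag_cmul k a) = frag_cmul k (h p a)" for p k a
  proof -
    have *: "h p (frag_cmul (int n) a) = frag_cmul (int n) (h p a)" for n
      by (induction n) (simp_all add: h0 h_add frag_cmul_distrib)
    show ?thesis
    proof (cases "k \<ge> 0")
      case True
      then show ?thesis using * [of "nat k"] by simp
    next
      case False
      have "h p (frag_cmul k a) = h p (- frag_cmul (int (nat (- k))) a)"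
        using False by simp
      also have "\<dots> = - frag_cmul (int (nat (- k))) (h p a)"
        using h_minus * by metis
      finally show ?thesis using False by simp
    qed
  qed
  have h_sum: "h p (sum f I) = (\<Sum>i\<in>I. h p (f i))" for p f and I :: "nat set"
    by (induction I rule: infinite_finite_induct) (simp_all add: h0 h_add)
  define sd :: "nat \<Rightarrow> nat \<Rightarrow> 'a chain \<Rightarrow> 'a chain" where "sd q i = singular_subdivision q ^^ i" for q i
  \<comment> \<open>Smallness is demanded from \<open>n\<close> onwards, because the correction term
    below contains all subdivisions of a face between its own number of steps and that of the
    simplex.\<close>
  define N where "N q s = (LEAST n. \<forall>m\<ge>n. small_chain q X \<C> (sd q m (frag_of s)))" for q s
  have N: "small_chain q X \<C> (sd q m (frag_of s))" if "singular_simplex q X s" "m \<ge> N q s" for q m s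
  proof -
    have "singular_chain q X (frag_of s)"
      using that by (simp add: singular_chain_of)
    then obtain n where n: "\<And>m f. \<lbrakk>n \<le> m; f \<in> Poly_Mapping.keys (sd q m (frag_of s))\<rbrakk>
                      \<Longrightarrow> \<exists>V \<in> \<C>. f \<in> (standard_simplex q) \<rightarrow> V"
      unfolding sd_def using sufficient_iterated_singular_subdivision_exists [OF open_C cover] by metis
    have "small_chain q X \<C> (sd q m (frag_of s))" if "n \<le> m" for m
    proof -
      have "singular_chain q X (sd q m (frag_of s))"
        unfolding sd_def using \<open>singular_chain q X (frag_of s)\<close>
        by (induction m) (auto simp: singular_chain_singular_subdivision)
      moreover have "\<exists>V\<in>\<C>. f ` standard_simplex q \<subseteq> V"
        if "f \<in> Poly_Mapping.keys (sd q m (frag_of s))" for f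
        using n [OF \<open>n \<le> m\<close> that] by (simp add: image_subset_iff_funcset)
      ultimately show ?thesis
        unfolding small_chain_def small_simplex_def singular_chain_def singular_simplex_subtopology
        by (simp add: subset_iff)
    qed
    then have "\<exists>n. \<forall>m\<ge>n. small_chain q X \<C> (sd q m (frag_of s))"
      by blast
    from LeastI_ex [OF this] show ?thesis
      using that(2) unfolding N_def by blast
  qed
  have N0: "N q s = 0" if "small_simplex q X \<C> s" for q s
    unfolding N_def using that
    by (intro Least_eq_0) (auto simp: sd_def small_chain_singular_subdivision)
  \<comment> \<open>Small subdivisions of a simplex need not have small subdivisions of its faces, as terms may
    cancel in the boundary. Taking the maximum over all faces makes the number of steps monotone.\<close>
  define M :: "nat \<Rightarrow> ((nat \<Rightarrow> real) \<Rightarrow> 'a) \<Rightarrow> nat" where "M = rec_nat (N 0)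
      (\<lambda>q f s. Max (insert (N (Suc q) s) ((\<lambda>k. f (singular_face (Suc q) k s)) ` {..Suc q})))"
  have M_0: "M 0 s = N 0 s" for s
    by (simp add: M_def)
  have M_Suc: "M (Suc q) s = Max (insert (N (Suc q) s) ((\<lambda>k. M q (singular_face (Suc q) k s)) ` {..Suc q}))" for q s
    by (simp add: M_def)
  have NM: "N q s \<le> M q s" for q s
    by (cases q) (simp_all add: M_0 M_Suc del: atMost_Suc)
  have faceM: "M q (singular_face (Suc q) k s) \<le> M (Suc q) s" if "k \<le> Suc q" for q k s
    unfolding M_Suc using that by (intro Max_ge) auto
  have M_small: "M q s = 0" if "small_simplex q X \<C> s" for q s
    using that
  proof (induction q arbitrary: s)
    case 0
    then show ?case by (simp add: M_0 N0)
  next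
    case (Suc q)
    have "small_simplex q X \<C> (singular_face (Suc q) k s)" if "k \<le> Suc q" for k
      using Suc.prems singular_simplex_singular_face [of "Suc q" _ s k] that
      unfolding small_simplex_def by fastforce
    then have "(\<lambda>k. M q (singular_face (Suc q) k s)) ` {..Suc q} = {0}"
      using Suc.IH by auto
    then show ?case
      using N0 [OF Suc.prems] by (simp add: M_Suc del: atMost_Suc)
  qed
  define D where "D q = frag_extend (\<lambda>s. \<Sum>i<M q s. h q (sd q i (frag_of s)))" for q
  have sd_diff: "sd q i (a - b) = sd q i a - sd q i b" for q i a b
    by (simp add: sd_def singular_subdivision_power_diff)
  have sd_chain: "singular_chain q Y (sd q i c)" if "singular_chain q Y c" for q i c and Y :: "'a topology"
    unfolding sd_def using that by (induction i) (auto simp: singular_chain_singular_subdivision)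
  \<comment> \<open>For a fixed number \<open>m\<close> of steps the homotopies telescope to a
    homotopy between the identity and the \<open>m\<close>-fold subdivision.\<close>
  have tele: "chain_boundary (Suc q) (\<Sum>i<m. h q (sd q i c)) + (\<Sum>i<m. h (q - Suc 0) (sd (q - Suc 0) i (chain_boundary q c)))
      = sd q m c - c" if "singular_chain q X c" for q m c
  proof (induction m)
    case 0
    then show ?case by (simp add: sd_def)
  next
    case (Suc m)
    have "chain_boundary q (sd q m c) = sd (q - Suc 0) m (chain_boundary q c)"
    proof (cases q)
      case 0
      then show ?thesis by (simp add: chain_boundary_def sd_def)
    next
      case (Suc q')
      then show ?thesis
        using chain_boundary_iterated_subdivision [of q' X c m] that by (simp add: sd_def)
    qed
    then have "chain_boundary (Suc q) (h q (sd q m c)) + h (q - Suc 0) (sd (q - Suc 0) m (chain_boundary q c))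
      = sd q (Suc m) c - sd q m c"
      using h_htpy [OF sd_chain [OF that, of m]] by (simp add: sd_def)
    moreover have "(a + d) + (b + e) = v - c" if "a + b = u - c" "d + e = v - u" for a b d e u v :: "'a chain"
    proof -
      have "(a + d) + (b + e) = (a + b) + (d + e)" by (simp add: ac_simps)
      with that show ?thesis by simp
    qed
    ultimately show ?case
      using Suc by (simp add: chain_boundary_add)
  qed
  show ?thesis
  proof
    show "D q (a - b) = D q a - D q b" for q a b
      by (simp add: D_def frag_extend_diff)
    show "singular_chain (Suc q) X (D q c)" if "singular_chain q X c" for q c
      unfolding D_def using that
      by (intro singular_chain_extend singular_chain_sum h_chain sd_chain)
         (auto simp: singular_chain_def)
    show "D q c = 0" if "small_chain q X \<C> c" for q c
      unfolding D_def using that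
      by (intro frag_extend_eq_0) (auto simp: small_chain_def M_small)
    show "small_chain q X \<C> (c + chain_boundary (Suc q) (D q c) + D (q - Suc 0) (chain_boundary q c))"
      if "singular_chain q X c" for q c
      using that unfolding singular_chain_def
    proof (induction c rule: frag_induction)
      case zero
      then show ?case by (simp add: D_def)
    next
      case (diff a b)
      have eq: "a - b + chain_boundary (Suc q) (D q (a - b)) + D (q - Suc 0) (chain_boundary q (a - b))
        = (a + chain_boundary (Suc q) (D q a) + D (q - Suc 0) (chain_boundary q a))
          - (b + chain_boundary (Suc q) (D q b) + D (q - Suc 0) (chain_boundary q b))"
        by (simp add: D_def frag_extend_diff chain_boundary_diff)
      then show ?case
        unfolding eq using diff by (intro small_chain_diff) auto
    next
      case (one s)
      then have s: "singular_simplex q X s" by simp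
      then have sc: "singular_chain q X (frag_of s)" by (simp add: singular_chain_of)
      have D_s: "D q (frag_of s) = (\<Sum>i<M q s. h q (sd q i (frag_of s)))"
        by (simp add: D_def)
      show ?case
      proof (cases q)
        case 0
        have "frag_of s + chain_boundary (Suc q) (D q (frag_of s)) + D (q - Suc 0) (chain_boundary q (frag_of s))
          = sd q (M q s) (frag_of s)"
          using tele [OF sc, of "M q s"] by (simp add: 0 chain_boundary_def D_def h0 sd_def algebra_simps)
        then show ?thesis
          using N [OF s NM] by simp
      next
        case (Suc p)
        define F where "F k = singular_face q k s" for k
        have F: "singular_simplex p X (F k)" if "k \<le> q" for k
          using singular_simplex_singular_face [OF s, of k] that by (simp add: Suc F_def)
        have MF: "M p (F k) \<le> M q s" if "k \<le> q" for k
          using faceM that by (simp add: Suc F_def)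
        have bd: "chain_boundary q (frag_of s) = (\<Sum>k\<le>q. frag_cmul ((-1) ^ k) (frag_of (F k)))"
          by (simp add: chain_boundary_of Suc F_def)
        have 1: "D (q - Suc 0) (chain_boundary q (frag_of s))
          = (\<Sum>k\<le>q. frag_cmul ((-1) ^ k) (\<Sum>i<M p (F k). h p (sd p i (frag_of (F k)))))"
          unfolding bd D_def by (simp add: frag_extend_sum frag_extend_cmul Suc del: sum.atMost_Suc)
        have 2: "(\<Sum>i<M q s. h (q - Suc 0) (sd (q - Suc 0) i (chain_boundary q (frag_of s))))
          = (\<Sum>k\<le>q. frag_cmul ((-1) ^ k) (\<Sum>i<M q s. h p (sd p i (frag_of (F k)))))"
        proof -
          have "h (q - Suc 0) (sd (q - Suc 0) i (chain_boundary q (frag_of s)))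
            = (\<Sum>k\<le>q. frag_cmul ((-1) ^ k) (h p (sd p i (frag_of (F k)))))" for i
            unfolding bd sd_def iterated_subdivision_sum iterated_subdivision_cmul h_sum h_cmul
            by (simp add: Suc del: sum.atMost_Suc)
          then show ?thesis
            by (simp add: frag_cmul_sum sum.swap [of _ "{..q}"])
        qed
        have 3: "(\<Sum>i<M q s. h p (sd p i (frag_of (F k))))
           - (\<Sum>i<M p (F k). h p (sd p i (frag_of (F k)))) = (\<Sum>i\<in>{M p (F k)..<M q s}. h p (sd p i (frag_of (F k))))"
          if "k \<le> q" for k
          using sum.atLeastLessThan_concat [of 0 "M p (F k)" "M q s" "\<lambda>i. h p (sd p i (frag_of (F k)))"] MF [OF that]
          by (simp add: atLeast0LessThan algebra_simps)
        \<comment> \<open>If the faces used \<open>M q s\<close> steps as well, telescoping would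
          leave only the subdivided simplex. A face stops after \<open>M p (F k)\<close> steps, and
          the difference consists of \<open>h\<close> applied to subdivisions of the face that are
          small already.\<close>
        have "frag_of s + chain_boundary (Suc q) (D q (frag_of s)) + D (q - Suc 0) (chain_boundary q (frag_of s))
          = sd q (M q s) (frag_of s) - ((\<Sum>i<M q s. h (q - Suc 0) (sd (q - Suc 0) i (chain_boundary q (frag_of s))))
             - D (q - Suc 0) (chain_boundary q (frag_of s)))"
          using tele [OF sc, of "M q s"] by (simp add: D_s algebra_simps)
        also have "\<dots> = sd q (M q s) (frag_of s)
          - (\<Sum>k\<le>q. frag_cmul ((-1) ^ k) (\<Sum>i\<in>{M p (F k)..<M q s}. h p (sd p i (frag_of (F k)))))"
        proof -
          have fd: "frag_cmul k a - frag_cmul k b = frag_cmul k (a - b)" for k and a b :: "'a chain"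
            by (rule poly_mapping_eqI) (simp add: lookup_minus right_diff_distrib)
          show ?thesis
            unfolding 1 2 sum_subtractf [symmetric] fd
            by (rule arg_cong [where f = "\<lambda>x. _ - x"], rule sum.cong) (simp_all add: 3)
        qed
        also have "small_chain q X \<C> \<dots>"
        proof (intro small_chain_diff small_chain_sum small_chain_cmul)
          show "small_chain q X \<C> (sd q (M q s) (frag_of s))"
            using N [OF s NM] .
          fix k i assume k: "k \<in> {..q}" and i: "i \<in> {M p (F k)..<M q s}"
          have "small_chain p X \<C> (sd p i (frag_of (F k)))"
            using i k NM [of p "F k"] by (intro N F) auto
          then show "small_chain q X \<C> (h p (sd p i (frag_of (F k))))"
            unfolding Suc by (rule small_chain_map) (auto simp: h_diff h_chain)
        qed
        finally show ?thesis .
      qed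
    qed
  qed
qed

section \<open>Cocycles and open covers\<close>

text \<open>After the retraction to small chains \<open>b\<close> evaluates to 0, and being a
  cocycle it kills the boundary term of the homotopy. What is left says that \<open>b\<close> is the
  coboundary of \<open>g\<close>, the negative transpose of \<open>D\<close> applied to
  \<open>b\<close>.\<close>

lemma cocycle_vanishing_on_small_simplices:
  assumes open_C: "\<And>U. U \<in> \<C> \<Longrightarrow> openin X U" and cover: "topspace X \<subseteq> \<Union>\<C>"
    and b: "b \<in> cochains X" and cocycle: "coboundary X b = (\<lambda>q s. 0)"
    and small: "\<And>q s. small_simplex q X \<C> s \<Longrightarrow> b q s = 0"
  shows "b \<in> coboundaries X"
proof -
  obtain D where D_diff: "\<And>q x y. D q (x - y) = D q x - D q y"
    and D_chain: "\<And>q c. singular_chain q X c \<Longrightarrow> singular_chain (Suc q) X (D q c)"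
    and D_small: "\<And>q c. singular_chain q X c \<Longrightarrow>
       small_chain q X \<C> (c + chain_boundary (Suc q) (D q c) + D (q - Suc 0) (chain_boundary q c))"
    using small_chain_retraction [OF open_C cover] by metis
  have D0: "D q 0 = 0" for q
    using D_diff [of q 0 0] by simp
  have key: "frag_eval (b q) c = - frag_eval (b q) (D (q - Suc 0) (chain_boundary q c))"
    if c: "singular_chain q X c" for q c
  proof -
    have "frag_eval (b q) (c + chain_boundary (Suc q) (D q c) + D (q - Suc 0) (chain_boundary q c)) = 0"
      using D_small [OF c] small by (intro frag_eval_eq_0) (auto simp: small_chain_def)
    moreover have "frag_eval (b q) (chain_boundary (Suc q) (D q c)) = 0"
      using frag_eval_coboundary [OF D_chain [OF c], of b] by (simp add: cocycle frag_eval_eq_0)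
    ultimately show ?thesis
      by (simp add: frag_eval_add)
  qed
  define g where "g q s = (if singular_simplex q X s then - frag_eval (b (Suc q)) (D q (frag_of s)) else 0)" for q s
  have g: "frag_eval (g q) c = - frag_eval (b (Suc q)) (D q c)" if "singular_chain q X c" for q c
    using that unfolding singular_chain_def
    by (induction c rule: frag_induction) (auto simp: D0 D_diff frag_eval_diff g_def)
  have "finite {q. \<exists>s. g q s \<noteq> 0}"
  proof (rule finite_surj)
    show "finite {q. \<exists>s. b q s \<noteq> 0}"
      using b by (simp add: cochains_def)
    have "q \<in> (\<lambda>q. q - 1) ` {q. \<exists>s. b q s \<noteq> 0}" if nz: "g q s \<noteq> 0" for q s
    proof -
      have "\<exists>s. b (Suc q) s \<noteq> 0"
      proof (rule ccontr)
        assume "\<not> ?thesis"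
        then have "g q s = 0" by (simp add: g_def frag_eval_eq_0)
        with nz show False by simp
      qed
      then show ?thesis by (intro image_eqI [of _ _ "Suc q"]) auto
    qed
    then show "{q. \<exists>s. g q s \<noteq> 0} \<subseteq> (\<lambda>q. q - 1) ` {q. \<exists>s. b q s \<noteq> 0}"
      by blast
  qed
  then have "g \<in> cochains X"
    by (simp add: cochains_def g_def)
  moreover have "coboundary X g q s = b q s" for q s
  proof (cases "singular_simplex q X s")
    case False
    then show ?thesis
      using b by (simp add: coboundary_non_simplex cochains_supportD)
  next
    case s: True
    then have sc: "singular_chain q X (frag_of s)"
      by (simp add: singular_chain_of)
    show ?thesis
    proof (cases q)
      case 0
      then show ?thesis
        using key [OF sc] by (simp add: chain_boundary_def D0)
    next
      case (Suc p)
      then show ?thesis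
        using key [OF sc] s g [of p "chain_boundary q (frag_of s)"] singular_chain_boundary [OF sc]
        by (simp add: coboundary_apply)
    qed
  qed
  ultimately show ?thesis
    unfolding coboundaries_def by (intro image_eqI [of _ _ g]) (auto simp: fun_eq_iff)
qed

text \<open>The connecting homomorphism of the Mayer-Vietoris sequence on the level of cochains. The
  equalities on \<open>U\<close> and \<open>V\<close> are strict because the cocycle is later
  evaluated on chains inside these sets. The last conclusion keeps track of the degree, as a cochain
  may mix degrees.\<close>

lemma Mayer_Vietoris_cocycle:
  assumes U: "openin X U" and V: "openin X V" and cover: "topspace X \<subseteq> U \<union> V"
    and x: "x \<in> cochains (subtopology X (U \<inter> V))"
    and cocycle: "\<And>q s. singular_simplex q (subtopology X (U \<inter> V)) s \<Longrightarrow> coboundary X x q s = 0"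
  obtains a where "a \<in> cochains X" "coboundary X a = (\<lambda>q s. 0)"
    "\<And>q s. singular_simplex q (subtopology X U) s \<Longrightarrow> a q s = coboundary X x q s"
    "\<And>q s. singular_simplex q (subtopology X V) s \<Longrightarrow> a q s = 0"
    "\<And>q s. (\<And>t. coboundary X x q t = 0) \<Longrightarrow> a q s = 0"
proof -
  let ?C = "{U, V}"
  have open_C: "\<And>W. W \<in> ?C \<Longrightarrow> openin X W" and cover_C: "topspace X \<subseteq> \<Union>?C"
    using U V cover by auto
  obtain D where D_diff: "\<And>q x y. D q (x - y) = D q x - D q y"
    and D_chain: "\<And>q c. singular_chain q X c \<Longrightarrow> singular_chain (Suc q) X (D q c)"
    and D_0: "\<And>q c. small_chain q X ?C c \<Longrightarrow> D q c = 0"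
    and D_small: "\<And>q c. singular_chain q X c \<Longrightarrow>
       small_chain q X ?C (c + chain_boundary (Suc q) (D q c) + D (q - Suc 0) (chain_boundary q c))"
    using small_chain_retraction [OF open_C cover_C] by metis
  have D0: "D q 0 = 0" for q
    using D_diff [of q 0 0] by simp
  define R where "R q c = c + chain_boundary (Suc q) (D q c) + D (q - Suc 0) (chain_boundary q c)" for q c
  have R_diff: "R q (y - z) = R q y - R q z" for q y z
    by (simp add: R_def D_diff chain_boundary_diff)
  have R0: "R q 0 = 0" for q
    using R_diff [of q 0 0] by simp
  have R_small: "small_chain q X ?C (R q c)" if "singular_chain q X c" for q c
    using D_small [OF that] by (simp add: R_def)
  have R_id: "R q c = c" if "small_chain q X ?C c" for q c
  proof (cases q)
    case 0
    then show ?thesis using D_0 [OF that] by (simp add: R_def chain_boundary_def D0)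
  next
    case (Suc p)
    then show ?thesis
      using D_0 [OF that] D_0 [OF small_chain_boundary [of p X ?C c]] that by (simp add: R_def)
  qed
  have R_boundary: "chain_boundary (Suc q) (R (Suc q) c) = R q (chain_boundary (Suc q) c)"
    if c: "singular_chain (Suc q) X c" for q c
    using chain_boundary_boundary_alt [OF D_chain [OF c]] chain_boundary_boundary_alt [OF c]
    by (simp add: R_def chain_boundary_add D0)
  \<comment> \<open>On small simplices the cocycle is the coboundary of the extension of x by zero on the
    side of U and zero on the side of V. The retraction R to small chains extends it.\<close>
  define f where "f q s = (if singular_simplex q (subtopology X U) s then coboundary X x q s else 0)" for q s
  \<comment> \<open>On the overlap the prescriptions for the two sides agree, because
    \<open>x\<close> is a cocycle there.\<close>
  have fV: "f q s = 0" if "singular_simplex q (subtopology X V) s" for q s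
    using cocycle that by (auto simp: f_def singular_simplex_subtopology)
  have f_boundary: "frag_eval (f q) (chain_boundary (Suc q) c) = 0" if "small_chain (Suc q) X ?C c" for q c
    using that unfolding small_chain_def
  proof (induction c rule: frag_induction)
    case (one s)
    then consider "singular_simplex (Suc q) (subtopology X U) s" | "singular_simplex (Suc q) (subtopology X V) s"
      by (auto simp: small_simplex_def)
    then show ?case
    proof cases
      case 1
      then have b: "singular_chain q (subtopology X U) (chain_boundary (Suc q) (frag_of s))"
        by (simp add: singular_chain_boundary_alt singular_chain_of)
      have "frag_eval (f q) (chain_boundary (Suc q) (frag_of s))
        = frag_eval (coboundary X x q) (chain_boundary (Suc q) (frag_of s))"
        using b by (intro frag_eval_cong) (auto simp: f_def singular_chain_def)
      also have "\<dots> = coboundary X (coboundary X x) (Suc q) s"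
        using coboundary_apply singular_simplex_of_subtopology [OF 1] by metis
      finally show ?thesis
        by (simp add: coboundary_coboundary)
    next
      case 2
      then have b: "singular_chain q (subtopology X V) (chain_boundary (Suc q) (frag_of s))"
        by (simp add: singular_chain_boundary_alt singular_chain_of)
      then show ?thesis
        by (intro frag_eval_eq_0) (auto simp: fV singular_chain_def)
    qed
  qed (auto simp: chain_boundary_diff frag_eval_diff)
  \<comment> \<open>\<open>R\<close> is a chain map into small chains and \<open>f\<close> is a
    cocycle on these, so the composite is a cocycle. On small simplices \<open>R\<close> is the
    identity and the composite is \<open>f\<close>.\<close>
  define a where "a q s = (if singular_simplex q X s then frag_eval (f q) (R q (frag_of s)) else 0)" for q s
  have a: "frag_eval (a q) c = frag_eval (f q) (R q c)" if "singular_chain q X c" for q c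
    using that unfolding singular_chain_def
    by (induction c rule: frag_induction) (auto simp: R0 R_diff frag_eval_diff a_def)
  have a_small: "a q s = f q s" if "small_simplex q X ?C s" for q s
  proof -
    have "singular_simplex q X s"
      using that by (auto simp: small_simplex_def singular_simplex_of_subtopology)
    then show ?thesis
      using that by (simp add: a_def R_id)
  qed
  have zero: "a q s = 0" if "\<And>t. coboundary X x q t = 0" for q s
    unfolding a_def f_def using that by (auto intro!: frag_eval_eq_0)
  show ?thesis
  proof
    have "{q. \<exists>s. a q s \<noteq> 0} \<subseteq> {q. \<exists>s. coboundary X x q s \<noteq> 0}"
      using zero by blast
    moreover have "finite {q. \<exists>s. coboundary X x q s \<noteq> 0}"
      using coboundary_in_cochains [OF cochains_subtopology [OF x]] by (simp add: cochains_def)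
    ultimately have "finite {q. \<exists>s. a q s \<noteq> 0}"
      by (rule finite_subset)
    moreover have "a q s = 0" if "\<not> singular_simplex q X s" for q s
      using that by (simp add: a_def)
    ultimately show "a \<in> cochains X"
      by (simp add: cochains_def)
    show "coboundary X a = (\<lambda>q s. 0)"
    proof (intro ext)
      fix q s
      show "coboundary X a q s = 0"
      proof (cases "\<exists>p. q = Suc p \<and> singular_simplex q X s")
        case True
        then obtain p where q: "q = Suc p" and s: "singular_simplex (Suc p) X s" by auto
        then have sc: "singular_chain (Suc p) X (frag_of s)"
          by (simp add: singular_chain_of)
        have "coboundary X a q s = frag_eval (f p) (chain_boundary (Suc p) (R (Suc p) (frag_of s)))"
          unfolding q coboundary_apply [OF s] a [OF singular_chain_boundary_alt [OF sc]] R_boundary [OF sc] ..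
        then show ?thesis
          using f_boundary [OF R_small [OF sc]] by simp
      next
        case False
        then show ?thesis by (cases q) (auto simp: coboundary_non_simplex)
      qed
    qed
    show "a q s = coboundary X x q s" if "singular_simplex q (subtopology X U) s" for q s
      using a_small [of q s] that by (simp add: small_simplex_def f_def)
    show "a q s = 0" if "singular_simplex q (subtopology X V) s" for q s
      using a_small [of q s] that by (simp add: small_simplex_def fV)
  qed (use zero in blast)
qed

section \<open>The cohomology ring\<close>

lemma singular_simplex_front_face:
  assumes s: "singular_simplex r X s" and "p \<le> r"
  shows "singular_simplex p X (front_face p s)"
proof -
  have "continuous_map (subtopology (powertop_real UNIV) (standard_simplex p)) X s"
    using s standard_simplex_mono [OF \<open>p \<le> r\<close>] unfolding singular_simplex_def
    using continuous_map_from_subtopology_mono by blast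
  then show ?thesis
    by (simp add: singular_simplex_def front_face_def)
qed

lemma shift_in_standard_simplex:
  assumes "x \<in> standard_simplex q"
  shows "(\<lambda>i. if i < p then 0 else x (i - p)) \<in> standard_simplex (p + q)"
proof -
  have "{..p + q} = {..<p} \<union> {p..p + q}" by auto
  then have "(\<Sum>i\<le>p + q. if i < p then 0 else x (i - p)) = (\<Sum>i\<in>{p..p + q}. x (i - p))"
    by (simp add: sum.union_disjoint ivl_disj_int_one)
  also have "\<dots> = (\<Sum>i\<le>q. x i)"
    by (rule sum.reindex_bij_witness [of _ "\<lambda>i. i + p" "\<lambda>i. i - p"]) auto
  finally show ?thesis
    using assms by (auto simp: standard_simplex_def)
qed

lemma singular_simplex_back_face:
  assumes s: "singular_simplex (p + q) X s"
  shows "singular_simplex q X (back_face p q s)"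
proof -
  let ?g = "\<lambda>x i. if i < p then 0 else x (i - p) :: real"
  have "continuous_map (powertop_real UNIV) (powertop_real UNIV) ?g"
    unfolding continuous_map_componentwise_UNIV
  proof
    fix i
    show "continuous_map (powertop_real UNIV) euclideanreal (\<lambda>x. ?g x i)"
      by (cases "i < p") (auto intro: continuous_map_product_projection)
  qed
  then have "continuous_map (subtopology (powertop_real UNIV) (standard_simplex q))
      (subtopology (powertop_real UNIV) (standard_simplex (p + q))) ?g"
    using shift_in_standard_simplex
    by (auto simp: continuous_map_in_subtopology continuous_map_from_subtopology)
  moreover have "continuous_map (subtopology (powertop_real UNIV) (standard_simplex (p + q))) X s"
    using s by (simp add: singular_simplex_def)
  ultimately have "continuous_map (subtopology (powertop_real UNIV) (standard_simplex q)) X (s \<circ> ?g)"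
    by (rule continuous_map_compose)
  then show ?thesis
    by (simp add: singular_simplex_def back_face_def comp_def)
qed

lemma front_face_front_face: "p \<le> r \<Longrightarrow> front_face p (front_face r s) = front_face p s"
  using standard_simplex_mono [of p r] by (auto simp: front_face_def fun_eq_iff)

lemma back_face_back_face:
  "back_face q r (back_face p (q + r) s) = back_face (p + q) r s"
proof (rule ext)
  fix x :: "nat \<Rightarrow> real"
  have "(\<lambda>i. if i < p then 0 else if i - p < q then 0 else x (i - p - q))
      = (\<lambda>i. if i < p + q then 0 else x (i - (p + q)) :: real)"
    by (auto simp: fun_eq_iff)
  then show "back_face q r (back_face p (q + r) s) x = back_face (p + q) r s x"
    using shift_in_standard_simplex [of x r q] by (simp add: back_face_def)
qed

lemma back_face_front_face:
  "back_face p q (front_face (p + q) s) = front_face q (back_face p (q + r) s)"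
proof (rule ext)
  fix x :: "nat \<Rightarrow> real"
  show "back_face p q (front_face (p + q) s) x = front_face q (back_face p (q + r) s) x"
    using shift_in_standard_simplex [of x q p] standard_simplex_mono [of q "q + r"]
    by (auto simp: back_face_def front_face_def)
qed

lemma front_face_all: "singular_simplex r X s \<Longrightarrow> front_face r s = s"
  by (simp add: singular_simplex_def front_face_def extensional_restrict)

lemma back_face_0: "singular_simplex r X s \<Longrightarrow> back_face 0 r s = s"
  by (simp add: singular_simplex_def back_face_def extensional_restrict)

text \<open>Omitting one of the vertices 0 to \<open>p\<close> affects the front part, omitting a
  later one affects the back part. With the corresponding identity for back faces this sorts the
  terms in the coboundary of a product into the two halves of the Leibniz rule.\<close>

lemma front_face_singular_face:
  assumes "p \<le> r" "k \<le> Suc r"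
  shows "front_face p (singular_face (Suc r) k s) =
    (if k \<le> p then singular_face (Suc p) k (front_face (Suc p) s) else front_face p s)"
proof (rule ext)
  fix x :: "nat \<Rightarrow> real"
  have "simplical_face k x = x" if "x \<in> standard_simplex p" "k > p"
    using that by (auto simp: simplical_face_def fun_eq_iff standard_simplex_def)
  then show "front_face p (singular_face (Suc r) k s) x =
    (if k \<le> p then singular_face (Suc p) k (front_face (Suc p) s) else front_face p s) x"
    using standard_simplex_mono [OF \<open>p \<le> r\<close>] simplical_face_in_standard_simplex [of "Suc p" k x]
    by (auto simp: front_face_def singular_face_def)
qed

lemma front_face_last_face:
  "singular_face (Suc p) (Suc p) (front_face (Suc p) s) = front_face p s"
proof (rule ext)
  fix x :: "nat \<Rightarrow> real"
  have "simplical_face (Suc p) x = x" if "x \<in> standard_simplex p"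
    using that by (auto simp: simplical_face_def fun_eq_iff standard_simplex_def)
  then show "singular_face (Suc p) (Suc p) (front_face (Suc p) s) x = front_face p s x"
    using simplical_face_in_standard_simplex [of "Suc p" "Suc p" x]
    by (auto simp: front_face_def singular_face_def)
qed

lemma back_face_singular_face:
  assumes "k \<le> Suc (p + q)"
  shows "back_face p q (singular_face (Suc (p + q)) k s) =
    (if k \<le> p then back_face (Suc p) q s else singular_face (Suc q) (k - p) (back_face p (Suc q) s))"
proof (rule ext)
  fix x :: "nat \<Rightarrow> real"
  have 1: "simplical_face k (\<lambda>i. if i < p then 0 else x (i - p)) = (\<lambda>i. if i < Suc p then 0 else x (i - Suc p))"
    if "k \<le> p"
    using that by (auto simp: simplical_face_def fun_eq_iff Suc_le_eq)
  have 2: "simplical_face k (\<lambda>i. if i < p then 0 else x (i - p))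
      = (\<lambda>i. if i < p then 0 else simplical_face (k - p) x (i - p))" if "k > p"
    using that by (auto simp: simplical_face_def fun_eq_iff)
  show "back_face p q (singular_face (Suc (p + q)) k s) x =
    (if k \<le> p then back_face (Suc p) q s else singular_face (Suc q) (k - p) (back_face p (Suc q) s)) x"
    using shift_in_standard_simplex [of x q p] simplical_face_in_standard_simplex [of "Suc q" "k - p" x] assms
    by (auto simp: back_face_def singular_face_def 1 2)
qed

lemma back_face_first_face:
  "singular_face (Suc q) 0 (back_face p (Suc q) s) = back_face (Suc p) q s"
proof (rule ext)
  fix x :: "nat \<Rightarrow> real"
  have "(\<lambda>i. if i < p then 0 else simplical_face 0 x (i - p)) = (\<lambda>i. if i < Suc p then 0 else x (i - Suc p))"
    by (auto simp: simplical_face_def fun_eq_iff)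
  then show "singular_face (Suc q) 0 (back_face p (Suc q) s) x = back_face (Suc p) q s x"
    using simplical_face_in_standard_simplex [of "Suc q" 0 x]
    by (auto simp: back_face_def singular_face_def)
qed

section \<open>The cup product of cochains\<close>

lemma cup_product_simplex:
  "singular_simplex r X s \<Longrightarrow>
    cup_product X a b r s = (\<Sum>p\<le>r. a p (front_face p s) * b (r - p) (back_face p (r - p) s))"
  by (simp add: cup_product_def)

lemma cup_product_non_simplex: "\<not> singular_simplex r X s \<Longrightarrow> cup_product X a b r s = 0"
  by (simp add: cup_product_def)

lemma singular_simplex_back_face':
  "singular_simplex r X s \<Longrightarrow> p \<le> r \<Longrightarrow> singular_simplex (r - p) X (back_face p (r - p) s)"
  using singular_simplex_back_face [of p "r - p" X s] by simp

lemma finite_degrees: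
  assumes "c \<in> cochains X"
  obtains m where "\<And>q s. q > m \<Longrightarrow> c q s = 0"
proof -
  have "finite {q. \<exists>s. c q s \<noteq> 0}"
    using assms by (simp add: cochains_def)
  then obtain m where "\<forall>q\<in>{q. \<exists>s. c q s \<noteq> 0}. q \<le> m"
    using finite_nat_set_iff_bounded_le by blast
  then have "\<And>q s. q > m \<Longrightarrow> c q s = 0"
    by (metis (mono_tags, lifting) leD mem_Collect_eq)
  then show ?thesis using that by blast
qed

lemma cochainsI:
  assumes "\<And>q s. \<not> singular_simplex q X s \<Longrightarrow> c q s = 0" and "\<And>q s. q > m \<Longrightarrow> c q s = 0"
  shows "c \<in> cochains X"
proof -
  have "{q. \<exists>s. c q s \<noteq> 0} \<subseteq> {..m}"
    using assms(2) not_le by (auto simp: atMost_def)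
  then have "finite {q. \<exists>s. c q s \<noteq> 0}"
    by (rule finite_subset) simp
  then show ?thesis
    using assms(1) by (simp add: cochains_def)
qed

lemma cup_product_in_cochains:
  assumes a: "a \<in> cochains X" and b: "b \<in> cochains X"
  shows "cup_product X a b \<in> cochains X"
proof -
  obtain m n where m: "\<And>q s. q > m \<Longrightarrow> a q s = 0" and n: "\<And>q s. q > n \<Longrightarrow> b q s = 0"
    using finite_degrees [OF a] finite_degrees [OF b] by metis
  show ?thesis
  proof (rule cochainsI)
    fix q s assume "q > m + n"
    then have "p > m \<or> q - p > n" for p
      by linarith
    then have "a p t * b (q - p) u = 0" for p t u
      using m n by (metis mult_zero_left mult_zero_right)
    then show "cup_product X a b q s = 0"
      unfolding cup_product_def by (auto intro!: sum.neutral)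
  qed (simp add: cup_product_non_simplex)
qed

lemma cup_product_add_left:
  "cup_product X (\<lambda>q s. a q s + b q s) c = (\<lambda>q s. cup_product X a c q s + cup_product X b c q s)"
  by (simp add: cup_product_def fun_eq_iff distrib_right sum.distrib)

lemma cup_product_add_right:
  "cup_product X a (\<lambda>q s. b q s + c q s) = (\<lambda>q s. cup_product X a b q s + cup_product X a c q s)"
  by (simp add: cup_product_def fun_eq_iff distrib_left sum.distrib)

abbreviation unit_cochain :: "'a topology \<Rightarrow> 'a cochain" where
  "unit_cochain X \<equiv> (\<lambda>q s. if q = 0 \<and> singular_simplex 0 X s then 1 else 0)"

lemma cup_product_unit_left:
  assumes "a \<in> cochains X"
  shows "cup_product X (unit_cochain X) a = a"
proof (intro ext)
  fix q s
  show "cup_product X (unit_cochain X) a q s = a q s"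
  proof (cases "singular_simplex q X s")
    case True
    have "cup_product X (unit_cochain X) a q s
      = (\<Sum>p\<le>q. if p = 0 then a q s else 0)"
      unfolding cup_product_simplex [OF True] using True
      by (intro sum.cong) (auto simp: back_face_0 singular_simplex_front_face)
    then show ?thesis by simp
  next
    case False
    then show ?thesis
      using assms by (simp add: cup_product_non_simplex cochains_supportD)
  qed
qed

lemma cup_product_unit_right:
  assumes "a \<in> cochains X"
  shows "cup_product X a (unit_cochain X) = a"
proof (intro ext)
  fix q s
  show "cup_product X a (unit_cochain X) q s = a q s"
  proof (cases "singular_simplex q X s")
    case True
    have "cup_product X a (unit_cochain X) q s
      = (\<Sum>p\<le>q. if p = q then a q s else 0)"
      unfolding cup_product_simplex [OF True] using True singular_simplex_back_face' [OF True, of q]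
      by (intro sum.cong) (auto simp: front_face_all)
    then show ?thesis by simp
  next
    case False
    then show ?thesis
      using assms by (simp add: cup_product_non_simplex cochains_supportD)
  qed
qed

lemma cup_product_assoc:
  "cup_product X (cup_product X a b) c = cup_product X a (cup_product X b c)"
proof (intro ext)
  fix r s
  show "cup_product X (cup_product X a b) c r s = cup_product X a (cup_product X b c) r s"
  proof (cases "singular_simplex r X s")
    case s: True
    have eq: "b (p - i) (front_face (p - i) (back_face i (r - i) s)) *
           c (r - p) (back_face (p - i) (r - p) (back_face i (r - i) s)) =
           b (p - i) (back_face i (p - i) (front_face p s)) * c (r - p) (back_face p (r - p) s)"
      if "p \<le> r" "i \<le> p" for p i
    proof -
      obtain j where p: "p = i + j"
        using le_Suc_ex [OF \<open>i \<le> p\<close>] by blast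
      obtain k where "r = p + k"
        using le_Suc_ex [OF \<open>p \<le> r\<close>] by blast
      then have r: "r = i + (j + k)" by (simp add: p)
      show ?thesis
        using back_face_back_face [of j k i s] back_face_front_face [of i j s k]
        by (simp add: p r)
    qed
    have "cup_product X (cup_product X a b) c r s
      = (\<Sum>p\<le>r. \<Sum>i\<le>p. a i (front_face i s) * b (p - i) (back_face i (p - i) (front_face p s))
           * c (r - p) (back_face p (r - p) s))"
      using s
      by (simp add: cup_product_simplex singular_simplex_front_face sum_distrib_right front_face_front_face)
    also have "\<dots> = (\<Sum>i\<le>r. \<Sum>j\<le>r - i. a i (front_face i s) * (b j (front_face j (back_face i (r - i) s))
           * c (r - i - j) (back_face j (r - i - j) (back_face i (r - i) s))))"
      unfolding sum.Sigma [OF finite_atMost ballI [OF finite_atMost]]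
      by (rule sum.reindex_bij_witness [of _ "\<lambda>(i, j). (i + j, i)" "\<lambda>(p, i). (i, p - i)"])
         (auto simp: eq)
    also have "\<dots> = cup_product X a (cup_product X b c) r s"
      using s
      by (simp add: cup_product_simplex singular_simplex_back_face' sum_distrib_left)
    finally show ?thesis .
  qed (simp add: cup_product_non_simplex)
qed

text \<open>The graded Leibniz rule. Cochains may mix degrees, so the usual sign, which depends on
  the degree of the first factor, is put on \<open>a\<close> in each degree separately.\<close>

lemma coboundary_cup_product:
  fixes a b :: "'a cochain"
  shows "coboundary X (cup_product X a b) = (\<lambda>q s. cup_product X (coboundary X a) b q s
     + cup_product X (\<lambda>q s. (-1) ^ q * a q s) (coboundary X b) q s)"
proof (intro ext)
  fix q s
  show "coboundary X (cup_product X a b) q s = cup_product X (coboundary X a) b q s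
     + cup_product X (\<lambda>q s. (-1) ^ q * a q s) (coboundary X b) q s"
  proof (cases "singular_simplex q X s")
    case False
    then show ?thesis by (simp add: coboundary_non_simplex cup_product_non_simplex)
  next
    case s: True
    show ?thesis
    proof (cases q)
      case 0
      with s show ?thesis
        by (simp add: cup_product_simplex)
    next
      case (Suc r)
      define A where "A p k = a p (singular_face (Suc p) k (front_face (Suc p) s)) * b (r - p) (back_face (Suc p) (r - p) s)" for p k
      define B where "B p k = a p (front_face p s) * b (r - p) (singular_face (Suc (r - p)) k (back_face p (Suc (r - p)) s))" for p k
      have "coboundary X (cup_product X a b) q s
        = (\<Sum>k\<le>Suc r. \<Sum>p\<le>r. (-1) ^ k * (a p (front_face p (singular_face (Suc r) k s))
             * b (r - p) (back_face p (r - p) (singular_face (Suc r) k s))))"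
        using s singular_simplex_singular_face [OF s]
        by (simp add: coboundary_def Suc cup_product_simplex sum_distrib_left del: sum.atMost_Suc)
      also have "\<dots> = (\<Sum>k\<le>Suc r. \<Sum>p\<le>r. (-1) ^ k * (if k \<le> p then A p k else B p (k - p)))"
      proof (intro sum.cong refl)
        fix k p assume "k \<in> {..Suc r}" "p \<in> {..r}"
        then show "(-1) ^ k * (a p (front_face p (singular_face (Suc r) k s))
             * b (r - p) (back_face p (r - p) (singular_face (Suc r) k s)))
          = (-1) ^ k * (if k \<le> p then A p k else B p (k - p))"
          using back_face_singular_face [of k p "r - p" s]
          by (auto simp: A_def B_def front_face_singular_face)
      qed
      also have "\<dots> = (\<Sum>p\<le>r. \<Sum>k\<le>Suc r. (-1) ^ k * (if k \<le> p then A p k else B p (k - p)))"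
        by (rule sum.swap)
      \<comment> \<open>For each \<open>p\<close> the right side has two additional terms,
        \<open>A p (Suc p)\<close> and \<open>B p 0\<close>. Removing the last vertex of the front
        part or the first vertex of the back part gives the same product, and the two terms occur
        with opposite signs.\<close>
      also have "\<dots> = (\<Sum>p\<le>r. (\<Sum>k\<le>Suc p. (-1) ^ k * A p k) + (-1) ^ p * (\<Sum>k\<le>Suc (r - p). (-1) ^ k * B p k))"
      proof (intro sum.cong refl)
        fix p assume "p \<in> {..r}"
        then have p: "p \<le> r" by simp
        have "{..Suc r} = {..p} \<union> {Suc p..Suc r}"
          using p by auto
        then have "(\<Sum>k\<le>Suc r. (-1) ^ k * (if k \<le> p then A p k else B p (k - p)))
          = (\<Sum>k\<le>p. (-1) ^ k * A p k) + (\<Sum>k\<in>{Suc p..Suc r}. (-1) ^ k * B p (k - p))"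
          by (simp add: sum.union_disjoint)
        also have "(\<Sum>k\<in>{Suc p..Suc r}. (-1) ^ k * B p (k - p)) = (\<Sum>k\<in>{Suc 0..Suc (r - p)}. (-1) ^ (p + k) * B p k)"
          by (rule sum.reindex_bij_witness [of _ "\<lambda>k. k + p" "\<lambda>k. k - p"]) (use p in auto)
        also have "\<dots> = (-1) ^ p * (\<Sum>k\<in>{Suc 0..Suc (r - p)}. (-1) ^ k * B p k)"
          by (simp add: sum_distrib_left power_add mult.assoc del: sum.cl_ivl_Suc)
        also have "(\<Sum>k\<in>{Suc 0..Suc (r - p)}. (-1) ^ k * B p k) = (\<Sum>k\<le>Suc (r - p). (-1) ^ k * B p k) - B p 0"
          by (simp add: sum.atMost_Suc_shift sum.atLeast_Suc_atMost_Suc_shift atLeast0AtMost del: sum.cl_ivl_Suc sum.atMost_Suc)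
        also have "B p 0 = A p (Suc p)"
          using front_face_last_face [of p s] back_face_first_face [of "r - p" p s]
          by (simp add: A_def B_def)
        finally show "(\<Sum>k\<le>Suc r. (-1) ^ k * (if k \<le> p then A p k else B p (k - p)))
          = (\<Sum>k\<le>Suc p. (-1) ^ k * A p k) + (-1) ^ p * (\<Sum>k\<le>Suc (r - p). (-1) ^ k * B p k)"
          by (simp add: algebra_simps del: sum.atMost_Suc) simp
      qed
      also have "\<dots> = (\<Sum>p\<le>r. \<Sum>k\<le>Suc p. (-1) ^ k * A p k) + (\<Sum>p\<le>r. (-1) ^ p * (\<Sum>k\<le>Suc (r - p). (-1) ^ k * B p k))"
        by (rule sum.distrib)
      also have "(\<Sum>p\<le>r. \<Sum>k\<le>Suc p. (-1) ^ k * A p k) = cup_product X (coboundary X a) b q s"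
      proof -
        have "cup_product X (coboundary X a) b q s
          = (\<Sum>p\<le>r. coboundary X a (Suc p) (front_face (Suc p) s) * b (r - p) (back_face (Suc p) (r - p) s))"
          using s by (simp add: Suc cup_product_simplex sum.atMost_Suc_shift del: sum.atMost_Suc)
        also have "\<dots> = (\<Sum>p\<le>r. \<Sum>k\<le>Suc p. (-1) ^ k * A p k)"
          using s by (intro sum.cong refl)
            (simp add: Suc coboundary_def A_def singular_simplex_front_face sum_distrib_right mult.assoc del: sum.atMost_Suc)
        finally show ?thesis by simp
      qed
      also have "(\<Sum>p\<le>r. (-1) ^ p * (\<Sum>k\<le>Suc (r - p). (-1) ^ k * B p k))
        = cup_product X (\<lambda>q s. (-1) ^ q * a q s) (coboundary X b) q s"
      proof -
        have "cup_product X (\<lambda>q s. (-1) ^ q * a q s) (coboundary X b) q s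
          = (\<Sum>p\<le>r. (-1) ^ p * a p (front_face p s) * coboundary X b (Suc (r - p)) (back_face p (Suc (r - p)) s))"
          using s by (simp add: Suc cup_product_simplex Suc_diff_le)
        also have "\<dots> = (\<Sum>p\<le>r. (-1) ^ p * (\<Sum>k\<le>Suc (r - p). (-1) ^ k * B p k))"
        proof (intro sum.cong refl)
          fix p assume "p \<in> {..r}"
          then have "singular_simplex (Suc (r - p)) X (back_face p (Suc (r - p)) s)"
            using singular_simplex_back_face' [OF s, of p] by (simp add: Suc Suc_diff_le)
          then show "(-1) ^ p * a p (front_face p s) * coboundary X b (Suc (r - p)) (back_face p (Suc (r - p)) s)
            = (-1) ^ p * (\<Sum>k\<le>Suc (r - p). (-1) ^ k * B p k)"
            by (simp add: coboundary_def B_def sum_distrib_left mult_ac del: sum.atMost_Suc)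
        qed
        finally show ?thesis by simp
      qed
      finally show ?thesis .
    qed
  qed
qed

section \<open>The ring of cocycles and its quotient by the coboundaries\<close>

lemma coboundary_add: "coboundary X (\<lambda>q s. a q s + b q s) = (\<lambda>q s. coboundary X a q s + coboundary X b q s)"
  by (simp add: coboundary_def fun_eq_iff distrib_left sum.distrib)

lemma coboundary_minus: "coboundary X (\<lambda>q s. - a q s) = (\<lambda>q s. - coboundary X a q s)"
  by (simp add: coboundary_def fun_eq_iff sum_negf)

lemma coboundary_sign: "coboundary X (\<lambda>q s. (-1) ^ q * a q s) = (\<lambda>q s. - ((-1) ^ q * coboundary X a q s))"
proof (intro ext)
  fix q s
  show "coboundary X (\<lambda>q s. (-1) ^ q * a q s) q s = - ((-1) ^ q * coboundary X a q s)"
    by (cases q) (auto simp: coboundary_def sum_distrib_left mult_ac sum_negf simp flip: sum_negf simp del: sum.atMost_Suc)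
qed

lemma cochains_add: "a \<in> cochains X \<Longrightarrow> b \<in> cochains X \<Longrightarrow> (\<lambda>q s. a q s + b q s) \<in> cochains X"
proof -
  assume a: "a \<in> cochains X" and b: "b \<in> cochains X"
  obtain m n where "\<And>q s. q > m \<Longrightarrow> a q s = 0" and "\<And>q s. q > n \<Longrightarrow> b q s = 0"
    using finite_degrees [OF a] finite_degrees [OF b] by metis
  then show ?thesis
    using a b by (intro cochainsI [where m = "max m n"]) (auto simp: cochains_supportD)
qed

lemma cochains_minus: "a \<in> cochains X \<Longrightarrow> (\<lambda>q s. - a q s) \<in> cochains X"
  by (simp add: cochains_def)

lemma cochains_zero: "(\<lambda>q s. 0) \<in> cochains X"
  by (simp add: cochains_def)

lemma cochains_unit: "unit_cochain X \<in> cochains X"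
  by (rule cochainsI [where m = 0]) auto

lemma coboundary_unit: "coboundary X (unit_cochain X) = (\<lambda>q s. 0)"
proof (intro ext)
  fix q s
  show "coboundary X (unit_cochain X) q s = 0"
  proof (cases "singular_simplex q X s \<and> q = 1")
    case True
    then show ?thesis
      using singular_simplex_singular_face [of q X s]
      by (auto simp: coboundary_def)
  next
    case False
    then show ?thesis
      by (auto simp: coboundary_def)
  qed
qed

lemma cocycle_ring_simps [simp]:
  "c \<in> carrier (cocycle_ring X) \<longleftrightarrow> c \<in> cochains X \<and> coboundary X c = (\<lambda>q s. 0)"
  "a \<otimes>\<^bsub>cocycle_ring X\<^esub> b = cup_product X a b"
  "\<one>\<^bsub>cocycle_ring X\<^esub> = unit_cochain X"
  "\<zero>\<^bsub>cocycle_ring X\<^esub> = (\<lambda>q s. 0)"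
  "a \<oplus>\<^bsub>cocycle_ring X\<^esub> b = (\<lambda>q s. a q s + b q s)"
  by (simp_all add: cocycle_ring_def)

lemma ring_cocycle_ring: "ring (cocycle_ring X)"
proof (rule ringI)
  show "abelian_group (cocycle_ring X)"
  proof (rule abelian_groupI)
    show "\<exists>y\<in>carrier (cocycle_ring X). y \<oplus>\<^bsub>cocycle_ring X\<^esub> x = \<zero>\<^bsub>cocycle_ring X\<^esub>"
      if "x \<in> carrier (cocycle_ring X)" for x
      using that
      by (intro bexI [where x = "\<lambda>q s. - x q s"]) (auto simp: cochains_minus coboundary_minus)
  qed (auto simp: cochains_add coboundary_add cochains_zero fun_eq_iff coboundary_def)
  show "monoid (cocycle_ring X)"
    by (rule monoidI)
       (auto simp: cup_product_in_cochains coboundary_cup_product cup_product_assoc cochains_unit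
         coboundary_unit cup_product_unit_left cup_product_unit_right, auto simp: cup_product_def fun_eq_iff)
qed (auto simp: cup_product_add_left cup_product_add_right)

lemma coboundaries_subset: "coboundaries X \<subseteq> carrier (cocycle_ring X)"
  by (auto simp: coboundaries_def coboundary_in_cochains coboundary_coboundary)

lemma cup_product_zero_left: "cup_product X (\<lambda>q s. 0) b = (\<lambda>q s. 0)"
  by (simp add: cup_product_def fun_eq_iff)

lemma cup_product_zero_right: "cup_product X a (\<lambda>q s. 0) = (\<lambda>q s. 0)"
  by (simp add: cup_product_def fun_eq_iff)

lemma ideal_coboundaries: "ideal (coboundaries X) (cocycle_ring X)"
proof (rule idealI)
  interpret ring "cocycle_ring X"
    by (rule ring_cocycle_ring)
  show "ring (cocycle_ring X)"
    by (rule ring_cocycle_ring)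
  have minus: "\<ominus>\<^bsub>cocycle_ring X\<^esub> c = (\<lambda>q s. - c q s)" if "c \<in> carrier (cocycle_ring X)" for c
    using that by (intro minus_equality) (auto simp: cochains_minus coboundary_minus)
  show "subgroup (coboundaries X) (add_monoid (cocycle_ring X))"
  proof (rule add.subgroupI)
    show "coboundaries X \<subseteq> carrier (cocycle_ring X)"
      by (rule coboundaries_subset)
    show "coboundaries X \<noteq> {}"
      using cochains_zero by (auto simp: coboundaries_def)
    show "\<ominus>\<^bsub>cocycle_ring X\<^esub> c \<in> coboundaries X" if bc: "c \<in> coboundaries X" for c
    proof -
      obtain x where x: "x \<in> cochains X" and c: "c = coboundary X x"
        using bc by (auto simp: coboundaries_def)
      have "\<ominus>\<^bsub>cocycle_ring X\<^esub> c = coboundary X (\<lambda>q s. - x q s)"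
        using x by (simp add: minus c coboundary_in_cochains coboundary_coboundary coboundary_minus)
      then show ?thesis
        using x by (simp add: coboundaries_def cochains_minus)
    qed
    show "a \<oplus>\<^bsub>cocycle_ring X\<^esub> b \<in> coboundaries X" if "a \<in> coboundaries X" "b \<in> coboundaries X" for a b
      using that by (auto simp: coboundaries_def simp flip: coboundary_add intro: cochains_add)
  qed
next
  fix b a
  assume "b \<in> coboundaries X" and a: "a \<in> carrier (cocycle_ring X)"
  then obtain c where c: "c \<in> cochains X" and b: "b = coboundary X c"
    by (auto simp: coboundaries_def)
  \<comment> \<open>The Leibniz rule puts a sign on the first factor. Twisting the cocycle
    \<open>a\<close> beforehand undoes it, and the twist of a cocycle is again a cocycle.\<close>
  define a' where "a' = (\<lambda>q s. (-1) ^ q * a q s)"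
  have a': "a' \<in> cochains X" "coboundary X a' = (\<lambda>q s. 0)" "(\<lambda>q s. (-1) ^ q * a' q s) = a"
    using a by (auto simp: a'_def cochains_def coboundary_sign fun_eq_iff simp flip: mult.assoc power_add)
  have "cup_product X a b = coboundary X (cup_product X a' c)"
    by (simp add: coboundary_cup_product a' b cup_product_zero_left)
  then show "a \<otimes>\<^bsub>cocycle_ring X\<^esub> b \<in> coboundaries X"
    using a' c by (auto simp: coboundaries_def cup_product_in_cochains)
  have "cup_product X b a = coboundary X (cup_product X c a)"
    using a by (simp add: coboundary_cup_product b cup_product_zero_right)
  then show "b \<otimes>\<^bsub>cocycle_ring X\<^esub> a \<in> coboundaries X"
    using a c by (auto simp: coboundaries_def cup_product_in_cochains)
qed

lemma coset_zero_iff: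
  assumes "c \<in> carrier (cocycle_ring X)"
  shows "coboundaries X +>\<^bsub>cocycle_ring X\<^esub> c = \<zero>\<^bsub>cohomology_ring X\<^esub> \<longleftrightarrow> c \<in> coboundaries X"
proof -
  interpret ideal "coboundaries X" "cocycle_ring X"
    by (rule ideal_coboundaries)
  show ?thesis
    using assms a_coset_join1 [OF _ assms] a_coset_join2 [OF assms] a_subgroup
    by (auto simp: cohomology_ring_def FactRing_def simp del: cocycle_ring_simps)
qed

lemma cohomology_class_cases:
  assumes "A \<in> carrier (cohomology_ring X)"
  obtains a where "a \<in> carrier (cocycle_ring X)" "A = coboundaries X +>\<^bsub>cocycle_ring X\<^esub> a"
  using assms by (auto simp: cohomology_ring_def FactRing_def A_RCOSETS_def')

lemma foldr_cup_product_in_cocycles: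
  assumes "set cs \<subseteq> carrier (cocycle_ring X)"
  shows "foldr (cup_product X) cs (unit_cochain X) \<in> carrier (cocycle_ring X)"
proof -
  interpret ring "cocycle_ring X"
    by (rule ring_cocycle_ring)
  show ?thesis
    using assms
  proof (induction cs)
    case Nil
    then show ?case using one_closed by (simp del: cocycle_ring_simps(1))
  next
    case (Cons c cs)
    then show ?case
      using m_closed [of c "foldr (cup_product X) cs (unit_cochain X)"] by (simp del: cocycle_ring_simps(1))
  qed
qed

text \<open>Moves the products in the definition of the cup length from cosets to representing
  cocycles.\<close>

lemma foldr_cohomology_mult:
  assumes "set cs \<subseteq> carrier (cocycle_ring X)"
  shows "foldr (\<otimes>\<^bsub>cohomology_ring X\<^esub>) (map (\<lambda>c. coboundaries X +>\<^bsub>cocycle_ring X\<^esub> c) cs) \<one>\<^bsub>cohomology_ring X\<^esub>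
    = coboundaries X +>\<^bsub>cocycle_ring X\<^esub> foldr (cup_product X) cs (unit_cochain X)"
  using assms
proof (induction cs)
  case Nil
  then show ?case by (simp add: cohomology_ring_def FactRing_def)
next
  case (Cons c cs)
  interpret ideal "coboundaries X" "cocycle_ring X"
    by (rule ideal_coboundaries)
  show ?case
    using Cons rcoset_mult_add [of c "foldr (cup_product X) cs (unit_cochain X)"]
      foldr_cup_product_in_cocycles [of cs X]
    by (simp add: cohomology_ring_def FactRing_def del: cocycle_ring_simps(1))
qed

section \<open>Natural chain homotopies\<close>

text \<open>The contraction makes \<open>c\<close> homologous to its image in a single point. There
  every cycle of positive degree bounds, while a chain of degree 0 is its augmentation times the
  point. This is why the augmentation has to vanish in degree 0.\<close>

lemma contractible_space_bounding_chain:
  fixes Y :: "'a topology"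
  assumes Y: "contractible_space Y" and c: "singular_chain q Y c" "chain_boundary q c = 0"
    and augmentation: "q = 0 \<Longrightarrow> frag_eval (\<lambda>_. 1) c = 0"
  obtains d where "singular_chain (Suc q) Y d" "chain_boundary (Suc q) d = c"
proof (cases "topspace Y = {}")
  case True
  then have "c = 0"
    using c(1) by (simp add: singular_chain_empty)
  then show ?thesis
    using that [of 0] by simp
next
  case False
  obtain a where htpy: "homotopic_with (\<lambda>h. h \<in> {} \<rightarrow> ({}::'a set)) Y Y id (\<lambda>x. a)"
    using Y by (auto simp: contractible_space_def)
  have cont: "continuous_map Y Y (\<lambda>x. a)"
    using homotopic_with_imp_continuous_maps [OF htpy] by blast
  then have a: "a \<in> topspace Y"
    using False by (auto simp: continuous_map_def)
  have cyc: "singular_relcycle q Y {} c"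
    using c by (simp add: singular_cycle)
  have hom: "homologous_rel q Y {} c (chain_map q (\<lambda>x. a) c)"
    using homotopic_imp_homologous_rel_chain_maps [OF htpy cyc] chain_map_ident [OF c(1)] by simp
  have "singular_relboundary q Y {} (chain_map q (\<lambda>x. a) c)"
  proof (cases "q = 0")
    case True
    let ?pt = "restrict (\<lambda>x. a) (standard_simplex q)"
    have "chain_map q (\<lambda>x. a) x = frag_cmul (frag_eval (\<lambda>_. 1) x) (frag_of ?pt)" for x :: "'a chain"
      using subset_UNIV
    proof (induction x rule: frag_induction)
      case (one s)
      have "simplex_map q (\<lambda>x. a) s = ?pt"
        by (auto simp: simplex_map_def)
      then show ?case by (simp add: restrict_def)
    qed (auto simp: chain_map_diff frag_eval_diff frag_cmul_diff_distrib)
    then show ?thesis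
      using augmentation [OF True] by simp
  next
    case False
    have ta: "topspace (subtopology Y {a}) = {a}"
      using a by simp
    have "singular_relcycle q (subtopology Y {a}) {} (chain_map q (\<lambda>x. a) c)"
      using cyc by (rule singular_relcycle_chain_map) (use a in \<open>auto simp: continuous_map_in_subtopology\<close>)
    then have "singular_relboundary q (subtopology Y {a}) {} (chain_map q (\<lambda>x. a) c)"
      using False by (simp add: singular_boundary_eq_cycle_singleton [OF ta])
    then show ?thesis
      unfolding singular_boundary using singular_chain_of_subtopology by blast
  qed
  then have "singular_relboundary q Y {} c"
    using hom singular_relboundary_add unfolding homologous_rel_def by fastforce
  then show ?thesis
    using that by (auto simp: singular_boundary)
qed

lemma contractible_space_standard_simplex:
  "contractible_space (subtopology (powertop_real UNIV) (standard_simplex q))"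
proof -
  let ?S = "subtopology (powertop_real UNIV) (standard_simplex q)"
  let ?e = "\<lambda>i::nat. if i = 0 then 1 else 0 :: real"
  let ?h = "\<lambda>(u, x) i. (1 - u) * x i + u * ?e i"
  have "continuous_map (prod_topology (top_of_set {0..1}) ?S) (powertop_real UNIV) ?h"
    unfolding continuous_map_componentwise_UNIV
  proof
    fix i
    have "continuous_map (prod_topology (top_of_set {0..1}) ?S) euclideanreal (\<lambda>z. (snd z) i)"
      using continuous_map_compose [OF continuous_map_snd continuous_map_from_subtopology
          [OF continuous_map_product_projection [of i UNIV "\<lambda>i. euclideanreal"]]]
      by (simp add: comp_def)
    moreover have "continuous_map (prod_topology (top_of_set {0..1}) ?S) euclideanreal fst"
      using continuous_map_fst continuous_map_into_fulltopology by blast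
    ultimately have "continuous_map (prod_topology (top_of_set {0..1}) ?S) euclideanreal
        (\<lambda>z. (1 - fst z) * (snd z) i + fst z * ?e i)"
      by (intro continuous_intros)
    then show "continuous_map (prod_topology (top_of_set {0..1}) ?S) euclideanreal (\<lambda>z. ?h z i)"
      by (simp add: case_prod_unfold)
  qed
  moreover have "?h \<in> topspace (prod_topology (top_of_set {0..1}) ?S) \<rightarrow> standard_simplex q"
    using convex_standard_simplex [of _ q ?e] by auto
  ultimately have "continuous_map (prod_topology (top_of_set {0..1}) ?S) ?S ?h"
    by (simp add: continuous_map_in_subtopology)
  then have "homotopic_with (\<lambda>x. True) ?S ?S id (\<lambda>x. ?e)"
    unfolding homotopic_with_def by (intro exI [of _ ?h]) auto
  then show ?thesis
    unfolding contractible_space_def by blast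
qed

text \<open>
  The prism operator is assembled from model chains on the products of the unit interval with the
  standard simplices. These are contractible, so that a model with the prescribed boundary exists.
\<close>

definition prism_of :: "(real \<times> (nat \<Rightarrow> real)) chain \<Rightarrow> nat \<Rightarrow> (real \<times> 'a \<Rightarrow> 'b) \<Rightarrow> 'a chain \<Rightarrow> 'b chain" where
  "prism_of m q H = frag_extend (\<lambda>s. chain_map (Suc q) (\<lambda>(t, x). H (t, s x)) m)"

abbreviation id_simplex :: "nat \<Rightarrow> (nat \<Rightarrow> real) chain" where
  "id_simplex q \<equiv> frag_of (restrict id (standard_simplex q))"

abbreviation simplex_space :: "nat \<Rightarrow> (nat \<Rightarrow> real) topology" where
  "simplex_space q \<equiv> subtopology (powertop_real UNIV) (standard_simplex q)"

abbreviation cylinder :: "'a topology \<Rightarrow> (real \<times> 'a) topology" where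
  "cylinder X \<equiv> prod_topology (top_of_set {0..1}) X"

text \<open>The method of acyclic models: the next model has to fill top minus bottom minus the
  prism over the boundary of the simplex. \<open>prism_of\<close> takes the model as an argument so
  that this recursion can refer to the model one degree lower. That the choices are possible is
  shown only in \<open>good_model\<close>, by an induction that uses the boundary formula in lower
  degrees.\<close>

primrec prism_model :: "nat \<Rightarrow> (real \<times> (nat \<Rightarrow> real)) chain" where
  "prism_model 0 = (SOME d. singular_chain (Suc 0) (cylinder (simplex_space 0)) d \<and>
     chain_boundary (Suc 0) d = chain_map 0 (Pair 1) (id_simplex 0) - chain_map 0 (Pair 0) (id_simplex 0))"
| "prism_model (Suc q) = (SOME d. singular_chain (Suc (Suc q)) (cylinder (simplex_space (Suc q))) d \<and>
     chain_boundary (Suc (Suc q)) d = chain_map (Suc q) (Pair 1) (id_simplex (Suc q))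
       - chain_map (Suc q) (Pair 0) (id_simplex (Suc q))
       - prism_of (prism_model q) q id (chain_boundary (Suc q) (id_simplex (Suc q))))"

definition prism :: "nat \<Rightarrow> (real \<times> 'a \<Rightarrow> 'b) \<Rightarrow> 'a chain \<Rightarrow> 'b chain" where
  "prism q = prism_of (prism_model q) q"

lemma prism_0 [simp]: "prism q H 0 = 0"
  by (simp add: prism_def prism_of_def)

lemma prism_diff: "prism q H (a - b) = prism q H a - prism q H b"
  by (simp add: prism_def prism_of_def frag_extend_diff)

lemma prism_of_simplex:
  "prism q H (frag_of s) = chain_map (Suc q) (\<lambda>(t, x). H (t, s x)) (prism_model q)"
  by (simp add: prism_def prism_of_def)

lemma chain_map_prism: "chain_map (Suc q) g (prism q H c) = prism q (g \<circ> H) c"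
  using subset_UNIV
proof (induction c rule: frag_induction)
  case (one s)
  have "(g \<circ> (\<lambda>(t, x). H (t, s x))) = (\<lambda>(t, x). (g \<circ> H) (t, s x))"
    by auto
  then show ?case
    using chain_map_compose [of "Suc q" g "\<lambda>(t, x). H (t, s x)"]
    by (simp add: prism_of_simplex)
qed (auto simp: prism_diff chain_map_diff)

text \<open>In degree 0 the truncated \<open>q - Suc 0\<close> does no harm, as the boundary of a
  0-chain is 0 and the last term disappears.\<close>

definition good_model :: "nat \<Rightarrow> bool" where
  "good_model q \<longleftrightarrow> singular_chain (Suc q) (cylinder (simplex_space q)) (prism_model q) \<and>
     chain_boundary (Suc q) (prism_model q) = chain_map q (Pair 1) (id_simplex q)
       - chain_map q (Pair 0) (id_simplex q) - prism (q - Suc 0) id (chain_boundary q (id_simplex q))"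

lemma singular_simplex_id: "singular_simplex q (simplex_space q) (restrict id (standard_simplex q))"
  by (simp add: simplicial_imp_singular_simplex)

lemma continuous_map_simplex_cylinder:
  assumes "singular_simplex q X s" and "continuous_map (cylinder X) Y H"
  shows "continuous_map (cylinder (simplex_space q)) Y (\<lambda>(t, x). H (t, s x))"
proof -
  have "continuous_map (simplex_space q) X s"
    using assms(1) by (simp add: singular_simplex_def)
  then have "continuous_map (cylinder (simplex_space q)) (cylinder X) (\<lambda>(t, x). (t, s x))"
    unfolding case_prod_unfold continuous_map_pairwise comp_def
    using continuous_map_compose [OF continuous_map_snd, of "simplex_space q" X s "top_of_set {0..1}"]
    by (simp add: comp_def continuous_map_fst)
  from continuous_map_compose [OF this assms(2)] show ?thesis
    by (simp add: case_prod_unfold comp_def)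
qed

lemma prism_chain_map_aux:
  assumes m: "singular_chain (Suc q) (cylinder (simplex_space q)) (prism_model q)"
  shows "prism q H (chain_map q g c) = prism q (\<lambda>(t, x). H (t, g x)) c"
  using subset_UNIV
proof (induction c rule: frag_induction)
  case (one s)
  show ?case
    unfolding chain_map_of prism_of_simplex
    by (rule chain_map_eq [OF m]) (auto simp: simplex_map_def)
qed (auto simp: prism_diff chain_map_diff)

text \<open>The boundary formula of the model is pushed forward along the map that takes
  \<open>(t, x)\<close> to \<open>H (t, s x)\<close>. Goodness of the models is a hypothesis,
  because the proof that they are good uses this lemma in lower degrees.\<close>

lemma prism_boundary_aux:
  assumes m: "good_model q" and m': "q > 0 \<Longrightarrow> good_model (q - Suc 0)"
    and H: "continuous_map (cylinder X) Y H" and c: "singular_chain q X c"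
  shows "chain_boundary (Suc q) (prism q H c) = chain_map q (\<lambda>x. H (1, x)) c
     - chain_map q (\<lambda>x. H (0, x)) c - prism (q - Suc 0) H (chain_boundary q c)"
  using c unfolding singular_chain_def
proof (induction c rule: frag_induction)
  case (one s)
  then have s: "singular_simplex q X s" by simp
  let ?g = "\<lambda>(t, x). H (t, s x)"
  have m1: "singular_chain (Suc q) (cylinder (simplex_space q)) (prism_model q)"
    and m2: "chain_boundary (Suc q) (prism_model q) = chain_map q (Pair 1) (id_simplex q)
       - chain_map q (Pair 0) (id_simplex q) - prism (q - Suc 0) id (chain_boundary q (id_simplex q))"
    using m by (auto simp: good_model_def)
  have end_map: "chain_map q ?g (chain_map q (Pair t) (id_simplex q)) = chain_map q (\<lambda>x. H (t, x)) (frag_of s)" for t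
  proof -
    have "chain_map q ?g (chain_map q (Pair t) (id_simplex q)) = chain_map q (?g \<circ> Pair t) (id_simplex q)"
      by (simp only: chain_map_compose comp_apply)
    also have "?g \<circ> Pair t = (\<lambda>x. H (t, x)) \<circ> s"
      by auto
    also have "chain_map q ((\<lambda>x. H (t, x)) \<circ> s) (id_simplex q)
        = (chain_map q (\<lambda>x. H (t, x)) \<circ> chain_map q s) (id_simplex q)"
      by (rule fun_cong [OF chain_map_compose])
    also have "\<dots> = chain_map q (\<lambda>x. H (t, x)) (chain_map q s (id_simplex q))"
      by (rule comp_apply)
    also have "chain_map q s (id_simplex q) = frag_of s"
      by (rule singular_simplex_chain_map_id [OF s])
    finally show ?thesis .
  qed
  have bd: "chain_map q ?g (prism (q - Suc 0) id (chain_boundary q (id_simplex q)))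
    = prism (q - Suc 0) H (chain_boundary q (frag_of s))"
  proof (cases q)
    case 0
    then show ?thesis by (simp add: chain_boundary_def)
  next
    case (Suc p)
    have m3: "singular_chain (Suc p) (cylinder (simplex_space p)) (prism_model p)"
      using m' by (simp add: Suc good_model_def)
    have "chain_boundary q (frag_of s) = chain_boundary q (chain_map q s (id_simplex q))"
      by (simp only: singular_simplex_chain_map_id [OF s])
    also have "\<dots> = chain_map p s (chain_boundary q (id_simplex q))"
      using singular_simplex_id [of q] chain_boundary_chain_map [of q "simplex_space q" "id_simplex q" s]
      by (simp add: Suc singular_chain_of)
    finally show ?thesis
      by (simp add: Suc chain_map_prism prism_chain_map_aux [OF m3])
  qed
  show ?case
    using chain_boundary_chain_map [OF m1, of ?g]
    by (simp add: prism_of_simplex m2 chain_map_diff end_map bd del: chain_map_of)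
qed (auto simp: prism_diff chain_map_diff chain_boundary_diff)

text \<open>The prescribed boundary \<open>z\<close> is a cycle: by the formula one degree lower,
  the boundary of its last term cancels the boundaries of top and bottom. The cylinder over a
  simplex is contractible, so \<open>z\<close> bounds. In degree 0 it is a difference of two points
  and has augmentation 0.\<close>

lemma good_model: "good_model q"
proof (induction q rule: less_induct)
  case (less q)
  define z where "z = chain_map q (Pair 1) (id_simplex q)
       - chain_map q (Pair 0) (id_simplex q) - prism (q - Suc 0) id (chain_boundary q (id_simplex q))"
  let ?Y = "cylinder (simplex_space q)"
  have idc: "singular_chain q (simplex_space q) (id_simplex q)"
    by (simp add: singular_chain_of singular_simplex_id)
  have cont: "continuous_map (simplex_space q) ?Y (Pair t)" if "t \<in> {0..1}" for t :: real
    using that unfolding continuous_map_pairwise comp_def by simp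
  have "continuous_map ?Y ?Y id"
    by simp
  have "contractible_space (top_of_set {0..1::real})"
    unfolding contractible_space_top_of_set by (rule convex_imp_contractible) (rule convex_real_interval)
  then have "contractible_space ?Y"
    unfolding contractible_space_prod_topology using contractible_space_standard_simplex by blast
  moreover have "singular_chain q ?Y z"
  proof -
    have "singular_chain q ?Y (prism (q - Suc 0) id (chain_boundary q (id_simplex q)))"
    proof (cases q)
      case 0
      then show ?thesis by (simp add: chain_boundary_def)
    next
      case (Suc p)
      have m: "singular_chain (Suc p) (cylinder (simplex_space p)) (prism_model p)"
        using less.IH [of p] by (simp add: Suc good_model_def)
      have "singular_chain p (simplex_space q) (chain_boundary q (id_simplex q))"
        using singular_chain_boundary [OF idc] by (simp add: Suc)
      then show ?thesis
        unfolding Suc prism_def prism_of_def diff_Suc_Suc minus_nat.diff_0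
        by (intro singular_chain_extend singular_chain_chain_map [OF m] continuous_map_simplex_cylinder)
           (auto simp: singular_chain_def)
    qed
    then show ?thesis
      unfolding z_def
      by (intro singular_chain_diff singular_chain_chain_map [OF idc] cont) auto
  qed
  moreover have "chain_boundary q z = 0"
  proof (cases q)
    case 0
    then show ?thesis by (simp add: chain_boundary_def)
  next
    case (Suc p)
    have bc: "singular_chain p (simplex_space q) (chain_boundary q (id_simplex q))"
      using singular_chain_boundary [OF idc] by (simp add: Suc)
    have "good_model p" and "p > 0 \<Longrightarrow> good_model (p - Suc 0)"
      using less.IH by (auto simp: Suc)
    then have "chain_boundary (Suc p) (prism p id (chain_boundary q (id_simplex q)))
      = chain_map p (Pair 1) (chain_boundary q (id_simplex q)) - chain_map p (Pair 0) (chain_boundary q (id_simplex q))"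
      using prism_boundary_aux [OF _ _ \<open>continuous_map ?Y ?Y id\<close> bc] chain_boundary_boundary [OF idc]
      by (simp add: Suc)
    then show ?thesis
      using chain_boundary_chain_map [OF idc, of "Pair (0::real)"] chain_boundary_chain_map [OF idc, of "Pair (1::real)"]
      by (simp add: z_def Suc chain_boundary_diff del: chain_map_of)
  qed
  moreover have "frag_eval (\<lambda>_. 1) z = 0" if "q = 0"
    using that by (simp add: z_def frag_eval_diff chain_boundary_def)
  ultimately have ex: "\<exists>d. singular_chain (Suc q) ?Y d \<and> chain_boundary (Suc q) d = z"
    using contractible_space_bounding_chain by metis
  have eq: "prism_model q = (SOME d. singular_chain (Suc q) ?Y d \<and> chain_boundary (Suc q) d = z)"
    by (cases q) (simp_all add: z_def prism_def chain_boundary_def [of 0] prism_of_def)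
  show ?case
    using someI_ex [OF ex, folded eq] by (simp only: good_model_def z_def)
qed

lemma singular_chain_prism_model: "singular_chain (Suc q) (cylinder (simplex_space q)) (prism_model q)"
  using good_model by (simp add: good_model_def)

lemma singular_chain_prism:
  assumes "continuous_map (cylinder X) Y H" and "singular_chain q X c"
  shows "singular_chain (Suc q) Y (prism q H c)"
  unfolding prism_def prism_of_def using assms
  by (intro singular_chain_extend singular_chain_chain_map [OF singular_chain_prism_model]
      continuous_map_simplex_cylinder) (auto simp: singular_chain_def)

lemma chain_boundary_prism:
  assumes "continuous_map (cylinder X) Y H" and "singular_chain q X c"
  shows "chain_boundary (Suc q) (prism q H c) = chain_map q (\<lambda>x. H (1, x)) c
     - chain_map q (\<lambda>x. H (0, x)) c - prism (q - Suc 0) H (chain_boundary q c)"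
  using prism_boundary_aux [OF good_model good_model assms] .

text \<open>Naturality in the source, as \<open>chain_map_prism\<close> is naturality in the target.
  Together they show that a cone dies under a map if the cycle below it does and the map makes the
  homotopy stationary.\<close>

lemma prism_chain_map: "prism q H (chain_map q g c) = prism q (\<lambda>(t, x). H (t, g x)) c"
  by (rule prism_chain_map_aux [OF singular_chain_prism_model])

section \<open>Vanishing of products by the Lusternik-Schnirelmann method\<close>

lemma zero_in_coboundaries: "(\<lambda>q s. 0) \<in> coboundaries X"
  using cochains_zero [of X] by (force simp: coboundaries_def coboundary_def)

lemma mem_coset_iff:
  "b \<in> coboundaries X +>\<^bsub>cocycle_ring X\<^esub> a \<longleftrightarrow> (\<exists>h\<in>coboundaries X. b = (\<lambda>q s. h q s + a q s))"
  by (auto simp: a_r_coset_def')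

lemma reduced_class_restriction:
  assumes A: "A \<in> reduced_cohomology X x0" and a: "a \<in> A"
  obtains e where "e \<in> cochains (subtopology X {x0})"
    "\<And>q s. singular_simplex q (subtopology X {x0}) s \<Longrightarrow> a q s = coboundary X e q s"
proof -
  let ?Y = "subtopology X {x0}"
  have "cohomology_map ?Y id A = coboundaries ?Y"
    using A by (simp add: reduced_cohomology_def a_kernel_def' cohomology_ring_def FactRing_def)
  then have "coboundaries ?Y +>\<^bsub>cocycle_ring ?Y\<^esub> cochain_pullback ?Y id a \<subseteq> coboundaries ?Y"
    using a unfolding cohomology_map_def by blast
  moreover have "cochain_pullback ?Y id a \<in> coboundaries ?Y +>\<^bsub>cocycle_ring ?Y\<^esub> cochain_pullback ?Y id a"
    unfolding mem_coset_iff by (rule bexI [OF _ zero_in_coboundaries]) simp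
  ultimately obtain e where e: "e \<in> cochains ?Y" and eq: "cochain_pullback ?Y id a = coboundary ?Y e"
    by (auto simp: coboundaries_def)
  have "a q s = coboundary X e q s" if s: "singular_simplex q ?Y s" for q s
  proof -
    have "restrict s (standard_simplex q) = s"
      using s by (simp add: singular_simplex_def extensional_restrict)
    then have "a q s = cochain_pullback ?Y id a q s"
      using s by (simp add: cochain_pullback_def)
    then show ?thesis
      by (simp add: eq coboundary_subtopology [OF s])
  qed
  with e show ?thesis using that by blast
qed

text \<open>On \<open>U\<close> the inclusion is homotopic to the constant map at \<open>x0\<close>,
  so up to a coboundary a representative \<open>a\<close> agrees there with the pullback of its
  restriction to \<open>x0\<close>. The class is reduced, hence that restriction is a coboundary and
  so is \<open>a\<close> on \<open>U\<close>. Its primitive on \<open>U\<close>, extended by zero,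
  corrects \<open>a\<close> to a representative that vanishes on \<open>U\<close>.\<close>

lemma reduced_class_vanishing_on:
  assumes A: "A \<in> reduced_cohomology X x0" and x0: "x0 \<in> topspace X"
    and htpy: "homotopic_with (\<lambda>_. True) (subtopology X U) X id (\<lambda>_. x0)"
  obtains b where "b \<in> carrier (cocycle_ring X)" "A = coboundaries X +>\<^bsub>cocycle_ring X\<^esub> b"
    "\<And>q s. singular_simplex q (subtopology X U) s \<Longrightarrow> b q s = 0"
proof -
  interpret I: ideal "coboundaries X" "cocycle_ring X"
    by (rule ideal_coboundaries)
  let ?U = "subtopology X U" and ?k = "\<lambda>_::'a. x0"
  obtain H where H: "continuous_map (cylinder ?U) X H" and H0: "\<And>x. H (0, x) = x" and H1: "\<And>x. H (1, x) = x0"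
    using htpy by (auto simp: homotopic_with_def)
  obtain a where a: "a \<in> carrier (cocycle_ring X)" and Aa: "A = coboundaries X +>\<^bsub>cocycle_ring X\<^esub> a"
    using A cohomology_class_cases unfolding reduced_cohomology_def a_kernel_def' by blast
  have "a \<in> A"
    unfolding Aa using a by (rule I.a_rcos_self)
  then obtain e where e: "e \<in> cochains (subtopology X {x0})"
    and ae: "\<And>q s. singular_simplex q (subtopology X {x0}) s \<Longrightarrow> a q s = coboundary X e q s"
    using reduced_class_restriction [OF A] by metis
  \<comment> \<open>The primitive at the base point is pulled back along the constant map. The
    second term comes from the homotopy.\<close>
  define g where "g q s = (if singular_simplex q ?U s
    then e q (simplex_map q ?k s) - frag_eval (a (Suc q)) (prism q H (frag_of s)) else 0)" for q s
  have g: "frag_eval (g q) c = frag_eval (e q) (chain_map q ?k c) - frag_eval (a (Suc q)) (prism q H c)"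
    if "singular_chain q ?U c" for q c
    using that unfolding singular_chain_def
    by (induction c rule: frag_induction) (auto simp: g_def frag_eval_diff chain_map_diff prism_diff)
  obtain m where m: "\<And>q s. q > m \<Longrightarrow> e q s = 0"
    using finite_degrees [OF e] by metis
  obtain n where n: "\<And>q s. q > n \<Longrightarrow> a q s = 0"
    using finite_degrees [of a X] a by auto
  have g_cochain: "g \<in> cochains X"
  proof (rule cochainsI [where m = "max m n"])
    show "g q s = 0" if "\<not> singular_simplex q X s" for q s
      using that singular_simplex_of_subtopology by (auto simp: g_def)
    show "g q s = 0" if "q > max m n" for q s
      using that by (simp add: g_def m n frag_eval_eq_0)
  qed
  have ag: "a q s = coboundary X g q s" if s: "singular_simplex q ?U s" for q s
  proof -
    have sc: "singular_chain q ?U (frag_of s)"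
      using s by (simp add: singular_chain_of)
    have ks: "singular_simplex q (subtopology X {x0}) (simplex_map q ?k s)"
      using s x0 by (intro singular_simplex_simplex_map [of q ?U]) (auto simp: continuous_map_in_subtopology)
    have "frag_eval (a q) (chain_boundary (Suc q) (prism q H (frag_of s))) = 0"
      using frag_eval_coboundary [OF singular_chain_prism [OF H sc], of a] a
      by (simp add: frag_eval_eq_0)
    then have "a q s = coboundary X e q (simplex_map q ?k s)
        - frag_eval (a q) (prism (q - Suc 0) H (chain_boundary q (frag_of s)))"
      unfolding chain_boundary_prism [OF H sc] using chain_map_ident [OF sc] ae [OF ks]
      by (simp add: H0 H1 frag_eval_diff id_def del: chain_map_of) (simp add: chain_map_of)
    also have "\<dots> = coboundary X g q s"
    proof (cases q)
      case 0
      then show ?thesis by (simp add: chain_boundary_def)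
    next
      case (Suc p)
      have "chain_boundary q (frag_of (simplex_map q ?k s)) = chain_map p ?k (chain_boundary q (frag_of s))"
        using chain_boundary_chain_map [OF sc, of ?k] by (simp add: Suc)
      moreover have "singular_chain p ?U (chain_boundary q (frag_of s))"
        using singular_chain_boundary [OF sc] by (simp add: Suc)
      ultimately show ?thesis
        using s ks by (simp add: Suc coboundary_apply singular_simplex_of_subtopology g)
    qed
    finally show ?thesis .
  qed
  define b where "b = (\<lambda>q s. coboundary X (\<lambda>q s. - g q s) q s + a q s)"
  have ng: "(\<lambda>q s. - g q s) \<in> cochains X"
    using g_cochain by (rule cochains_minus)
  show ?thesis
  proof
    show "b \<in> carrier (cocycle_ring X)"
      using a ng by (simp add: b_def cochains_add coboundary_add coboundary_in_cochains coboundary_coboundary)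
    have "b \<in> coboundaries X +>\<^bsub>cocycle_ring X\<^esub> a"
      unfolding mem_coset_iff
      by (rule bexI [where x = "coboundary X (\<lambda>q s. - g q s)"]) (use ng in \<open>auto simp: b_def coboundaries_def\<close>)
    then show "A = coboundaries X +>\<^bsub>cocycle_ring X\<^esub> b"
      unfolding Aa using I.a_repr_independence [OF _ a I.a_subgroup] by blast
    show "b q s = 0" if "singular_simplex q ?U s" for q s
      using ag [OF that] by (simp add: b_def coboundary_minus)
  qed
qed

lemma cup_product_vanishing_on:
  assumes s: "singular_simplex q (subtopology X U) s"
    and vanish: "(\<forall>q s. singular_simplex q (subtopology X U) s \<longrightarrow> a q s = 0) \<or>
      (\<forall>q s. singular_simplex q (subtopology X U) s \<longrightarrow> b q s = 0)"
  shows "cup_product X a b q s = 0"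
  using vanish singular_simplex_back_face' [OF s]
  using singular_simplex_front_face [OF s]
  by (auto simp: cup_product_def intro!: sum.neutral)

lemma foldr_cup_product_vanishing_on:
  assumes "b \<in> set bs" and "\<And>q s. singular_simplex q (subtopology X U) s \<Longrightarrow> b q s = 0"
    and "singular_simplex q (subtopology X U) s"
  shows "foldr (cup_product X) bs (unit_cochain X) q s = 0"
  using assms(1,3)
proof (induction bs arbitrary: q s)
  case (Cons c bs)
  then show ?case
    using assms(2) by (auto intro: cup_product_vanishing_on)
qed simp

theorem reduced_cohomology_products_vanish:
  assumes x0: "x0 \<in> topspace X"
    and open_U: "\<And>i. i \<le> n \<Longrightarrow> openin X (U i)" and cover: "topspace X \<subseteq> (\<Union>i\<le>n. U i)"
    and htpy: "\<And>i. i \<le> n \<Longrightarrow> homotopic_with (\<lambda>_. True) (subtopology X (U i)) X id (\<lambda>_. x0)"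
    and as: "set as \<subseteq> reduced_cohomology X x0" and len: "length as > n"
  shows "foldr (\<otimes>\<^bsub>cohomology_ring X\<^esub>) as \<one>\<^bsub>cohomology_ring X\<^esub> = \<zero>\<^bsub>cohomology_ring X\<^esub>"
proof -
  \<comment> \<open>The first \<open>n + 1\<close> representatives vanish on one set of the cover
    each. Further factors keep any representative, as one vanishing factor is enough on each
    set.\<close>
  let ?P = "\<lambda>i b. b \<in> carrier (cocycle_ring X) \<and> as ! i = coboundaries X +>\<^bsub>cocycle_ring X\<^esub> b
    \<and> (i \<le> n \<longrightarrow> (\<forall>q s. singular_simplex q (subtopology X (U i)) s \<longrightarrow> b q s = 0))"
  have "\<exists>b. ?P i b" if "i < length as" for i
  proof -
    have A: "as ! i \<in> reduced_cohomology X x0"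
      using as that by auto
    show ?thesis
    proof (cases "i \<le> n")
      case True
      from reduced_class_vanishing_on [OF A x0 htpy [OF True]] show ?thesis by metis
    next
      case False
      then show ?thesis
        using A cohomology_class_cases unfolding reduced_cohomology_def a_kernel_def' by blast
    qed
  qed
  then obtain f where f: "\<And>i. i < length as \<Longrightarrow> ?P i (f i)"
    by metis
  define bs where "bs = map f [0..<length as]"
  have bs: "set bs \<subseteq> carrier (cocycle_ring X)"
    using f by (auto simp: bs_def)
  have as_eq: "as = map (\<lambda>c. coboundaries X +>\<^bsub>cocycle_ring X\<^esub> c) bs"
    by (rule nth_equalityI) (use f in \<open>auto simp: bs_def\<close>)
  let ?c = "foldr (cup_product X) bs (unit_cochain X)"
  have c: "?c \<in> carrier (cocycle_ring X)"
    by (rule foldr_cup_product_in_cocycles [OF bs])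
  have "?c \<in> coboundaries X"
  proof (rule cocycle_vanishing_on_small_simplices [of "U ` {..n}"])
    fix q s assume "small_simplex q X (U ` {..n}) s"
    then obtain i where i: "i \<le> n" and s: "singular_simplex q (subtopology X (U i)) s"
      by (auto simp: small_simplex_def)
    have "f i \<in> set bs"
      using i len by (auto simp: bs_def)
    then show "?c q s = 0"
      by (rule foldr_cup_product_vanishing_on [OF _ _ s]) (use f [of i] i len in auto)
  qed (use open_U cover c in auto)
  then show ?thesis
    unfolding as_eq foldr_cohomology_mult [OF bs] coset_zero_iff [OF c] .
qed

section \<open>Products of cocycles of spheres\<close>

definition coord_axis :: "nat \<Rightarrow> nat \<Rightarrow> real" where
  "coord_axis j = (\<lambda>l. if l = j then 1 else 0)"

lemma continuous_replace_block:
  "continuous_on S (\<lambda>x :: nat \<Rightarrow> nat \<Rightarrow> real. x(k := b))"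
proof (rule continuous_on_coordinatewise_then_product)
  fix i
  show "continuous_on S (\<lambda>x. (x(k := b)) i)"
    by (cases "i = k") (auto intro: continuous_on_product_coordinates continuous_on_subset)
qed

lemma continuous_block_homotopy:
  "continuous_on S (\<lambda>(t, x :: nat \<Rightarrow> nat \<Rightarrow> real). x(k := (\<lambda>l. (1 - t) * x k l + t * b l)))"
proof (rule continuous_on_coordinatewise_then_product, rule continuous_on_coordinatewise_then_product)
  fix i l
  have c: "continuous_on S (\<lambda>z :: real \<times> (nat \<Rightarrow> nat \<Rightarrow> real). snd z i l)" for i l
    using continuous_on_product_then_coordinatewise [OF continuous_on_product_then_coordinatewise
        [OF continuous_on_snd [OF continuous_on_id]]] by this
  show "continuous_on S (\<lambda>z. (case z of (t, x) \<Rightarrow> x(k := (\<lambda>l. (1 - t) * x k l + t * b l))) i l)"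
    by (cases "i = k") (simp_all add: case_prod_unfold c continuous_on_add continuous_on_mult
        continuous_on_diff continuous_on_const continuous_on_fst continuous_on_id)
qed

lemma chain_map_replace_block:
  "chain_map q (\<lambda>x. x(k := b)) (chain_map q (\<lambda>x. x(k := b')) c) = chain_map q (\<lambda>x. x(k := b)) c"
proof -
  have "(\<lambda>x. x(k := b)) \<circ> (\<lambda>x. x(k := b')) = (\<lambda>x. x(k := b))"
    by (auto simp: fun_eq_iff)
  then show ?thesis
    using chain_map_compose [of q "\<lambda>x. x(k := b)" "\<lambda>x. x(k := b')"] by (metis comp_apply)
qed

lemma cup_product_cong_left:
  assumes s: "singular_simplex q (subtopology X U) s"
    and eq: "\<And>q s. singular_simplex q (subtopology X U) s \<Longrightarrow> a q s = b q s"
  shows "cup_product X a y q s = cup_product X b y q s"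
  using eq singular_simplex_front_face [OF s] by (simp add: cup_product_def)

text \<open>A product of \<open>n\<close> spheres of dimension \<open>m\<close> in \<open>X\<close>,
  with functions on the whole of \<open>X\<close> in the role of its coordinates. A sphere is
  replaced by the vectors whose coordinates 0 to \<open>m\<close> are not all zero, so that nothing
  has to be normalised. Only signs are compared, since the open sets of the Mayer-Vietoris steps are
  given by signs and by nonvanishing of coordinates.\<close>

locale sphere_coordinates =
  fixes X :: "'a topology" and n m :: nat
    and coord :: "nat \<Rightarrow> nat \<Rightarrow> 'a \<Rightarrow> real" and embed :: "(nat \<Rightarrow> nat \<Rightarrow> real) \<Rightarrow> 'a"
  assumes continuous_coord: "\<And>i l. i < n \<Longrightarrow> l \<le> m \<Longrightarrow> continuous_map X euclideanreal (coord i l)"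
    and coord_nonzero: "\<And>z i. z \<in> topspace X \<Longrightarrow> i < n \<Longrightarrow> \<exists>l\<le>m. coord i l z \<noteq> 0"
    and continuous_embed: "continuous_map (top_of_set {x. \<forall>i<n. \<exists>l\<le>m. x i l \<noteq> 0}) X embed"
    and sgn_coord_embed: "\<And>x i l. \<lbrakk>\<forall>i<n. \<exists>l\<le>m. x i l \<noteq> 0; i < n; l \<le> m\<rbrakk> \<Longrightarrow>
      sgn (coord i l (embed x)) = sgn (x i l)"
begin

text \<open>The blocks from \<open>k\<close> onwards rest at an axis vector, a point of the sphere.
  In \<open>partial\<close>, block \<open>k\<close> moves in a set of the homotopy type of a
  \<open>j\<close>-sphere, and \<open>level\<close> is the matching open subset of \<open>X\<close>.
  For \<open>j = m\<close> this becomes \<open>based (Suc k)\<close>, which links the induction over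
  \<open>j\<close> to the one over \<open>k\<close>.\<close>

definition based :: "nat \<Rightarrow> (nat \<Rightarrow> nat \<Rightarrow> real) set" where
  "based k = {x. (\<forall>i<k. \<exists>l\<le>m. x i l \<noteq> 0) \<and> (\<forall>i\<ge>k. x i = coord_axis 0)}"

definition partial :: "nat \<Rightarrow> nat \<Rightarrow> (nat \<Rightarrow> nat \<Rightarrow> real) set" where
  "partial k j = {x. (\<forall>i<k. \<exists>l\<le>m. x i l \<noteq> 0) \<and> (\<exists>l\<le>j. x k l \<noteq> 0) \<and> (\<forall>i>k. x i = coord_axis 0)}"

definition level :: "nat \<Rightarrow> nat \<Rightarrow> 'a set" where
  "level k j = {z \<in> topspace X. \<exists>l\<le>j. coord k l z \<noteq> 0}"

lemma embed_continuous_on: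
  assumes "S \<subseteq> {x. \<forall>i<n. \<exists>l\<le>m. x i l \<noteq> 0}" and "\<And>x. x \<in> S \<Longrightarrow> embed x \<in> T"
  shows "continuous_map (top_of_set S) (subtopology X T) embed"
  using continuous_map_from_subtopology_mono [OF continuous_embed assms(1)] assms(2)
  by (auto simp: continuous_map_in_subtopology)

lemma based_subset: "k \<le> n \<Longrightarrow> based k \<subseteq> {x. \<forall>i<n. \<exists>l\<le>m. x i l \<noteq> 0}"
  by (auto simp: based_def coord_axis_def) (metis not_le zero_neq_one le0)

lemma partial_subset: "k < n \<Longrightarrow> j \<le> m \<Longrightarrow> partial k j \<subseteq> {x. \<forall>i<n. \<exists>l\<le>m. x i l \<noteq> 0}"
  unfolding partial_def coord_axis_def
  by clarsimp (metis le0 le_trans linorder_neqE_nat zero_neq_one)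

lemma partial_full: "partial k m = based (Suc k)"
  by (auto simp: partial_def based_def less_Suc_eq Suc_le_eq)

lemma level_open: "k < n \<Longrightarrow> j \<le> m \<Longrightarrow> openin X (level k j)"
proof -
  assume k: "k < n" "j \<le> m"
  have "level k j = (\<Union>l\<le>j. {z \<in> topspace X. coord k l z \<in> - {0}})"
    by (auto simp: level_def)
  moreover have "openin X {z \<in> topspace X. coord k l z \<in> - {0}}" if "l \<le> j" for l
    using k that by (intro openin_continuous_map_preimage [OF continuous_coord]) (auto simp: open_openin [symmetric])
  ultimately show ?thesis
    by auto
qed

lemma embed_level:
  assumes "k < n" "j \<le> m" "x \<in> partial k j"
  shows "embed x \<in> level k j"
proof -
  have x: "x \<in> {x. \<forall>i<n. \<exists>l\<le>m. x i l \<noteq> 0}"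
    using partial_subset assms by blast
  then have "embed x \<in> topspace X"
    using continuous_embed by (auto simp: continuous_map_def)
  moreover obtain l where "l \<le> j" "x k l \<noteq> 0"
    using assms by (auto simp: partial_def)
  ultimately show ?thesis
    using sgn_coord_embed [of x k l] x assms unfolding level_def
    by (auto simp: sgn_zero_iff)
qed

text \<open>
  The third condition on the cycle \<open>d\<close>, which says that it dies when its \<open>k\<close>-th block is made constant,
  ensures that both of its cones in the next step have boundary \<open>d\<close>.
\<close>

definition transports :: "nat \<Rightarrow> nat \<Rightarrow> 'a cochain \<Rightarrow> bool" where
  "transports k j x \<longleftrightarrow> (\<forall>y r c. y \<in> cochains X \<longrightarrow> coboundary X y = (\<lambda>q s. 0) \<longrightarrow>
     singular_chain r (top_of_set (based k)) c \<longrightarrow> chain_boundary r c = 0 \<longrightarrow>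
     (\<exists>d. singular_chain (r + j) (top_of_set (partial k j)) d \<and> chain_boundary (r + j) d = 0 \<and>
       (\<forall>b. chain_map (r + j) (\<lambda>x. x(k := b)) d = 0) \<and>
       frag_eval (cup_product X x y (r + j)) (chain_map (r + j) embed d)
         = frag_eval (y r) (chain_map r embed c)))"

text \<open>The cochain \<open>x\<close> is the indicator of the set where coordinate 0 is positive.
  Where this coordinate does not vanish, its sign is constant along every path, so \<open>x\<close>
  is a cocycle. The cycle \<open>d\<close> is the difference of \<open>c\<close> and a copy of it on
  the negative side, where products with \<open>x\<close> vanish.\<close>

lemma sphere_cocycle_0:
  assumes k: "k < n"
  obtains x where "x \<in> cochains (subtopology X (level k 0))" "\<And>q s. q \<noteq> 0 \<Longrightarrow> x q s = 0"
    "\<And>q s. singular_simplex q (subtopology X (level k 0)) s \<Longrightarrow> coboundary X x q s = 0"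
    "transports k 0 x"
proof -
  define Pos where "Pos = {z \<in> topspace X. coord k 0 z > 0}"
  define x :: "'a cochain"
    where "x q s = (if q = 0 \<and> singular_simplex 0 (subtopology X Pos) s then 1 else 0)" for q s
  have x_deg: "x q s = 0" if "q \<noteq> 0" for q s
    using that by (simp add: x_def)
  have Pos_level: "Pos \<subseteq> level k 0"
    by (auto simp: Pos_def level_def)
  have x_cochain: "x \<in> cochains (subtopology X (level k 0))"
    using singular_simplex_mono [OF _ Pos_level]
    by (intro cochainsI [where m = 0]) (auto simp: x_def)
  have cocycle: "coboundary X x q s = 0" if s: "singular_simplex q (subtopology X (level k 0)) s" for q s
  proof (cases "q = 1")
    case False
    then show ?thesis
      by (auto simp: coboundary_def x_deg)
  next
    case True
    have cont: "continuous_map (simplex_space 1) euclideanreal (\<lambda>t. coord k 0 (s t))"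
      using s k continuous_map_compose [OF _ continuous_coord [of k 0], of "simplex_space 1" s] True
      by (auto simp: singular_simplex_def continuous_map_in_subtopology comp_def)
    have "connectedin euclideanreal ((\<lambda>t. coord k 0 (s t)) ` standard_simplex 1)"
      using connectedin_continuous_map_image [OF cont] connectedin_standard_simplex [of 1]
      by (simp add: connectedin_subtopology)
    then have iv: "is_interval ((\<lambda>t. coord k 0 (s t)) ` standard_simplex 1)"
      by (simp add: is_interval_connected_1)
    have nz: "coord k 0 (s t) \<noteq> 0" "s t \<in> topspace X" if "t \<in> standard_simplex 1" for t
      using s that True by (auto simp: singular_simplex_subtopology level_def image_subset_iff)
    have const: "coord k 0 (s t) > 0 \<longleftrightarrow> coord k 0 (s u) > 0" if "t \<in> standard_simplex 1" "u \<in> standard_simplex 1" for t u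
    proof -
      have False if "coord k 0 (s t) > 0" "coord k 0 (s u) \<le> 0" "t \<in> standard_simplex 1" "u \<in> standard_simplex 1" for t u
      proof -
        have "0 \<in> (\<lambda>t. coord k 0 (s t)) ` standard_simplex 1"
          using iv that unfolding is_interval_1 by (meson imageI less_imp_le)
        then show False using nz by auto
      qed
      then show ?thesis using that by (metis not_le)
    qed
    let ?e = "\<lambda>i::nat. if i = 0 then 1 else 0 :: real"
    have e: "?e \<in> standard_simplex 1"
      by simp
    have face: "x 0 (singular_face 1 i s) = (if coord k 0 (s ?e) > 0 then 1 else 0)" if "i \<le> 1" for i
    proof -
      have "singular_simplex 0 X (singular_face 1 i s)"
        using singular_simplex_singular_face [of 1 X s i] that s True
        by (simp add: singular_simplex_subtopology)
      moreover have "singular_face 1 i s ` standard_simplex 0 \<subseteq> Pos \<longleftrightarrow> coord k 0 (s ?e) > 0"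
      proof -
        have f: "simplical_face i ?e \<in> standard_simplex 1"
          using simplical_face_in_standard_simplex [of 1 i ?e] that by (simp add: standard_simplex_0)
        have "singular_face 1 i s ` standard_simplex 0 = {s (simplical_face i ?e)}"
          by (simp add: singular_face_def standard_simplex_0)
        then show ?thesis
          using const [OF f e] nz [OF f] by (simp add: Pos_def)
      qed
      ultimately show ?thesis
        by (simp add: x_def singular_simplex_subtopology)
    qed
    then show ?thesis
      using True face [of 0] face [of 1] by (simp add: coboundary_def)
  qed
  have cup_pos: "cup_product X x y r s = y r s" if s: "singular_simplex r (subtopology X Pos) s" for y r s
  proof -
    have s': "singular_simplex r X s"
      using s by (rule singular_simplex_of_subtopology)
    have "cup_product X x y r s = (\<Sum>p\<le>r. if p = 0 then y r s else 0)"
      unfolding cup_product_simplex [OF s']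
      using singular_simplex_front_face [OF s, of 0] back_face_0 [OF s']
      by (intro sum.cong) (auto simp: x_def)
    then show ?thesis by simp
  qed
  have cup_neg: "cup_product X x y r s = 0" if s: "singular_simplex r (subtopology X (- Pos)) s" for y r s
  proof -
    have "x 0 (front_face 0 s) = 0"
      using singular_simplex_front_face [OF s, of 0]
      by (auto simp: x_def singular_simplex_subtopology standard_simplex_0)
    then have "x p (front_face p s) = 0" for p
      using x_deg by (cases "p = 0") auto
    then show ?thesis
      by (simp add: cup_product_def)
  qed
  have "transports k 0 x"
    unfolding transports_def add_0_right
  proof (intro allI impI)
    fix y :: "'a cochain" and r c
    assume c: "singular_chain r (top_of_set (based k)) c" and bc: "chain_boundary r c = 0"
    \<comment> \<open>In block \<open>k\<close> the chain \<open>c\<close> already sits at the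
      positive axis vector, and \<open>f\<close> moves it to the negative one.\<close>
    define f where "f = (\<lambda>x :: nat \<Rightarrow> nat \<Rightarrow> real. x(k := - coord_axis 0))"
    have cf: "continuous_map (top_of_set (based k)) (top_of_set (f ` based k)) f"
      using continuous_replace_block [of "based k" k] by (auto simp: f_def)
    have fp: "f ` based k \<subseteq> partial k 0" and bp: "based k \<subseteq> partial k 0"
      by (auto simp: f_def based_def partial_def coord_axis_def)
    have fc: "singular_chain r (top_of_set (f ` based k)) (chain_map r f c)"
      using c cf by (rule singular_chain_chain_map)
    have emb1: "continuous_map (top_of_set (based k)) (subtopology X Pos) embed"
    proof (rule embed_continuous_on)
      show sub: "based k \<subseteq> {x. \<forall>i<n. \<exists>l\<le>m. x i l \<noteq> 0}"
        using based_subset k by simp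
      fix x assume x: "x \<in> based k"
      then have "sgn (coord k 0 (embed x)) = 1"
        using sgn_coord_embed [of x k 0] sub k by (auto simp: based_def coord_axis_def)
      moreover have "embed x \<in> topspace X"
        using embed_level [of k 0 x] bp k x by (auto simp: level_def)
      ultimately show "embed x \<in> Pos"
        by (simp add: Pos_def sgn_1_pos)
    qed
    have emb2: "continuous_map (top_of_set (f ` based k)) (subtopology X (- Pos)) embed"
    proof (rule embed_continuous_on)
      show sub: "f ` based k \<subseteq> {x. \<forall>i<n. \<exists>l\<le>m. x i l \<noteq> 0}"
        using fp partial_subset [OF k, of 0] by auto
      fix x assume x: "x \<in> f ` based k"
      then have "sgn (coord k 0 (embed x)) = -1"
        using sgn_coord_embed [of x k 0] sub k by (auto simp: f_def coord_axis_def)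
      then show "embed x \<in> - Pos"
        by (simp add: Pos_def sgn_1_neg)
    qed
    have "frag_eval (cup_product X x y r) (chain_map r embed (c - chain_map r f c)) = frag_eval (y r) (chain_map r embed c)"
    proof -
      have "frag_eval (cup_product X x y r) (chain_map r embed c) = frag_eval (y r) (chain_map r embed c)"
        using singular_chain_chain_map [OF c emb1] cup_pos
        by (intro frag_eval_cong) (auto simp: singular_chain_def)
      moreover have "frag_eval (cup_product X x y r) (chain_map r embed (chain_map r f c)) = 0"
        using singular_chain_chain_map [OF fc emb2] cup_neg
        by (intro frag_eval_eq_0) (auto simp: singular_chain_def)
      ultimately show ?thesis
        by (simp add: chain_map_diff frag_eval_diff)
    qed
    moreover have "singular_chain r (top_of_set (partial k 0)) (c - chain_map r f c)"
      using singular_chain_mono [OF c bp] singular_chain_mono [OF fc fp] by (rule singular_chain_diff)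
    moreover have "chain_boundary r (c - chain_map r f c) = 0"
      using chain_boundary_chain_map [OF c] by (simp add: chain_boundary_diff bc)
    moreover have "chain_map r (\<lambda>x. x(k := b)) (c - chain_map r f c) = 0" for b
      by (simp add: chain_map_diff f_def chain_map_replace_block)
    ultimately show "\<exists>d. singular_chain r (top_of_set (partial k 0)) d \<and> chain_boundary r d = 0 \<and>
       (\<forall>b. chain_map r (\<lambda>x. x(k := b)) d = 0) \<and>
       frag_eval (cup_product X x y r) (chain_map r embed d) = frag_eval (y r) (chain_map r embed c)"
      by blast
  qed
  then show ?thesis
    using that x_cochain x_deg cocycle by blast
qed

text \<open>The two halves extend \<open>level k j\<close> by the points where coordinate
  \<open>Suc j\<close> is positive or negative. The connecting homomorphism gives \<open>x'\<close>,
  which is the coboundary of \<open>x\<close> on one half and 0 on the other. The cones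
  \<open>E 1\<close> and \<open>E (-1)\<close> over \<open>d\<close> lie over the two halves, so the
  product of \<open>x'\<close> and \<open>y\<close> has on their difference the value of the
  coboundary of the product of \<open>x\<close> and \<open>y\<close> on the first cone, that is, the
  value of this product on \<open>d\<close>.\<close>

lemma sphere_cocycle_Suc:
  assumes k: "k < n" and j: "Suc j \<le> m"
    and x: "x \<in> cochains (subtopology X (level k j))" and x_deg: "\<And>q s. q \<noteq> j \<Longrightarrow> x q s = 0"
    and x_cocycle: "\<And>q s. singular_simplex q (subtopology X (level k j)) s \<Longrightarrow> coboundary X x q s = 0"
    and trans_x: "transports k j x"
  obtains x' where "x' \<in> cochains (subtopology X (level k (Suc j)))" "\<And>q s. q \<noteq> Suc j \<Longrightarrow> x' q s = 0"
    "\<And>q s. singular_simplex q (subtopology X (level k (Suc j))) s \<Longrightarrow> coboundary X x' q s = 0"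
    "transports k (Suc j) x'"
proof -
  define half where "half \<sigma> = {z \<in> topspace X. (\<exists>l\<le>j. coord k l z \<noteq> 0) \<or> \<sigma> * coord k (Suc j) z > 0}" for \<sigma> :: real
  let ?Y = "subtopology X (level k (Suc j))"
  have xX: "x \<in> cochains X"
    using x by (rule cochains_subtopology)
  have half_sub: "half \<sigma> \<subseteq> level k (Suc j)" for \<sigma>
  proof
    fix z assume z: "z \<in> half \<sigma>"
    then consider l where "l \<le> j" "coord k l z \<noteq> 0" | "coord k (Suc j) z \<noteq> 0"
      by (auto simp: half_def zero_less_mult_iff)
    then have "\<exists>l\<le>Suc j. coord k l z \<noteq> 0"
      by cases (auto intro: le_SucI)
    with z show "z \<in> level k (Suc j)"
      by (simp add: half_def level_def)
  qed
  have half_open: "openin ?Y (half \<sigma>)" for \<sigma>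
  proof -
    have "openin X {z \<in> topspace X. \<sigma> * coord k (Suc j) z \<in> {0<..}}"
      using continuous_coord [OF k j]
      by (intro openin_continuous_map_preimage [of X euclideanreal] continuous_map_real_mult_left) (auto simp: open_openin [symmetric])
    moreover have "half \<sigma> = level k j \<union> {z \<in> topspace X. \<sigma> * coord k (Suc j) z \<in> {0<..}}"
      by (auto simp: half_def level_def)
    ultimately have "openin X (half \<sigma>)"
      using level_open [OF k, of j] j by auto
    then show ?thesis
      using half_sub by (meson openin_subset_topspace_eq openin_open_subtopology openin_subtopology_Int2 level_open [OF k j])
  qed
  have cover: "topspace ?Y \<subseteq> half 1 \<union> half (-1)"
    by (auto simp: level_def half_def le_Suc_eq)
  have meet: "half 1 \<inter> half (-1) = level k j"
    by (auto simp: level_def half_def)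
  have Yj: "subtopology ?Y (half 1 \<inter> half (-1)) = subtopology X (level k j)"
  proof -
    have "level k j \<subseteq> level k (Suc j)"
      unfolding level_def using le_SucI by blast
    then have "level k (Suc j) \<inter> level k j = level k j"
      by blast
    then show ?thesis
      by (simp add: meet subtopology_subtopology)
  qed
  have Yhalf: "subtopology ?Y (half \<sigma>) = subtopology X (half \<sigma>)" for \<sigma>
    using half_sub [of \<sigma>] by (simp add: subtopology_subtopology Int_absorb1)
  have dx: "coboundary ?Y x q s = 0" if "singular_simplex q (subtopology ?Y (half 1 \<inter> half (-1))) s" for q s
    using that x_cocycle [of q s] coboundary_subtopology [of q X "level k (Suc j)" s x]
      singular_simplex_of_subtopology [OF that] unfolding Yj by simp
  obtain x' where x': "x' \<in> cochains ?Y" and dx': "coboundary ?Y x' = (\<lambda>q s. 0)"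
    and x'_pos: "\<And>q s. singular_simplex q (subtopology ?Y (half 1)) s \<Longrightarrow> x' q s = coboundary ?Y x q s"
    and x'_neg: "\<And>q s. singular_simplex q (subtopology ?Y (half (-1))) s \<Longrightarrow> x' q s = 0"
    and x'_zero: "\<And>q s. (\<And>t. coboundary ?Y x q t = 0) \<Longrightarrow> x' q s = 0"
    using Mayer_Vietoris_cocycle [OF half_open [of 1] half_open [of "-1"] cover x [folded Yj] dx] by blast
  have x'_half: "x' q s = coboundary X x q s" if "singular_simplex q (subtopology X (half 1)) s" for q s
    using that x'_pos [of q s] coboundary_subtopology [of q X "level k (Suc j)" s x]
      singular_simplex_mono [OF that half_sub] by (simp add: Yhalf)
  have "transports k (Suc j) x'"
    unfolding transports_def
  proof (intro allI impI)
    fix y :: "'a cochain" and r c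
    assume y: "y \<in> cochains X" "coboundary X y = (\<lambda>q s. 0)"
      and c: "singular_chain r (top_of_set (based k)) c" "chain_boundary r c = 0"
    then obtain d where d: "singular_chain (r + j) (top_of_set (partial k j)) d"
      and bd: "chain_boundary (r + j) d = 0"
      and rd: "\<And>b. chain_map (r + j) (\<lambda>x. x(k := b)) d = 0"
      and ev: "frag_eval (cup_product X x y (r + j)) (chain_map (r + j) embed d) = frag_eval (y r) (chain_map r embed c)"
      using trans_x unfolding transports_def by blast
    \<comment> \<open>Block \<open>k\<close> moves on a straight line to \<sigma> times the axis
      vector of \<open>Suc j\<close>. Its coordinates up to \<open>j\<close> can vanish together
      only at the end, where coordinate \<open>Suc j\<close> has the sign \<sigma>.\<close>
    define H where "H \<sigma> = (\<lambda>(t, x :: nat \<Rightarrow> nat \<Rightarrow> real). x(k := (\<lambda>l. (1 - t) * x k l + t * (\<sigma> * coord_axis (Suc j) l))))" for \<sigma>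
    \<comment> \<open>The boundary of the prism is end minus start, and the end vanishes since
      \<open>d\<close> dies when block \<open>k\<close> is made constant. The minus sign turns the
      boundary into \<open>d\<close> itself.\<close>
    define E where "E \<sigma> = - prism (r + j) (H \<sigma>) d" for \<sigma>
    define Q where "Q \<sigma> = {x \<in> partial k (Suc j). (\<exists>l\<le>j. x k l \<noteq> 0) \<or> \<sigma> * x k (Suc j) > 0}" for \<sigma>
    have Hcont: "continuous_map (cylinder (top_of_set (partial k j))) (top_of_set (Q \<sigma>)) (H \<sigma>)"
      if \<sigma>: "\<sigma> = 1 \<or> \<sigma> = -1" for \<sigma>
    proof -
      have "H \<sigma> (t, x) \<in> Q \<sigma>" if t: "0 \<le> t" "t \<le> 1" and x: "x \<in> partial k j" for t x
      proof -
        obtain l where l: "l \<le> j" "x k l \<noteq> 0"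
          using x by (auto simp: partial_def)
        have "(\<exists>l\<le>j. H \<sigma> (t, x) k l \<noteq> 0) \<or> \<sigma> * H \<sigma> (t, x) k (Suc j) > 0"
        proof (cases "t = 1")
          case True
          then show ?thesis using \<sigma> by (auto simp: H_def coord_axis_def)
        next
          case False
          then have "H \<sigma> (t, x) k l \<noteq> 0"
            using l by (simp add: H_def coord_axis_def)
          then show ?thesis using l by blast
        qed
        moreover from this have "\<exists>l\<le>Suc j. H \<sigma> (t, x) k l \<noteq> 0"
          using le_SucI by (metis less_irrefl mult_zero_right order_refl)
        ultimately show ?thesis
          using x by (auto simp: Q_def partial_def H_def)
      qed
      moreover have "continuous_on ({0..1} \<times> partial k j) (H \<sigma>)"
        unfolding H_def by (rule continuous_block_homotopy)
      moreover have "cylinder (top_of_set (partial k j))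
          = subtopology (prod_topology euclidean euclidean) ({0..1} \<times> partial k j)"
        by (rule subtopology_Times [symmetric])
      ultimately show ?thesis
        by auto
    qed
    have E: "singular_chain (Suc (r + j)) (top_of_set (Q \<sigma>)) (E \<sigma>)" if "\<sigma> = 1 \<or> \<sigma> = -1" for \<sigma>
      unfolding E_def using singular_chain_prism [OF Hcont [OF that] d] by (simp add: singular_chain_minus)
    have bE: "chain_boundary (Suc (r + j)) (E \<sigma>) = d" if "\<sigma> = 1 \<or> \<sigma> = -1" for \<sigma>
    proof -
      have "(\<lambda>x. H \<sigma> (1, x)) = (\<lambda>x. x(k := (\<lambda>l. \<sigma> * coord_axis (Suc j) l)))" "(\<lambda>x. H \<sigma> (0, x)) = id"
        by (auto simp: H_def fun_eq_iff)
      then show ?thesis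
        using chain_boundary_prism [OF Hcont [OF that] d] chain_map_ident [OF d]
        by (simp add: E_def chain_boundary_minus bd rd)
    qed
    \<comment> \<open>Once block \<open>k\<close> is constant the homotopy is stationary. By
      naturality the image of the prism over \<open>d\<close> is the prism over the image of
      \<open>d\<close>, which is 0.\<close>
    have rE: "chain_map (Suc (r + j)) (\<lambda>x. x(k := b)) (E \<sigma>) = 0" for b \<sigma>
    proof -
      have "(\<lambda>x. x(k := b)) \<circ> H \<sigma> = (\<lambda>(t, x). snd (t :: real, x(k := b)))"
        by (auto simp: H_def fun_eq_iff)
      then have "chain_map (Suc (r + j)) (\<lambda>x. x(k := b)) (prism (r + j) (H \<sigma>) d)
          = prism (r + j) snd (chain_map (r + j) (\<lambda>x. x(k := b)) d)"
        by (simp only: chain_map_prism prism_chain_map)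
      then show ?thesis
        by (simp add: E_def chain_map_minus rd)
    qed
    have Qpartial: "Q \<sigma> \<subseteq> partial k (Suc j)" for \<sigma>
      by (auto simp: Q_def)
    have embQ: "continuous_map (top_of_set (Q \<sigma>)) (subtopology X (half \<sigma>)) embed" if \<sigma>: "\<sigma> = 1 \<or> \<sigma> = -1" for \<sigma>
    proof (rule embed_continuous_on)
      show sub: "Q \<sigma> \<subseteq> {x. \<forall>i<n. \<exists>l\<le>m. x i l \<noteq> 0}"
        using Qpartial partial_subset [OF k j] by blast
      fix x assume x: "x \<in> Q \<sigma>"
      then have xn: "\<forall>i<n. \<exists>l\<le>m. x i l \<noteq> 0"
        using sub by auto
      have "embed x \<in> topspace X"
        using embed_level [OF k j] Qpartial x by (auto simp: level_def)
      moreover have "(\<exists>l\<le>j. coord k l (embed x) \<noteq> 0) \<or> \<sigma> * coord k (Suc j) (embed x) > 0"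
      proof (cases "\<exists>l\<le>j. x k l \<noteq> 0")
        case True
        then obtain l where "l \<le> j" "x k l \<noteq> 0" by auto
        then show ?thesis
          using sgn_coord_embed [OF xn k, of l] j by (metis Suc_leD le_trans sgn_zero_iff)
      next
        case False
        then have "\<sigma> * x k (Suc j) > 0"
          using x by (auto simp: Q_def)
        then show ?thesis
          using sgn_coord_embed [OF xn k j] \<sigma> by (metis sgn_1_pos sgn_mult sgn_pos)
      qed
      ultimately show "embed x \<in> half \<sigma>"
        by (simp add: half_def)
    qed
    have e1: "frag_eval (cup_product X x' y (Suc (r + j))) (chain_map (Suc (r + j)) embed (E 1))
      = frag_eval (y r) (chain_map r embed c)"
    proof -
      let ?z = "chain_map (Suc (r + j)) embed (E 1)"
      have z: "singular_chain (Suc (r + j)) (subtopology X (half 1)) ?z"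
        using E [of 1] embQ [of 1] by (simp add: singular_chain_chain_map)
      have "frag_eval (cup_product X x' y (Suc (r + j))) ?z
          = frag_eval (cup_product X (coboundary X x) y (Suc (r + j))) ?z"
      proof (rule frag_eval_cong)
        fix s assume "s \<in> Poly_Mapping.keys ?z"
        then have "singular_simplex (Suc (r + j)) (subtopology X (half 1)) s"
          using z by (auto simp: singular_chain_def)
        then show "cup_product X x' y (Suc (r + j)) s = cup_product X (coboundary X x) y (Suc (r + j)) s"
          by (rule cup_product_cong_left) (rule x'_half)
      qed
      \<comment> \<open>As \<open>y\<close> is a cocycle, one term of the Leibniz rule
        remains.\<close>
      also have "cup_product X (coboundary X x) y = coboundary X (cup_product X x y)"
        by (simp add: coboundary_cup_product y cup_product_zero_right)
      also have "frag_eval (coboundary X (cup_product X x y) (Suc (r + j))) ?z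
          = frag_eval (cup_product X x y (r + j)) (chain_boundary (Suc (r + j)) ?z)"
        by (rule frag_eval_coboundary [OF singular_chain_of_subtopology [OF z]])
      also have "chain_boundary (Suc (r + j)) ?z = chain_map (r + j) embed d"
        using chain_boundary_chain_map [OF E [of 1], of embed] bE [of 1] by simp
      finally show ?thesis
        by (simp add: ev)
    qed
    have e2: "frag_eval (cup_product X x' y (Suc (r + j))) (chain_map (Suc (r + j)) embed (E (-1))) = 0"
    proof (rule frag_eval_eq_0)
      fix s assume "s \<in> Poly_Mapping.keys (chain_map (Suc (r + j)) embed (E (-1)))"
      moreover have "singular_chain (Suc (r + j)) (subtopology X (half (-1))) (chain_map (Suc (r + j)) embed (E (-1)))"
        using E [of "-1"] embQ [of "-1"] by (simp add: singular_chain_chain_map)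
      ultimately have "singular_simplex (Suc (r + j)) (subtopology X (half (-1))) s"
        by (auto simp: singular_chain_def)
      then show "cup_product X x' y (Suc (r + j)) s = 0"
        using x'_neg by (intro cup_product_vanishing_on) (auto simp: Yhalf)
    qed
    show "\<exists>d. singular_chain (r + Suc j) (top_of_set (partial k (Suc j))) d \<and> chain_boundary (r + Suc j) d = 0 \<and>
       (\<forall>b. chain_map (r + Suc j) (\<lambda>x. x(k := b)) d = 0) \<and>
       frag_eval (cup_product X x' y (r + Suc j)) (chain_map (r + Suc j) embed d)
         = frag_eval (y r) (chain_map r embed c)"
    proof (intro exI conjI allI)
      show "singular_chain (r + Suc j) (top_of_set (partial k (Suc j))) (E 1 - E (-1))"
        using singular_chain_mono [OF E Qpartial] by (simp add: singular_chain_diff)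
      show "chain_boundary (r + Suc j) (E 1 - E (-1)) = 0"
        by (simp add: chain_boundary_diff bE)
      show "chain_map (r + Suc j) (\<lambda>x. x(k := b)) (E 1 - E (-1)) = 0" for b
        by (simp add: chain_map_diff rE)
      show "frag_eval (cup_product X x' y (r + Suc j)) (chain_map (r + Suc j) embed (E 1 - E (-1)))
         = frag_eval (y r) (chain_map r embed c)"
        by (simp add: chain_map_diff frag_eval_diff e1 e2)
    qed
  qed
  moreover have "x' q s = 0" if "q \<noteq> Suc j" for q s
  proof (rule x'_zero)
    show "coboundary ?Y x q t = 0" for t
      using that x_deg [of "q - 1"] by (cases q) (auto simp: coboundary_def)
  qed
  moreover have "coboundary X x' q s = 0" if "singular_simplex q ?Y s" for q s
    using coboundary_subtopology [OF that, of x'] by (simp add: dx')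
  ultimately show ?thesis
    using that x' by blast
qed

text \<open>The last level is the whole of \<open>X\<close>, because the coordinates of a block
  never vanish all at once. So the final cocycle is global.\<close>

lemma sphere_cocycle:
  assumes k: "k < n"
  obtains a where "a \<in> carrier (cocycle_ring X)" "\<And>q s. q \<noteq> m \<Longrightarrow> a q s = 0" "transports k m a"
proof -
  have "\<exists>x. x \<in> cochains (subtopology X (level k j)) \<and> (\<forall>q s. q \<noteq> j \<longrightarrow> x q s = 0) \<and>
    (\<forall>q s. singular_simplex q (subtopology X (level k j)) s \<longrightarrow> coboundary X x q s = 0) \<and> transports k j x"
    if "j \<le> m" for j
    using that
  proof (induction j)
    case 0
    from sphere_cocycle_0 [OF k] show ?case by metis
  next
    case (Suc j)
    then obtain x where x: "x \<in> cochains (subtopology X (level k j))" "\<And>q s. q \<noteq> j \<Longrightarrow> x q s = 0"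
      "\<And>q s. singular_simplex q (subtopology X (level k j)) s \<Longrightarrow> coboundary X x q s = 0" "transports k j x"
      by auto
    from sphere_cocycle_Suc [OF k Suc.prems x] show ?case by metis
  qed
  from this [of m] obtain a where a: "a \<in> cochains (subtopology X (level k m))" "\<And>q s. q \<noteq> m \<Longrightarrow> a q s = 0"
      "\<And>q s. singular_simplex q (subtopology X (level k m)) s \<Longrightarrow> coboundary X a q s = 0" "transports k m a"
    by blast
  have "level k m = topspace X"
    using coord_nonzero k by (auto simp: level_def)
  then have "subtopology X (level k m) = X"
    by simp
  then have "a \<in> carrier (cocycle_ring X)"
    using a coboundary_non_simplex by (fastforce simp: fun_eq_iff)
  then show ?thesis
    using that a by blast
qed

text \<open>Each step uses \<open>transports\<close> with the product of the previous cocycles in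
  place of \<open>y\<close> and the previous cycle in place of \<open>c\<close>. The start is the
  unit cochain, which has value 1 on a point.\<close>

lemma product_of_sphere_cocycles:
  assumes "k \<le> n"
  shows "\<exists>bs c. length bs = k \<and> (\<forall>b\<in>set bs. b \<in> carrier (cocycle_ring X) \<and> (\<forall>q s. q \<noteq> m \<longrightarrow> b q s = 0)) \<and>
    singular_chain (k * m) (top_of_set (based k)) c \<and> chain_boundary (k * m) c = 0 \<and>
    frag_eval (foldr (cup_product X) bs (unit_cochain X) (k * m)) (chain_map (k * m) embed c) = 1"
  using assms
proof (induction k)
  case 0
  define s where "s = restrict (\<lambda>_. (\<lambda>_. coord_axis 0) :: nat \<Rightarrow> nat \<Rightarrow> real) (standard_simplex 0)"
  have s: "singular_simplex 0 (top_of_set (based 0)) s"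
    by (simp add: singular_simplex_def s_def based_def fun_eq_iff)
  moreover have "continuous_map (top_of_set (based 0)) X embed"
    using embed_continuous_on [OF based_subset [of 0], of UNIV] by simp
  ultimately have "singular_simplex 0 X (simplex_map 0 embed s)"
    by (rule singular_simplex_simplex_map)
  then show ?case
    using s by (intro exI [of _ "[]"] exI [of _ "frag_of s"]) (simp add: singular_chain_of chain_boundary_def)
next
  case (Suc k)
  from Suc.IH [OF Suc_leD [OF Suc.prems]] obtain bs c where
    IH: "length bs = k \<and> (\<forall>b\<in>set bs. b \<in> carrier (cocycle_ring X) \<and> (\<forall>q s. q \<noteq> m \<longrightarrow> b q s = 0)) \<and>
      singular_chain (k * m) (top_of_set (based k)) c \<and> chain_boundary (k * m) c = 0 \<and>
      frag_eval (foldr (cup_product X) bs (unit_cochain X) (k * m)) (chain_map (k * m) embed c) = 1"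
    by (elim exE)
  then have len: "length bs = k"
    and bs: "\<forall>b\<in>set bs. b \<in> carrier (cocycle_ring X) \<and> (\<forall>q s. q \<noteq> m \<longrightarrow> b q s = 0)"
    and c: "singular_chain (k * m) (top_of_set (based k)) c" "chain_boundary (k * m) c = 0"
    and ev: "frag_eval (foldr (cup_product X) bs (unit_cochain X) (k * m)) (chain_map (k * m) embed c) = 1"
    by simp_all
  obtain a where a: "a \<in> carrier (cocycle_ring X)" "\<And>q s. q \<noteq> m \<Longrightarrow> a q s = 0" "transports k m a"
    by (rule sphere_cocycle [of k]) (use Suc.prems in auto)
  have y': "foldr (cup_product X) bs (unit_cochain X) \<in> carrier (cocycle_ring X)"
    using bs by (intro foldr_cup_product_in_cocycles) (simp add: subset_iff)
  define y where "y = foldr (cup_product X) bs (unit_cochain X)"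
  have y: "y \<in> cochains X" "coboundary X y = (\<lambda>q s. 0)"
    using y' by (simp_all add: y_def)
  from a(3) [unfolded transports_def, rule_format, OF y c]
  obtain d where d: "singular_chain (k * m + m) (top_of_set (partial k m)) d" "chain_boundary (k * m + m) d = 0"
     "frag_eval (cup_product X a y (k * m + m)) (chain_map (k * m + m) embed d)
       = frag_eval (y (k * m)) (chain_map (k * m) embed c)"
    by (elim exE conjE) auto
  show ?case
  proof (intro exI conjI)
    show "length (a # bs) = Suc k" "\<forall>b\<in>set (a # bs). b \<in> carrier (cocycle_ring X) \<and> (\<forall>q s. q \<noteq> m \<longrightarrow> b q s = 0)"
      using len bs a by simp_all
    show "singular_chain (Suc k * m) (top_of_set (based (Suc k))) d" "chain_boundary (Suc k * m) d = 0"
      using d by (simp_all add: partial_full add.commute)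
    show "frag_eval (foldr (cup_product X) (a # bs) (unit_cochain X) (Suc k * m)) (chain_map (Suc k * m) embed d) = 1"
      using d(3) ev by (simp add: y_def add.commute)
  qed
qed

text \<open>A coboundary has value 0 on every cycle, whereas the product has value 1 on one.\<close>

theorem sphere_cocycles_exist:
  obtains bs where "length bs = n" "set bs \<subseteq> carrier (cocycle_ring X)"
    "\<forall>b\<in>set bs. \<forall>q s. q \<noteq> m \<longrightarrow> b q s = 0"
    "foldr (cup_product X) bs (unit_cochain X) \<notin> coboundaries X"
proof -
  obtain bs c where bs: "length bs = n" "\<forall>b\<in>set bs. b \<in> carrier (cocycle_ring X) \<and> (\<forall>q s. q \<noteq> m \<longrightarrow> b q s = 0)"
    and c: "singular_chain (n * m) (top_of_set (based n)) c" "chain_boundary (n * m) c = 0"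
    and ev: "frag_eval (foldr (cup_product X) bs (unit_cochain X) (n * m)) (chain_map (n * m) embed c) = 1"
    using product_of_sphere_cocycles [OF order_refl] by (elim exE conjE) auto
  let ?z = "chain_map (n * m) embed c"
  have "continuous_map (top_of_set (based n)) X embed"
    using embed_continuous_on [OF based_subset [of n], of UNIV] by simp
  then have z: "singular_chain (n * m) X ?z"
    using c singular_chain_chain_map by blast
  have bz: "chain_boundary (n * m) ?z = 0"
    using chain_boundary_chain_map [OF c(1), of embed] by (simp add: c)
  have "frag_eval (coboundary X e (n * m)) ?z = 0" for e
  proof (cases "n * m")
    case 0
    have "coboundary X e (n * m) = (\<lambda>s. 0)"
      unfolding 0 by (simp add: fun_eq_iff)
    then show ?thesis by (simp add: frag_eval_eq_0)
  next
    case (Suc r)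
    have "frag_eval (coboundary X e (Suc r)) ?z = frag_eval (e r) (chain_boundary (Suc r) ?z)"
      using z unfolding Suc by (rule frag_eval_coboundary)
    then show ?thesis
      using bz unfolding Suc by simp
  qed
  with ev have "foldr (cup_product X) bs (unit_cochain X) \<notin> coboundaries X"
    unfolding coboundaries_def by fastforce
  then show ?thesis
    using that bs by blast
qed

end

section \<open>Classes of odd degree are reduced\<close>

lemma cochain_pullback_id:
  "cochain_pullback (subtopology X S) id c q s = (if singular_simplex q (subtopology X S) s then c q s else 0)"
  by (simp add: cochain_pullback_def singular_simplex_def extensional_restrict)

lemma coboundary_pullback_id:
  "cochain_pullback (subtopology X S) id (coboundary X c) = coboundary (subtopology X S) (cochain_pullback (subtopology X S) id c)"
proof (intro ext)
  fix q s
  show "cochain_pullback (subtopology X S) id (coboundary X c) q s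
    = coboundary (subtopology X S) (cochain_pullback (subtopology X S) id c) q s"
  proof (cases "singular_simplex q (subtopology X S) s")
    case True
    then show ?thesis
      using singular_simplex_singular_face [OF True] singular_simplex_of_subtopology [OF True]
      by (auto simp: cochain_pullback_id coboundary_def intro!: sum.cong)
  qed (simp add: cochain_pullback_id coboundary_non_simplex)
qed

text \<open>For odd \<open>q\<close> the constant simplex of dimension \<open>Suc q\<close> has an
  odd number of faces, all of them equal, so its alternating boundary is a single constant
  \<open>q\<close>-simplex. A cocycle vanishes on this boundary.\<close>

lemma odd_cocycle_at_point:
  assumes b: "coboundary X b = (\<lambda>q s. 0)" and "odd q" and x0: "x0 \<in> topspace X"
    and s: "singular_simplex q (subtopology X {x0}) s"
  shows "b q s = 0"
proof -
  let ?Y = "subtopology X {x0}"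
  have Y: "topspace ?Y = {x0}"
    using x0 by simp
  define t where "t = restrict (\<lambda>x. x0) (standard_simplex (Suc q))"
  have t: "singular_simplex (Suc q) ?Y t"
    by (simp add: singular_simplex_singleton [OF Y] t_def)
  have st: "s = restrict (\<lambda>x. x0) (standard_simplex q)"
    using s by (simp add: singular_simplex_singleton [OF Y])
  have "chain_boundary (Suc q) (frag_of t) = frag_of s"
    using chain_boundary_of_singleton [OF Y, of "Suc q" "frag_of t"] t \<open>odd q\<close>
    by (simp add: singular_chain_of st)
  then show ?thesis
    using coboundary_apply [OF singular_simplex_of_subtopology [OF t], of b] b by simp
qed

lemma odd_class_reduced:
  assumes b: "b \<in> carrier (cocycle_ring X)" and deg: "\<And>q s. q \<noteq> m \<Longrightarrow> b q s = 0"
    and "odd m" and x0: "x0 \<in> topspace X"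
  shows "coboundaries X +>\<^bsub>cocycle_ring X\<^esub> b \<in> reduced_cohomology X x0"
proof -
  let ?Y = "subtopology X {x0}" and ?A = "coboundaries X +>\<^bsub>cocycle_ring X\<^esub> b"
  interpret I: ideal "coboundaries X" "cocycle_ring X"
    by (rule ideal_coboundaries)
  interpret J: ideal "coboundaries ?Y" "cocycle_ring ?Y"
    by (rule ideal_coboundaries)
  have A: "?A \<in> carrier (cohomology_ring X)"
    using b I.a_rcosetsI [OF I.a_subset] by (simp add: cohomology_ring_def FactRing_def del: cocycle_ring_simps)
  have "coboundaries ?Y +>\<^bsub>cocycle_ring ?Y\<^esub> cochain_pullback ?Y id a = coboundaries ?Y" if a: "a \<in> ?A" for a
  proof -
    obtain h where h: "h \<in> cochains X" and ah: "a = (\<lambda>q s. coboundary X h q s + b q s)"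
      using a unfolding mem_coset_iff by (auto simp: coboundaries_def)
    have "b q s = 0" if "singular_simplex q ?Y s" for q s
      using deg odd_cocycle_at_point [OF _ \<open>odd m\<close> x0, of b s] b that by (cases "q = m") auto
    then have "cochain_pullback ?Y id a = cochain_pullback ?Y id (coboundary X h)"
      by (auto simp: fun_eq_iff cochain_pullback_id ah)
    moreover have "cochain_pullback ?Y id h \<in> cochains ?Y"
      using finite_degrees [OF h] by (metis (no_types, lifting) cochainsI cochain_pullback_id)
    ultimately have "cochain_pullback ?Y id a \<in> coboundaries ?Y"
      by (simp add: coboundary_pullback_id coboundaries_def)
    then show ?thesis
      using J.a_subset J.a_subgroup by (intro J.a_coset_join2) auto
  qed
  moreover have "b \<in> ?A"
    using b by (rule I.a_rcos_self)
  ultimately have "cohomology_map ?Y id ?A = coboundaries ?Y"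
    unfolding cohomology_map_def by blast
  with A show ?thesis
    by (simp add: reduced_cohomology_def a_kernel_def' cohomology_ring_def FactRing_def)
qed

lemma (in sphere_coordinates) cup_length_ge:
  assumes "odd m" and x0: "x0 \<in> topspace X" and "n \<ge> 1"
  shows "enat n \<le> cup_length X x0"
proof -
  obtain bs where bs: "length bs = n" "set bs \<subseteq> carrier (cocycle_ring X)"
    "\<forall>b\<in>set bs. \<forall>q s. q \<noteq> m \<longrightarrow> b q s = 0"
    "foldr (cup_product X) bs (unit_cochain X) \<notin> coboundaries X"
    by (rule sphere_cocycles_exist)
  define as where "as = map (\<lambda>c. coboundaries X +>\<^bsub>cocycle_ring X\<^esub> c) bs"
  have "length as = n" "as \<noteq> []"
    using bs(1) \<open>n \<ge> 1\<close> by (auto simp: as_def)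
  moreover have "set as \<subseteq> reduced_cohomology X x0"
    using bs odd_class_reduced [OF _ _ \<open>odd m\<close> x0] by (fastforce simp: as_def)
  moreover have "foldr (\<otimes>\<^bsub>cohomology_ring X\<^esub>) as \<one>\<^bsub>cohomology_ring X\<^esub> \<noteq> \<zero>\<^bsub>cohomology_ring X\<^esub>"
    unfolding as_def foldr_cohomology_mult [OF bs(2)]
      coset_zero_iff [OF foldr_cup_product_in_cocycles [OF bs(2)]] by (rule bs(4))
  ultimately show ?thesis
    unfolding cup_length_def by (intro Sup_upper) blast
qed

section \<open>Moment angle complexes\<close>

lemma continuous_map_mult:
  fixes f :: "'a \<Rightarrow> 'b::real_normed_algebra"
  shows "\<lbrakk>continuous_map X euclidean f; continuous_map X euclidean g\<rbrakk> \<Longrightarrow> continuous_map X euclidean (\<lambda>x. f x * g x)"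
  by (simp add: continuous_map_atin tendsto_mult)

lemma continuous_map_divide:
  fixes f :: "'a \<Rightarrow> 'b::real_normed_field"
  shows "\<lbrakk>continuous_map X euclidean f; continuous_map X euclidean g; \<And>x. x \<in> topspace X \<Longrightarrow> g x \<noteq> 0\<rbrakk>
    \<Longrightarrow> continuous_map X euclidean (\<lambda>x. f x / g x)"
  by (simp add: continuous_map_atin tendsto_divide)

lemma continuous_map_of_real:
  "continuous_map X euclideanreal f \<Longrightarrow> continuous_map X euclidean (\<lambda>x. of_real (f x) :: 'b::real_normed_algebra_1)"
  by (simp add: continuous_map_atin tendsto_of_real)

text \<open>Homotopies on disjoint open pieces paste. In the application \<open>g\<close> is
  constant and \<open>Y\<close> is the whole complex, so that a disconnected union of strata is
  still moved to one point.\<close>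

lemma homotopic_with_disjoint_open_union:
  assumes open_T: "\<And>i. i \<in> I \<Longrightarrow> openin X (T i)"
    and disjoint: "\<And>i j. \<lbrakk>i \<in> I; j \<in> I; T i \<inter> T j \<noteq> {}\<rbrakk> \<Longrightarrow> i = j"
    and htpy: "\<And>i. i \<in> I \<Longrightarrow> homotopic_with (\<lambda>_. True) (subtopology X (T i)) Y f g"
  shows "homotopic_with (\<lambda>_. True) (subtopology X (\<Union>i\<in>I. T i)) Y f g"
proof -
  let ?X = "subtopology X (\<Union>i\<in>I. T i)"
  have "\<exists>h. continuous_map (cylinder (subtopology X (T i))) Y h \<and> (\<forall>x. h (0, x) = f x) \<and> (\<forall>x. h (1, x) = g x)"
    if "i \<in> I" for i
    using htpy [OF that] by (auto simp: homotopic_with_def)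
  then obtain h where h: "\<And>i. i \<in> I \<Longrightarrow> continuous_map (cylinder (subtopology X (T i))) Y (h i)"
    and h0: "\<And>i x. i \<in> I \<Longrightarrow> h i (0, x) = f x" and h1: "\<And>i x. i \<in> I \<Longrightarrow> h i (1, x) = g x"
    by metis
  have sub: "subtopology (cylinder ?X) ({0..1} \<times> T i) = cylinder (subtopology X (T i))" if "i \<in> I" for i
  proof -
    have "(\<Union>i\<in>I. T i) \<inter> T i = T i"
      using that by blast
    then show ?thesis
      by (simp add: subtopology_Times subtopology_subtopology)
  qed
  obtain H where H: "continuous_map (cylinder ?X) Y H"
    and Hh: "\<And>z i. \<lbrakk>i \<in> I; z \<in> topspace (cylinder ?X) \<inter> ({0..1} \<times> T i)\<rbrakk> \<Longrightarrow> H z = h i z"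
  proof (rule pasting_lemma_exists [of "cylinder ?X" "\<lambda>i. {0..1} \<times> T i" I Y h])
    show "topspace (cylinder ?X) \<subseteq> (\<Union>i\<in>I. {0..1} \<times> T i)"
      by auto
    show "openin (cylinder ?X) ({0..1} \<times> T i)" if "i \<in> I" for i
    proof -
      have "openin (top_of_set {0..1::real}) {0..1}"
        by simp
      moreover have "openin ?X (T i)"
        using open_T [OF that] that openin_subset by (auto simp: openin_subtopology intro!: exI [of _ "T i"])
      ultimately show ?thesis
        by (simp add: openin_prod_Times_iff)
    qed
    show "continuous_map (subtopology (cylinder ?X) ({0..1} \<times> T i)) Y (h i)" if "i \<in> I" for i
      unfolding sub [OF that] by (rule h [OF that])
    show "h i z = h j z" if "i \<in> I" "j \<in> I" "z \<in> topspace (cylinder ?X) \<inter> ({0..1} \<times> T i) \<inter> ({0..1} \<times> T j)" for i j z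
      using disjoint [OF that(1,2)] that(3) by auto
  qed auto
  have "H (0, x) = f x \<and> H (1, x) = g x" if x: "x \<in> topspace ?X" for x
  proof -
    obtain i where "i \<in> I" "x \<in> T i"
      using x by auto
    then show ?thesis
      using Hh [of i "(0, x)"] Hh [of i "(1, x)"] x h0 h1 by auto
  qed
  with H show ?thesis
    by (subst homotopic_with) auto
qed

section \<open>Strata of a moment angle complex and the upper bound\<close>

locale finite_complex =
  fixes V :: "'v set" and K :: "'v set set"
  assumes finite_V: "finite V" and K_subset: "\<And>\<sigma>. \<sigma> \<in> K \<Longrightarrow> \<sigma> \<subseteq> V"
    and K_down: "\<And>\<sigma> \<tau>. \<sigma> \<in> K \<Longrightarrow> \<tau> \<subseteq> \<sigma> \<Longrightarrow> \<tau> \<in> K"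
    and K_vertex: "\<And>v. v \<in> V \<Longrightarrow> {v} \<in> K"
begin

abbreviation Z where "Z \<equiv> moment_angle_complex V K"

text \<open>A simplex whose product of discs and circles contains \<open>z\<close> must contain all
  coordinates of \<open>z\<close> in the open disc. As subsets of simplices are simplices, the union
  over \<open>K\<close> reduces to a condition on this smallest set.\<close>

lemma topspace_moment_angle_complex_iff:
  "z \<in> topspace Z \<longleftrightarrow> z \<in> extensional V \<and> (\<forall>v\<in>V. cmod (z v) \<le> 1) \<and> {v \<in> V. cmod (z v) < 1} \<in> K"
  (is "?lhs \<longleftrightarrow> ?rhs")
proof
  assume ?lhs
  then obtain \<sigma> where z: "z \<in> extensional V" "\<forall>v\<in>V. cmod (z v) \<le> 1" and \<sigma>: "\<sigma> \<in> K"
    and z\<sigma>: "\<forall>v\<in>V. z v \<in> (if v \<in> \<sigma> then cball 0 1 else sphere 0 1)"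
    by (auto simp: moment_angle_complex_def PiE_iff)
  have "{v \<in> V. cmod (z v) < 1} \<subseteq> \<sigma>"
    using z\<sigma> by (auto split: if_splits)
  then show ?rhs
    using z \<sigma> K_down by blast
next
  assume R: ?rhs
  then have "z \<in> PiE V (\<lambda>i. if i \<in> {v \<in> V. cmod (z v) < 1} then cball 0 1 else sphere 0 1)"
    by (auto simp: PiE_iff)
  then have "z \<in> (\<Union>\<sigma>\<in>K. PiE V (\<lambda>i. if i \<in> \<sigma> then cball 0 1 else sphere 0 1))"
    using R by blast
  then show ?lhs
    using R by (simp add: moment_angle_complex_def PiE_iff)
qed

lemma continuous_map_moment_angle_complex:
  "continuous_map T Z f \<longleftrightarrow>
    (\<forall>v\<in>V. continuous_map T euclidean (\<lambda>x. f x v)) \<and> f \<in> topspace T \<rightarrow> topspace Z"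
  (is "?lhs \<longleftrightarrow> ?rhs")
proof
  assume L: ?lhs
  then have "f \<in> topspace T \<rightarrow> topspace Z"
    by (simp add: continuous_map_def)
  moreover have "continuous_map T (product_topology (\<lambda>i. top_of_set (cball 0 1)) V) f"
    using L by (simp add: moment_angle_complex_def continuous_map_in_subtopology)
  ultimately show ?rhs
    by (auto simp: continuous_map_componentwise continuous_map_in_subtopology)
next
  assume R: ?rhs
  then have "f x \<in> topspace Z" if "x \<in> topspace T" for x
    using that by blast
  then have "\<forall>x\<in>topspace T. f x \<in> extensional V \<and> (\<forall>v\<in>V. cmod (f x v) \<le> 1)"
    by (simp add: topspace_moment_angle_complex_iff)
  then have "continuous_map T (product_topology (\<lambda>i. top_of_set (cball 0 1)) V) f"
    using R by (auto simp: continuous_map_componentwise continuous_map_in_subtopology)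
  moreover have "f \<in> topspace T \<rightarrow> (\<Union>\<sigma>\<in>K. PiE V (\<lambda>i. if i \<in> \<sigma> then cball 0 1 else sphere 0 1))"
    using R unfolding moment_angle_complex_def by auto
  ultimately show ?lhs
    by (simp add: moment_angle_complex_def continuous_map_in_subtopology)
qed

lemma continuous_coordinate: "v \<in> V \<Longrightarrow> continuous_map Z euclidean (\<lambda>z. z v)"
  using continuous_map_moment_angle_complex [of Z id] by simp

text \<open>The nonvanishing condition matters for empty \<sigma>, where no inequality implies it.
  It permits the radial projection of the coordinates outside \<sigma> to the circle.\<close>

definition stratum :: "'v set \<Rightarrow> ('v \<Rightarrow> complex) set" where
  "stratum \<sigma> = {z \<in> topspace Z. (\<forall>j\<in>V - \<sigma>. z j \<noteq> 0) \<and> (\<forall>i\<in>\<sigma>. \<forall>j\<in>V - \<sigma>. cmod (z i) < cmod (z j))}"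

lemma openin_stratum:
  assumes "\<sigma> \<subseteq> V"
  shows "openin Z (stratum \<sigma>)"
proof -
  have norm: "continuous_map Z euclideanreal (\<lambda>z. cmod (z v))" if "v \<in> V" for v
    using continuous_coordinate [OF that] by (rule continuous_map_norm)
  have 1: "openin Z {z \<in> topspace Z. z j \<noteq> 0}" if "j \<in> V" for j
    using openin_continuous_map_preimage [OF continuous_coordinate [OF that], of "- {0}"]
    by (simp add: open_openin [symmetric] open_Compl)
  have 2: "openin Z {z \<in> topspace Z. cmod (z i) < cmod (z j)}" if "i \<in> V" "j \<in> V" for i j
    using openin_continuous_map_preimage [OF continuous_map_diff [OF norm [OF that(2)] norm [OF that(1)]], of "{0<..}"]
    by (simp add: open_openin [symmetric])
  have fin: "finite \<sigma>" "finite (V - \<sigma>)"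
    using finite_V assms finite_subset by auto
  have "stratum \<sigma> = ((\<Inter>j\<in>V - \<sigma>. {z \<in> topspace Z. z j \<noteq> 0}) \<inter> topspace Z) \<inter>
      ((\<Inter>(i, j)\<in>\<sigma> \<times> (V - \<sigma>). {z \<in> topspace Z. cmod (z i) < cmod (z j)}) \<inter> topspace Z)"
    by (auto simp: stratum_def)
  moreover have "openin Z ((\<Inter>j\<in>V - \<sigma>. {z \<in> topspace Z. z j \<noteq> 0}) \<inter> topspace Z)"
    using fin 1 by (intro openin_INT) auto
  moreover have "openin Z ((\<Inter>(i, j)\<in>\<sigma> \<times> (V - \<sigma>). {z \<in> topspace Z. cmod (z i) < cmod (z j)}) \<inter> topspace Z)"
    using fin 2 assms by (intro openin_INT) auto
  ultimately show ?thesis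
    by (simp only: openin_Int)
qed

text \<open>Distinct finite sets of equal size do not contain one another, and one element from each
  difference yields two contradictory inequalities.\<close>

lemma stratum_disjoint:
  assumes "\<sigma> \<subseteq> V" "\<tau> \<subseteq> V" "card \<sigma> = card \<tau>" "stratum \<sigma> \<inter> stratum \<tau> \<noteq> {}"
  shows "\<sigma> = \<tau>"
proof (rule ccontr)
  assume "\<sigma> \<noteq> \<tau>"
  have fin: "finite \<sigma>" "finite \<tau>"
    using finite_V assms finite_subset by auto
  have "\<not> \<sigma> \<subseteq> \<tau>" "\<not> \<tau> \<subseteq> \<sigma>"
    using \<open>\<sigma> \<noteq> \<tau>\<close> assms(3) fin by (metis card_subset_eq)+
  then obtain i j where "i \<in> \<sigma>" "i \<notin> \<tau>" "j \<in> \<tau>" "j \<notin> \<sigma>"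
    by blast
  moreover obtain z where "z \<in> stratum \<sigma>" "z \<in> stratum \<tau>"
    using assms(4) by blast
  ultimately have "cmod (z i) < cmod (z j)" "cmod (z j) < cmod (z i)"
    using assms(1,2) by (auto simp: stratum_def)
  then show False by simp
qed

lemma stratum_cover: "z \<in> topspace Z \<Longrightarrow> {v \<in> V. cmod (z v) < 1} \<in> K \<and> z \<in> stratum {v \<in> V. cmod (z v) < 1}"
  by (auto simp: stratum_def topspace_moment_angle_complex_iff not_less)

abbreviation base_point :: "'v \<Rightarrow> complex" where
  "base_point \<equiv> restrict (\<lambda>_. 1) V"

text \<open>Moving all coordinates at once could put several of them inside their discs, which the
  complex need not allow. Moving one coordinate along the chord to 1 puts at most this one inside,
  and single vertices are simplices.\<close>

lemma torus_contractible:
  assumes f: "continuous_map T Z f" and torus: "\<And>x v. x \<in> topspace T \<Longrightarrow> v \<in> V \<Longrightarrow> cmod (f x v) = 1"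
  shows "homotopic_with (\<lambda>_. True) T Z f (\<lambda>_. base_point)"
proof -
  have fS: "continuous_map T Z (\<lambda>x v. if v \<in> S then 1 else f x v) \<and>
    homotopic_with (\<lambda>_. True) T Z f (\<lambda>x v. if v \<in> S then 1 else f x v)" if "S \<subseteq> V" for S
    using finite_subset [OF that finite_V] that
  proof (induction S rule: finite_induct)
    case empty
    then show ?case using f by simp
  next
    case (insert w S)
    let ?f = "\<lambda>S x v. if v \<in> S then 1 else f x v"
    let ?H = "\<lambda>(t, x). (?f S x)(w := (1 - of_real t) * ?f S x w + of_real t)"
    have w: "w \<in> V" and S: "S \<subseteq> V"
      using insert by auto
    have cS: "continuous_map T Z (?f S)" and hS: "homotopic_with (\<lambda>_. True) T Z f (?f S)"
      using insert by auto
    have "continuous_map (cylinder T) Z ?H"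
      unfolding continuous_map_moment_angle_complex
    proof (intro conjI ballI)
      fix v assume "v \<in> V"
      have 1: "continuous_map (cylinder T) euclidean (\<lambda>z. ?f S (snd z) u)" if "u \<in> V" for u
        using continuous_map_compose [OF continuous_map_snd cS [unfolded continuous_map_moment_angle_complex, THEN conjunct1, rule_format, OF that], of "top_of_set {0..1}"]
        by (simp add: comp_def)
      have 2: "continuous_map (cylinder T) euclidean (\<lambda>z. of_real (fst z) :: complex)"
    by (rule continuous_map_of_real [OF continuous_map_into_fulltopology [OF continuous_map_fst]])
      show "continuous_map (cylinder T) euclidean (\<lambda>z. ?H z v)"
      proof (cases "v = w")
        case True
        have "continuous_map (cylinder T) euclidean (\<lambda>z. (1 - of_real (fst z)) * ?f S (snd z) w + of_real (fst z))"
          by (intro continuous_map_add continuous_map_mult continuous_map_diff 1 [OF w] 2) simp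
        then show ?thesis
          using True by (simp add: case_prod_unfold)
      next
        case False
        then show ?thesis
          using 1 [OF \<open>v \<in> V\<close>] by (simp add: case_prod_unfold)
      qed
    next
      have "?H (t, x) \<in> topspace Z" if t: "0 \<le> t" "t \<le> 1" and x: "x \<in> topspace T" for t x
      proof -
        have "?f S x \<in> topspace Z"
          using cS x by (auto simp: continuous_map_def)
        then have ext: "?f S x \<in> extensional V"
          by (simp add: topspace_moment_angle_complex_iff)
        have norm: "cmod (?f S x v) = 1" if "v \<in> V" for v
          using torus [OF x that] by simp
        have "cmod ((1 - of_real t) * ?f S x w + of_real t) \<le> cmod ((1 - of_real t) * ?f S x w) + cmod (of_real t :: complex)"
          by (rule norm_triangle_ineq)
        also have "cmod ((1 - of_real t) * ?f S x w) = 1 - t"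
          using norm [OF w] t norm_of_real [of "1 - t", where 'a = complex] by (simp add: norm_mult)
        finally have le: "cmod ((1 - of_real t) * ?f S x w + of_real t) \<le> 1"
          using t by simp
        have Hnorm: "cmod (?H (t, x) v) = 1" if "v \<in> V" "v \<noteq> w" for v
          using norm [OF that(1)] that(2) by simp
        have "{v \<in> V. cmod (?H (t, x) v) < 1} \<subseteq> {w}"
        proof (rule subsetI)
          fix v assume "v \<in> {v \<in> V. cmod (?H (t, x) v) < 1}"
          then have v: "v \<in> V" "cmod (?H (t, x) v) < 1"
            by (simp_all only: mem_Collect_eq)
          show "v \<in> {w}"
          proof (rule ccontr)
            assume "v \<notin> {w}"
            then have "v \<noteq> w" by blast
            from Hnorm [OF v(1) this] v(2) show False by linarith
          qed
        qed
        then have "{v \<in> V. cmod (?H (t, x) v) < 1} \<in> K"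
          using K_down [OF K_vertex [OF w]] by blast
        moreover have "?H (t, x) \<in> extensional V"
          using ext w by (auto simp: extensional_def)
        ultimately show ?thesis
          using le Hnorm unfolding topspace_moment_angle_complex_iff
          by (metis (no_types, lifting) case_prod_conv fun_upd_same order_refl)
      qed
      then show "?H \<in> topspace (cylinder T) \<rightarrow> topspace Z"
        by auto
    qed
    moreover have "?H (0, x) = ?f S x" "?H (1, x) = ?f (insert w S) x" for x
      by (auto simp: fun_eq_iff)
    ultimately have "homotopic_with (\<lambda>_. True) T Z (?f S) (?f (insert w S))"
      unfolding homotopic_with_def by (intro exI [of _ ?H]) auto
    then show ?case
      using homotopic_with_trans [OF hS] homotopic_with_imp_continuous_maps by blast
  qed
  have "(\<lambda>v. if v \<in> V then 1 else f x v) = base_point" if "x \<in> topspace T" for x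
  proof -
    have "f x \<in> topspace Z"
      using f that by (auto simp: continuous_map_def)
    then show ?thesis
      by (auto simp: fun_eq_iff topspace_moment_angle_complex_iff extensional_def)
  qed
  then show ?thesis
    using fS [of V] by (auto intro: homotopic_with_eq)
qed

lemma stratum_contractible:
  assumes \<sigma>: "\<sigma> \<in> K"
  shows "homotopic_with (\<lambda>_. True) (subtopology Z (stratum \<sigma>)) Z id (\<lambda>_. base_point)"
proof -
  let ?T = "subtopology Z (stratum \<sigma>)"
  define g where "g z v = (if v \<in> \<sigma> then 1 else if v \<in> V then z v / of_real (cmod (z v)) else undefined)" for z :: "'v \<Rightarrow> complex" and v
  let ?H = "\<lambda>(t, z) v. if v \<in> V then (1 - of_real t) * z v + of_real t * g z v else undefined"
  have \<sigma>V: "\<sigma> \<subseteq> V"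
    using K_subset \<sigma> by blast
  have nz: "z v \<noteq> 0" if "z \<in> stratum \<sigma>" "v \<in> V" "v \<notin> \<sigma>" for z v
    using that by (simp add: stratum_def)
  have g_cont: "continuous_map ?T euclidean (\<lambda>z. g z v)" if "v \<in> V" for v
  proof (cases "v \<in> \<sigma>")
    case True
    then show ?thesis by (simp add: g_def)
  next
    case False
    have c: "continuous_map ?T euclidean (\<lambda>z. z v)"
      using continuous_coordinate [OF that] by (rule continuous_map_from_subtopology)
    moreover have "continuous_map ?T euclidean (\<lambda>z. of_real (cmod (z v)) :: complex)"
      by (rule continuous_map_of_real [OF continuous_map_norm [OF c]])
    ultimately have "continuous_map ?T euclidean (\<lambda>z. z v / of_real (cmod (z v)))"
      using nz that False by (intro continuous_map_divide) auto
    then show ?thesis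
      using False that by (simp add: g_def)
  qed
  have g_norm: "cmod (g z v) = 1" if "z \<in> stratum \<sigma>" "v \<in> V" for z v
    using nz [OF that] that by (simp add: g_def norm_divide)
  have H: "continuous_map (cylinder ?T) Z ?H"
    unfolding continuous_map_moment_angle_complex
  proof (intro conjI ballI)
    fix v assume v: "v \<in> V"
    have 1: "continuous_map (cylinder ?T) euclidean (\<lambda>x. snd x v)"
      using continuous_map_compose [OF continuous_map_snd continuous_map_from_subtopology [OF continuous_coordinate [OF v]], of "top_of_set {0..1}"]
      by (simp add: comp_def)
    have 2: "continuous_map (cylinder ?T) euclidean (\<lambda>z. of_real (fst z) :: complex)"
      by (rule continuous_map_of_real [OF continuous_map_into_fulltopology [OF continuous_map_fst]])
    have 3: "continuous_map (cylinder ?T) euclidean (\<lambda>x. g (snd x) v)"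
      using continuous_map_compose [OF continuous_map_snd g_cont [OF v], of "top_of_set {0..1}"]
      by (simp add: comp_def)
    have "continuous_map (cylinder ?T) euclidean (\<lambda>x. (1 - of_real (fst x)) * snd x v + of_real (fst x) * g (snd x) v)"
      by (intro continuous_map_add continuous_map_mult continuous_map_diff 1 2 3) simp
    then show "continuous_map (cylinder ?T) euclidean (\<lambda>x. ?H x v)"
      using v by (simp add: case_prod_unfold)
  next
    have "?H (t, z) \<in> topspace Z" if t: "0 \<le> t" "t \<le> 1" and z: "z \<in> stratum \<sigma>" for t z
    proof -
      have zZ: "z \<in> topspace Z"
        using z by (simp add: stratum_def)
      let ?I = "{v \<in> V. cmod (z v) < 1}"
      have "cmod (?H (t, z) v) \<le> 1" if "v \<in> V" for v
      proof -
        have "cmod ((1 - of_real t) * z v + of_real t * g z v) \<le> cmod ((1 - of_real t) * z v) + cmod (of_real t * g z v)"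
          by (rule norm_triangle_ineq)
        also have "\<dots> = (1 - t) * cmod (z v) + t * cmod (g z v)"
          using t norm_of_real [of "1 - t", where 'a = complex] by (simp add: norm_mult)
        also have "\<dots> \<le> (1 - t) * 1 + t * 1"
          using t zZ g_norm [OF z that] that
          by (intro add_mono mult_left_mono) (auto simp: topspace_moment_angle_complex_iff)
        finally show ?thesis
          using that by simp
      qed
      moreover have "{v \<in> V. cmod (?H (t, z) v) < 1} \<in> K"
      \<comment> \<open>If all coordinates in \<sigma> are interior, those on the circle lie outside
        \<sigma> and do not move, so the set of interior coordinates does not grow. Otherwise some
        coordinate in \<sigma> has modulus 1, which nothing exceeds. Then \<sigma> is all of
        \<open>V\<close>, and every set of coordinates is a simplex.\<close>
      proof (cases "\<sigma> \<subseteq> ?I")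
        case True
        have "{v \<in> V. cmod (?H (t, z) v) < 1} \<subseteq> ?I"
        proof (rule subsetI)
          fix v assume "v \<in> {v \<in> V. cmod (?H (t, z) v) < 1}"
          then have v: "v \<in> V" and lt: "cmod (?H (t, z) v) < 1"
            by (simp_all only: mem_Collect_eq)
          show "v \<in> ?I"
          proof (rule ccontr)
            assume "v \<notin> ?I"
            with v have not: "\<not> cmod (z v) < 1"
              by simp
            then have one: "cmod (z v) = 1"
              using zZ v by (force simp: topspace_moment_angle_complex_iff)
            have "v \<notin> \<sigma>"
              using True not by blast
            then have "?H (t, z) v = z v"
              using one v by (simp add: g_def algebra_simps)
            then show False using lt one by simp
          qed
        qed
        moreover have "?I \<in> K"
          using zZ by (simp add: topspace_moment_angle_complex_iff)
        ultimately show ?thesis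
          by (rule K_down [rotated])
      next
        case False
        then obtain i where i: "i \<in> \<sigma>" "\<not> cmod (z i) < 1"
          using \<sigma>V by auto
        have "V - \<sigma> = {}"
        proof (rule ccontr)
          assume "V - \<sigma> \<noteq> {}"
          then obtain j where j: "j \<in> V - \<sigma>" by blast
          then have "cmod (z i) < cmod (z j)" "cmod (z j) \<le> 1"
            using z i zZ by (auto simp: stratum_def topspace_moment_angle_complex_iff)
          with i show False by simp
        qed
        then have "{v \<in> V. cmod (?H (t, z) v) < 1} \<subseteq> \<sigma>"
          by blast
        then show ?thesis
          using K_down [OF \<sigma>] by blast
      qed
      ultimately show ?thesis
        unfolding topspace_moment_angle_complex_iff by (simp add: extensional_def)
    qed
    then show "?H \<in> topspace (cylinder ?T) \<rightarrow> topspace Z"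
      by auto
  qed
  have H0: "?H (0, z) = z" if "z \<in> topspace ?T" for z
    using that by (auto simp: fun_eq_iff topspace_moment_angle_complex_iff extensional_def)
  have H1: "?H (1, z) = g z" for z
    using \<sigma>V by (auto simp: fun_eq_iff g_def)
  have "homotopic_with (\<lambda>_. True) ?T Z id g"
    using H H0 H1 by (subst homotopic_with) auto
  moreover from this have "homotopic_with (\<lambda>_. True) ?T Z g (\<lambda>_. base_point)"
    using g_norm by (intro torus_contractible) (auto dest: homotopic_with_imp_continuous_maps)
  ultimately show ?thesis
    by (rule homotopic_with_trans)
qed

theorem moment_angle_cup_products_vanish:
  assumes dim: "\<And>\<sigma>. \<sigma> \<in> K \<Longrightarrow> card \<sigma> \<le> N" and x0: "x0 \<in> topspace Z"
    and as: "set as \<subseteq> reduced_cohomology Z x0" and len: "length as > N"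
  shows "foldr (\<otimes>\<^bsub>cohomology_ring Z\<^esub>) as \<one>\<^bsub>cohomology_ring Z\<^esub> = \<zero>\<^bsub>cohomology_ring Z\<^esub>"
proof -
  define U where "U k = (\<Union>\<sigma>\<in>{\<sigma> \<in> K. card \<sigma> = k}. stratum \<sigma>)" for k
  have open_U: "openin Z (U k)" for k
    unfolding U_def using openin_stratum K_subset by (intro openin_Union) auto
  have cover: "\<exists>k\<le>N. z \<in> U k" if "z \<in> topspace Z" for z
    using stratum_cover [OF that] dim unfolding U_def by blast
  have base: "homotopic_with (\<lambda>_. True) (subtopology Z (U k)) Z id (\<lambda>_. base_point)" for k
    unfolding U_def
  proof (rule homotopic_with_disjoint_open_union)
    fix \<sigma> \<tau> assume "\<sigma> \<in> {\<sigma> \<in> K. card \<sigma> = k}" "\<tau> \<in> {\<sigma> \<in> K. card \<sigma> = k}" "stratum \<sigma> \<inter> stratum \<tau> \<noteq> {}"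
    then show "\<sigma> = \<tau>"
      using K_subset by (intro stratum_disjoint) auto
  qed (use openin_stratum K_subset stratum_contractible in auto)
  \<comment> \<open>The contractions end at \<open>base_point\<close> instead of \<open>x0\<close>.
    The contraction of the set that contains \<open>x0\<close> yields a path between these two
    points.\<close>
  obtain k0 where k0: "x0 \<in> U k0"
    using cover [OF x0] by blast
  have "homotopic_with (\<lambda>_. True) (subtopology Z (U k)) Z (id \<circ> (\<lambda>_. x0)) ((\<lambda>_. base_point) \<circ> (\<lambda>_. x0))" for k
    using base [of k0] by (rule homotopic_with_compose_continuous_map_right) (use k0 x0 in auto)
  then have pt: "homotopic_with (\<lambda>_. True) (subtopology Z (U k)) Z (\<lambda>_. x0) (\<lambda>_. base_point)" for k
    by (simp add: comp_def)
  have "homotopic_with (\<lambda>_. True) (subtopology Z (U k)) Z id (\<lambda>_. x0)" for k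
    using homotopic_with_trans [OF base [of k]] pt [of k] homotopic_with_symD by blast
  then show ?thesis
    using open_U cover by (intro reduced_cohomology_products_vanish [OF x0 _ _ _ as len, of U]) blast+
qed

end

section \<open>Cup length of a moment angle complex, and cross polytopes\<close>

context finite_complex
begin

lemma cup_length_le:
  assumes dim: "\<And>\<sigma>. \<sigma> \<in> K \<Longrightarrow> card \<sigma> \<le> N" and x0: "x0 \<in> topspace Z"
  shows "cup_length Z x0 \<le> enat N"
  unfolding cup_length_def
proof (rule Sup_least, clarify)
  fix as assume "set as \<subseteq> reduced_cohomology Z x0"
    "foldr (\<otimes>\<^bsub>cohomology_ring Z\<^esub>) as \<one>\<^bsub>cohomology_ring Z\<^esub> \<noteq> \<zero>\<^bsub>cohomology_ring Z\<^esub>"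
  then show "enat (length as) \<le> enat N"
    using moment_angle_cup_products_vanish [OF dim x0] by (metis enat_ord_simps(1) not_le)
qed

text \<open>Two vertices without their edge have the boundary of a product of two discs, a
  three-sphere, as moment angle complex. The cross polytope is the join of \<open>n\<close> such
  pairs and gives the product of the spheres. The four coordinates of a pair cannot all vanish on
  the complex: both entries would then be interior, and the missing edge would be a simplex.\<close>

lemma sphere_coordinates_of_cross_polytope:
  fixes e f :: "nat \<Rightarrow> 'v"
  assumes e: "\<And>i. i < n \<Longrightarrow> e i \<in> V" and f: "\<And>i. i < n \<Longrightarrow> f i \<in> V"
    and inj_e: "inj_on e {..<n}" and inj_f: "inj_on f {..<n}"
    and ef: "\<And>i j. i < n \<Longrightarrow> j < n \<Longrightarrow> e i \<noteq> f j"
    and antipodal: "\<And>i. i < n \<Longrightarrow> {e i, f i} \<notin> K"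
    and face: "\<And>S. \<lbrakk>S \<subseteq> e ` {..<n} \<union> f ` {..<n}; \<And>i. i < n \<Longrightarrow> \<not> {e i, f i} \<subseteq> S\<rbrakk> \<Longrightarrow> S \<in> K"
  shows "\<exists>coord embed. sphere_coordinates Z n 3 coord embed"
proof -
  define coord where "coord i l z = (if l = 0 then Re (z (e i)) else if l = 1 then Im (z (e i))
    else if l = 2 then Re (z (f i)) else Im (z (f i)))" for i l :: nat and z :: "'v \<Rightarrow> complex"
  define a where "a x i = of_real (x i 0) + \<i> * of_real (x i 1)" for x :: "nat \<Rightarrow> nat \<Rightarrow> real" and i
  define b where "b x i = of_real (x i 2) + \<i> * of_real (x i 3)" for x :: "nat \<Rightarrow> nat \<Rightarrow> real" and i
  \<comment> \<open>Division by the larger modulus moves a nonzero pair to the boundary of the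
    product of discs. It is a positive factor, so all signs are preserved.\<close>
  define M where "M x i = max (cmod (a x i)) (cmod (b x i))" for x i
  define embed where "embed x v = (if v \<in> e ` {..<n} then a x (inv_into {..<n} e v) / of_real (M x (inv_into {..<n} e v))
    else if v \<in> f ` {..<n} then b x (inv_into {..<n} f v) / of_real (M x (inv_into {..<n} f v))
    else if v \<in> V then 1 else undefined)" for x v
  define W :: "(nat \<Rightarrow> nat \<Rightarrow> real) set" where "W = {x. \<forall>i<n. \<exists>l\<le>3. x i l \<noteq> 0}"
  have Re_a: "Re (a x i) = x i 0" "Im (a x i) = x i 1" "Re (b x i) = x i 2" "Im (b x i) = x i 3" for x i
    by (simp_all add: a_def b_def)
  have le3: "l \<le> 3 \<longleftrightarrow> l = 0 \<or> l = 1 \<or> l = 2 \<or> l = 3" for l :: nat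
    by auto
  have M_pos: "M x i > 0" if x: "x \<in> W" and i: "i < n" for x i
  proof -
    obtain l where "l \<le> 3" "x i l \<noteq> 0"
      using x i by (auto simp: W_def)
    then have "a x i \<noteq> 0 \<or> b x i \<noteq> 0"
      using Re_a [of x i] by (auto simp: le3 complex_eq_iff)
    then show ?thesis
      by (auto simp: M_def less_max_iff_disj)
  qed
  have f_notin: "f i \<notin> e ` {..<n}" if "i < n" for i
    using ef [OF _ that] by force
  have embed_e: "embed x (e i) = a x i / of_real (M x i)" and embed_f: "embed x (f i) = b x i / of_real (M x i)" if "i < n" for x i
    using that inj_e inj_f f_notin by (simp_all add: embed_def)
  have embed_other: "embed x v = 1" if "v \<in> V" "v \<notin> e ` {..<n}" "v \<notin> f ` {..<n}" for x v
    using that by (simp add: embed_def)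
  have norm_e: "cmod (embed x (e i)) \<le> 1" "cmod (embed x (f i)) \<le> 1"
    "cmod (embed x (e i)) = 1 \<or> cmod (embed x (f i)) = 1" if "x \<in> W" "i < n" for x i
  proof -
    have "cmod (embed x (e i)) = cmod (a x i) / M x i" "cmod (embed x (f i)) = cmod (b x i) / M x i"
      using M_pos [OF that] that by (simp_all add: embed_e embed_f norm_divide)
    moreover have "cmod (a x i) \<le> M x i" "cmod (b x i) \<le> M x i" "M x i = cmod (a x i) \<or> M x i = cmod (b x i)"
      by (auto simp: M_def)
    ultimately show "cmod (embed x (e i)) \<le> 1" "cmod (embed x (f i)) \<le> 1"
        "cmod (embed x (e i)) = 1 \<or> cmod (embed x (f i)) = 1"
      using M_pos [OF that] by auto
  qed
  have embed_Z: "embed x \<in> topspace Z" if x: "x \<in> W" for x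
  proof -
    have "embed x \<in> extensional V"
      unfolding extensional_def
    proof (intro CollectI allI impI)
      fix v assume v: "v \<notin> V"
      then have "v \<notin> e ` {..<n}" "v \<notin> f ` {..<n}"
        using e f by blast+
      with v show "embed x v = undefined"
        by (simp add: embed_def)
    qed
    moreover have "cmod (embed x v) \<le> 1" if "v \<in> V" for v
    proof -
      consider i where "i < n" "v = e i" | i where "i < n" "v = f i" | "v \<notin> e ` {..<n}" "v \<notin> f ` {..<n}"
        by blast
      then show ?thesis
        by cases (simp_all add: norm_e [OF x] embed_other [OF that])
    qed
    moreover have "{v \<in> V. cmod (embed x v) < 1} \<in> K"
    proof (rule face)
      show "{v \<in> V. cmod (embed x v) < 1} \<subseteq> e ` {..<n} \<union> f ` {..<n}"
        using embed_other by (metis (mono_tags, lifting) UnI1 UnI2 less_irrefl mem_Collect_eq norm_one subsetI)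
      show "\<not> {e i, f i} \<subseteq> {v \<in> V. cmod (embed x v) < 1}" if "i < n" for i
        using norm_e(3) [OF x that] by auto
    qed
    ultimately show ?thesis
      by (simp add: topspace_moment_angle_complex_iff)
  qed
  have cont_x: "continuous_on W (\<lambda>x. x i l)" for i l
    using continuous_on_product_then_coordinatewise [OF continuous_on_product_then_coordinatewise
        [OF continuous_on_id [of W]]] by this
  have cont_ab: "continuous_on W (\<lambda>x. a x i)" "continuous_on W (\<lambda>x. b x i)" for i
    unfolding a_def b_def
    by (intro continuous_on_add continuous_on_mult continuous_on_const continuous_on_of_real cont_x)+
  have cont_M: "continuous_on W (\<lambda>x. M x i)" for i
    unfolding M_def by (intro continuous_on_max continuous_on_norm cont_ab)
  have cont_embed: "continuous_on W (\<lambda>x. embed x v)" if "v \<in> V" for v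
  proof -
    consider i where "i < n" "v = e i" | i where "i < n" "v = f i" | "v \<notin> e ` {..<n}" "v \<notin> f ` {..<n}"
      by auto
    then show ?thesis
    proof cases
      case 1
      then show ?thesis
        using M_pos by (simp add: embed_e) (intro continuous_on_divide continuous_on_of_real cont_ab cont_M; force)
    next
      case 2
      then show ?thesis
        using M_pos by (simp add: embed_f) (intro continuous_on_divide continuous_on_of_real cont_ab cont_M; force)
    next
      case 3
      then show ?thesis
        using embed_other [OF that 3] by simp
    qed
  qed
  have "sphere_coordinates Z n 3 coord embed"
  proof
    show "continuous_map Z euclideanreal (coord i l)" if "i < n" for i l
    proof -
      have "continuous_map Z euclideanreal (\<lambda>z. Re (z (e i)))" "continuous_map Z euclideanreal (\<lambda>z. Im (z (e i)))"
        "continuous_map Z euclideanreal (\<lambda>z. Re (z (f i)))" "continuous_map Z euclideanreal (\<lambda>z. Im (z (f i)))"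
        using continuous_coordinate [OF e [OF that]] continuous_coordinate [OF f [OF that]]
        by (simp_all add: continuous_map_atin tendsto_Re tendsto_Im)
      then show ?thesis
        unfolding coord_def by (cases "l = 0"; cases "l = 1"; cases "l = 2") auto
    qed
    show "\<exists>l\<le>3. coord i l z \<noteq> 0" if z: "z \<in> topspace Z" and i: "i < n" for z i
    proof (rule ccontr)
      assume "\<not> ?thesis"
      then have "coord i 0 z = 0" "coord i 1 z = 0" "coord i 2 z = 0" "coord i 3 z = 0"
        by auto
      then have "z (e i) = 0" "z (f i) = 0"
        by (auto simp: coord_def complex_eq_iff)
      then have "{e i, f i} \<subseteq> {v \<in> V. cmod (z v) < 1}"
        using e [OF i] f [OF i] by auto
      moreover have "{v \<in> V. cmod (z v) < 1} \<in> K"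
        using z by (simp add: topspace_moment_angle_complex_iff)
      ultimately show False
        using K_down antipodal [OF i] by blast
    qed
    show "continuous_map (top_of_set {x. \<forall>i<n. \<exists>l\<le>3. x i l \<noteq> 0}) Z embed"
      unfolding W_def [symmetric] continuous_map_moment_angle_complex
      using cont_embed embed_Z by auto
    show "sgn (coord i l (embed x)) = sgn (x i l)" if "\<forall>i<n. \<exists>l\<le>3. x i l \<noteq> 0" "i < n" "l \<le> 3" for x i l
    proof -
      have "M x i > 0"
        using M_pos that by (simp add: W_def)
      then show ?thesis
        using that(3) unfolding le3
        by (auto simp: coord_def embed_e [OF that(2)] embed_f [OF that(2)] Re_a sgn_divide)
    qed
  qed
  then show ?thesis by blast
qed

end

section \<open>Linearly independent sets over a prime field\<close>

locale prime_coord_space =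
  fixes p n :: nat
  assumes prime_p: "prime p"
begin

sublocale R: residues_prime p "prime_field p"
  using prime_p by unfold_locales auto

sublocale M: module "prime_field p" "coord_space p n"
  unfolding coord_space_def by (rule R.func_space_is_module)

abbreviation vectors where "vectors \<equiv> carrier (coord_space p n)"

lemma vectors_eq: "vectors = {..<n} \<rightarrow>\<^sub>E {0..int p - 1}"
  by (simp add: coord_space_def R.func_space_def R.res_carrier_eq)

lemma finite_vectors: "finite vectors"
  by (simp add: vectors_eq finite_PiE)

lemma card_vectors: "card vectors = p ^ n"
  by (simp add: vectors_eq card_PiE)

lemma zero_vector: "\<zero>\<^bsub>coord_space p n\<^esub> = restrict (\<lambda>_. 0) {..<n}"
  by (simp add: coord_space_def R.func_space_def R.res_zero_eq)

lemma lincomb_coordinate: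
  assumes "finite A" "A \<subseteq> vectors" "a \<in> A \<rightarrow> carrier (prime_field p)" "i < n"
  shows "M.lincomb a A i = (\<Sum>v\<in>A. a v * v i) mod int p"
  using assms
proof (induction A rule: finite_induct)
  case empty
  then show ?case by (simp add: M.lincomb_def zero_vector)
next
  case (insert w A)
  have "M.lincomb a (insert w A) = a w \<odot>\<^bsub>coord_space p n\<^esub> w \<oplus>\<^bsub>coord_space p n\<^esub> M.lincomb a A"
    unfolding M.lincomb_def using insert by (intro M.finsum_insert) auto
  then have "M.lincomb a (insert w A) i = (a w * w i mod int p + M.lincomb a A i) mod int p"
    using insert.prems by (simp add: coord_space_def R.func_space_def R.res_add_eq R.res_mult_eq)
  also have "M.lincomb a A i = (\<Sum>v\<in>A. a v * v i) mod int p"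
    using insert by auto
  finally show ?case
    using insert by (simp add: mod_add_eq)
qed

lemma lincomb_eq_zero_iff:
  assumes "finite A" "A \<subseteq> vectors" "a \<in> A \<rightarrow> carrier (prime_field p)"
  shows "M.lincomb a A = \<zero>\<^bsub>coord_space p n\<^esub> \<longleftrightarrow> (\<forall>i<n. int p dvd (\<Sum>v\<in>A. a v * v i))"
proof -
  have "M.lincomb a A \<in> vectors"
    using assms by (intro M.lincomb_closed) auto
  then have "M.lincomb a A \<in> extensional {..<n}"
    by (auto simp: vectors_eq PiE_iff)
  then have "M.lincomb a A = \<zero>\<^bsub>coord_space p n\<^esub> \<longleftrightarrow> (\<forall>i<n. M.lincomb a A i = 0)"
    unfolding zero_vector by (auto simp: fun_eq_iff extensional_def)
  then show ?thesis
    using lincomb_coordinate [OF assms] by (simp add: dvd_eq_mod_eq_0)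
qed

lemma residue_dvd: "c \<in> carrier (prime_field p) \<Longrightarrow> int p dvd c \<Longrightarrow> c = 0"
  by (auto simp: R.res_carrier_eq zdvd_not_zless dest: zdvd_imp_le)

lemma indepI:
  assumes S: "S \<subseteq> vectors"
    and indep: "\<And>A a v. \<lbrakk>finite A; A \<subseteq> S; a \<in> A \<rightarrow> carrier (prime_field p); v \<in> A;
      \<forall>i<n. int p dvd (\<Sum>v\<in>A. a v * v i)\<rbrakk> \<Longrightarrow> int p dvd a v"
  shows "S \<in> indep_complex p n"
proof -
  have False if A: "finite A" "A \<subseteq> S" "a \<in> A \<rightarrow> carrier (prime_field p)" "M.lincomb a A = \<zero>\<^bsub>coord_space p n\<^esub>"
    "v \<in> A" "a v \<noteq> \<zero>\<^bsub>prime_field p\<^esub>" for A a v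
  proof -
    have "int p dvd a v"
      using A S lincomb_eq_zero_iff [of A a] by (intro indep [of A a]) auto
    then show False
      using A residue_dvd [of "a v"] by (auto simp: R.res_zero_eq)
  qed
  then show ?thesis
    using S unfolding indep_complex_def M.lin_dep_def by blast
qed

text \<open>Counting takes the place of dimension theory: independence makes the
  \<open>p ^ card S\<close> linear combinations of \<open>S\<close> distinct, and there are only
  \<open>p ^ n\<close> vectors.\<close>

lemma indep_complex_card:
  assumes "S \<in> indep_complex p n"
  shows "card S \<le> n"
proof -
  have S: "S \<subseteq> vectors" and indep: "\<not> M.lin_dep S"
    using assms by (auto simp: indep_complex_def)
  have fin: "finite S"
    using S finite_vectors finite_subset by blast
  let ?C = "S \<rightarrow>\<^sub>E carrier (prime_field p)"
  have "inj_on (\<lambda>a. M.lincomb a S) ?C"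
  proof (rule inj_onI)
    fix a b assume a: "a \<in> ?C" and b: "b \<in> ?C" and eq: "M.lincomb a S = M.lincomb b S"
    have ab: "a \<in> S \<rightarrow> carrier (prime_field p)" "b \<in> S \<rightarrow> carrier (prime_field p)"
      using a b by auto
    have "M.lincomb (\<lambda>v. a v \<ominus>\<^bsub>prime_field p\<^esub> b v) S = M.lincomb a S \<ominus>\<^bsub>coord_space p n\<^esub> M.lincomb b S"
      by (rule M.lincomb_diff [OF fin S ab])
    also have "\<dots> = \<zero>\<^bsub>coord_space p n\<^esub>"
      unfolding eq using M.lincomb_closed [OF S ab(2)] by (simp add: a_minus_def M.r_neg)
    finally have zero: "M.lincomb (\<lambda>v. a v \<ominus>\<^bsub>prime_field p\<^esub> b v) S = \<zero>\<^bsub>coord_space p n\<^esub>" .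
    have "a v = b v" if v: "v \<in> S" for v
    proof (rule ccontr)
      assume "a v \<noteq> b v"
      then have "a v \<ominus>\<^bsub>prime_field p\<^esub> b v \<noteq> \<zero>\<^bsub>prime_field p\<^esub>"
        using ab v R.r_right_minus_eq by blast
      moreover have "(\<lambda>v. a v \<ominus>\<^bsub>prime_field p\<^esub> b v) \<in> S \<rightarrow> carrier (prime_field p)"
        using ab by auto
      ultimately have "M.lin_dep S"
        using fin v zero unfolding M.lin_dep_def by blast
      with indep show False ..
    qed
    then show "a = b"
      using a b by (auto intro: PiE_ext)
  qed
  moreover have "(\<lambda>a. M.lincomb a S) ` ?C \<subseteq> vectors"
    using M.lincomb_closed [OF S] by auto
  ultimately have "card ?C \<le> card vectors"
    using finite_vectors by (metis card_inj_on_le)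
  then have "p ^ card S \<le> p ^ n"
    using fin by (simp add: card_vectors card_PiE R.res_carrier_eq)
  then show ?thesis
    by (rule power_le_imp_le_exp [OF prime_gt_1_nat [OF prime_p]])
qed

lemma singleton_indep:
  assumes "v \<in> nonzero_vectors p n"
  shows "{v} \<in> indep_complex p n"
proof (rule indepI)
  have v: "v \<in> vectors" "v \<noteq> \<zero>\<^bsub>coord_space p n\<^esub>"
    using assms by (auto simp: nonzero_vectors_def)
  then show "{v} \<subseteq> vectors" by simp
  have "\<exists>i<n. v i \<noteq> 0"
  proof (rule ccontr)
    assume "\<not> ?thesis"
    then have "v = \<zero>\<^bsub>coord_space p n\<^esub>"
      using v(1) unfolding zero_vector vectors_eq by (auto simp: fun_eq_iff PiE_iff extensional_def)
    with v(2) show False ..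
  qed
  then obtain i where i: "i < n" "v i \<noteq> 0" by blast
  have vi: "v i \<in> carrier (prime_field p)"
    using PiE_mem [OF v(1) [unfolded vectors_eq], of i] i by (simp add: R.res_carrier_eq)
  fix A a w assume A: "A \<subseteq> {v}" "w \<in> A" "\<forall>i<n. int p dvd (\<Sum>v\<in>A. a v * v i)"
  then have "int p dvd a v * v i" "w = v"
    using i by (auto simp: subset_singleton_iff)
  moreover have "\<not> int p dvd v i"
    using residue_dvd [OF vi] i by blast
  ultimately show "int p dvd a w"
    using prime_p by (auto simp: prime_dvd_mult_iff)
qed

lemma finite_complex_indep: "finite_complex (nonzero_vectors p n) (indep_complex p n)"
proof
  show "finite (nonzero_vectors p n)"
    using finite_vectors by (simp add: nonzero_vectors_def)
  \<comment> \<open>Over a ring with a nonzero element the zero vector belongs to no independent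
    set.\<close>
  have "carrier (prime_field p) \<noteq> {\<zero>\<^bsub>prime_field p\<^esub>}"
    using R.zero_not_one by (metis R.one_closed singletonD)
  then show "\<sigma> \<subseteq> nonzero_vectors p n" if "\<sigma> \<in> indep_complex p n" for \<sigma>
    using that M.zero_nin_lin_indpt [of \<sigma>] by (auto simp: indep_complex_def nonzero_vectors_def)
  show "\<tau> \<in> indep_complex p n" if "\<sigma> \<in> indep_complex p n" "\<tau> \<subseteq> \<sigma>" for \<sigma> \<tau>
    using that M.supset_ld_is_ld [of \<tau> \<sigma>] by (auto simp: indep_complex_def)
  show "{v} \<in> indep_complex p n" if "v \<in> nonzero_vectors p n" for v
    using that by (rule singleton_indep)
qed

section \<open>The cross polytope of the unit vectors and their doubles\<close>

definition unit_multiple :: "int \<Rightarrow> nat \<Rightarrow> nat \<Rightarrow> int" where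
  "unit_multiple c i = (\<lambda>j\<in>{..<n}. if j = i then c else 0)"

context
  assumes p2: "p > 2"
begin

lemma unit_multiple_vector: "c \<in> {1, 2} \<Longrightarrow> i < n \<Longrightarrow> unit_multiple c i \<in> nonzero_vectors p n"
proof -
  assume c: "c \<in> {1, 2}" and i: "i < n"
  have "unit_multiple c i \<in> vectors"
    using c p2 by (auto simp: unit_multiple_def vectors_eq)
  moreover have "unit_multiple c i \<noteq> \<zero>\<^bsub>coord_space p n\<^esub>"
    using c i by (auto simp: unit_multiple_def zero_vector fun_eq_iff)
  ultimately show ?thesis
    by (simp add: nonzero_vectors_def)
qed

lemma unit_multiple_eq_iff:
  "i < n \<Longrightarrow> j < n \<Longrightarrow> c \<noteq> 0 \<Longrightarrow> unit_multiple c i = unit_multiple d j \<longleftrightarrow> i = j \<and> c = d"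
  by (auto simp: unit_multiple_def fun_eq_iff)

lemma antipodal_dependent:
  assumes i: "i < n"
  shows "{unit_multiple 1 i, unit_multiple 2 i} \<notin> indep_complex p n"
proof -
  let ?e = "unit_multiple 1 i" and ?f = "unit_multiple 2 i"
  have ne: "?e \<noteq> ?f"
    using unit_multiple_eq_iff [OF i i, of 1 2] by simp
  \<comment> \<open>The residue \<open>int p - 2\<close> stands for -2. Added to the double, this
    multiple of the unit vector gives \<open>p\<close> in coordinate \<open>i\<close>.\<close>
  define a where "a v = (if v = ?f then 1 else int p - 2)" for v
  have V: "{?e, ?f} \<subseteq> vectors"
    using unit_multiple_vector [OF _ i] by (auto simp: nonzero_vectors_def)
  have a: "a \<in> {?e, ?f} \<rightarrow> carrier (prime_field p)"
    using p2 by (auto simp: a_def R.res_carrier_eq)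
  have "M.lincomb a {?e, ?f} = \<zero>\<^bsub>coord_space p n\<^esub>"
    unfolding lincomb_eq_zero_iff [OF _ V a, simplified]
    using ne by (auto simp: a_def) (auto simp: unit_multiple_def)
  moreover have "a ?f \<noteq> \<zero>\<^bsub>prime_field p\<^esub>"
    by (simp add: a_def R.res_zero_eq)
  ultimately have "M.lin_dep {?e, ?f}"
    by (intro M.lin_dep_crit [OF _ subset_refl a, of ?f]) simp_all
  then show ?thesis
    by (simp add: indep_complex_def)
qed

text \<open>\<open>S\<close> has at most one of the two vectors on each axis, so coordinate
  \<open>i\<close> is 0 for all its members except the vector \<open>v\<close> on axis
  \<open>i\<close>. This coordinate isolates the coefficient of \<open>v\<close>, up to a factor 1
  or 2 that \<open>p\<close> does not divide.\<close>

lemma cross_polytope_face: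
  assumes S: "S \<subseteq> unit_multiple 1 ` {..<n} \<union> unit_multiple 2 ` {..<n}"
    and face: "\<And>i. i < n \<Longrightarrow> \<not> {unit_multiple 1 i, unit_multiple 2 i} \<subseteq> S"
  shows "S \<in> indep_complex p n"
proof (rule indepI)
  show "S \<subseteq> vectors"
    using S unit_multiple_vector by (auto simp: nonzero_vectors_def)
  fix A a v
  assume A: "finite A" "A \<subseteq> S" and v: "v \<in> A" and dvd: "\<forall>i<n. int p dvd (\<Sum>v\<in>A. a v * v i)"
  obtain c i where c: "c \<in> {1, 2}" and i: "i < n" and vc: "v = unit_multiple c i"
    using S A v by blast
  have other: "w i = 0" if w: "w \<in> A - {v}" for w
  proof -
    obtain d j where d: "d \<in> {1, 2}" "j < n" "w = unit_multiple d j"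
      using S A w by blast
    have "j \<noteq> i"
    proof
      assume "j = i"
      then have "d \<noteq> c"
        using d(3) vc w by blast
      with c d(1) have "(c = 1 \<and> d = 2) \<or> (c = 2 \<and> d = 1)"
        by blast
      moreover have "v \<in> S" "w \<in> S"
        using A(2) v w by blast+
      ultimately have "{unit_multiple 1 i, unit_multiple 2 i} \<subseteq> S"
        using d(3) vc \<open>j = i\<close> by (elim disjE) simp_all
      with face [OF i] show False ..
    qed
    then show ?thesis
      using d i by (simp add: unit_multiple_def)
  qed
  have "(\<Sum>w\<in>A - {v}. a w * w i) = 0"
    using other by (intro sum.neutral) auto
  then have "(\<Sum>v\<in>A. a v * v i) = a v * v i"
    using A v by (simp add: sum.remove [of A v])
  moreover have "v i = c"
    using i by (simp add: vc unit_multiple_def)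
  ultimately have "int p dvd a v * c"
    using dvd [rule_format, OF i] by simp
  moreover have "\<not> int p dvd c"
    using c p2 by (auto dest: zdvd_imp_le)
  ultimately show "int p dvd a v"
    using prime_p by (auto simp: prime_dvd_mult_iff)
qed

end

end

theorem proposition4p2:
  fixes n p :: nat and x0 :: "(nat \<Rightarrow> int) \<Rightarrow> complex"
  assumes "n \<ge> 1" and "prime p" and "p > 2"
    and "x0 \<in> topspace (moment_angle_complex (nonzero_vectors p n) (indep_complex p n))"
  shows "cup_length (moment_angle_complex (nonzero_vectors p n) (indep_complex p n)) x0 = enat n"
proof -
  interpret prime_coord_space p n
    using \<open>prime p\<close> by unfold_locales
  interpret C: finite_complex "nonzero_vectors p n" "indep_complex p n"
    by (rule finite_complex_indep)
  have "\<exists>coord embed. sphere_coordinates C.Z n 3 coord embed"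
  proof (rule C.sphere_coordinates_of_cross_polytope)
    show "unit_multiple 1 i \<in> nonzero_vectors p n" "unit_multiple 2 i \<in> nonzero_vectors p n" if "i < n" for i
      using that \<open>p > 2\<close> by (auto intro: unit_multiple_vector)
    show "inj_on (unit_multiple 1) {..<n}" "inj_on (unit_multiple 2) {..<n}"
      using unit_multiple_eq_iff [OF \<open>p > 2\<close>] by (auto intro!: inj_onI)
    show "unit_multiple 1 i \<noteq> unit_multiple 2 j" if "i < n" "j < n" for i j
      using unit_multiple_eq_iff [OF \<open>p > 2\<close> that] by simp
  qed (use antipodal_dependent cross_polytope_face \<open>p > 2\<close> in auto)
  then obtain coord embed where "sphere_coordinates C.Z n 3 coord embed"
    by blast
  then interpret S: sphere_coordinates C.Z n 3 coord embed .
  show ?thesis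
    using C.cup_length_le [OF indep_complex_card assms(4)] S.cup_length_ge [OF _ assms(4,1)]
    by (intro antisym) auto
qed

end
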